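(* Let $p,q\in\mathbb C[x]$ be polynomials and consider the Abel equation $y'=p(x)y^2+q(x)y^3$. Let $s$ be a path in $\mathbb C$ joining two points $a$ and $b$, where $b$ is different from all the zeroes of $q$, and let the initial value $y_a^0\in\mathbb C$ be given. Assume that the solution $y(y_a^0,x)$ satisfying $y(y_a^0,a)=y_a^0$ can be analytically continued along $s$ from a neighborhood of $a$ to each point of $s$ except the endpoint $b$, where this solution has a singularity. Let $\gamma$ be the germ at $y_a^0$ of a real curve defined in the context. Then for each $y_a$ in a neighborhood of $y_a^0$ such that $y_a\notin\gamma$, the germ at $y_a$ of the Poincaré mapping $\phi=\phi_{a,b,s,y_a}$ along the path $s$ is defined and regular. In a punctured neighborhood $U_0$ of $y_a^0$ these germs can be analytically continued across $\gamma$ to form a double-valued regular function $\phi$ in $U_0$, which can be represented by a Puiseux series $$\phi(y_a)=y(b)=\frac{1}{\sqrt{y_a-y_a^0}}\sum_{k=0}^{\infty}\nu_k\,(y_a-y_a^0)^{k/2},\qquad \nu_0\neq 0,$$ convergent in $U_0$.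
   Context: All variables are complex. For $y_a\in\mathbb C$, $y(y_a,x)$ denotes the solution of $y'=p(x)y^2+q(x)y^3$ with $y(y_a,a)=y_a$, and its analytic continuations. A solution has a singularity at the endpoint $b$ of $s$ if its analytic continuation along $s$ cannot be extended holomorphically to $b$. Poincaré mapping: if the solution $y(y_a^1,x)$ can be analytically continued along $s$ from $a$ to $b$ without singularities on $s$ (including $b$), the germ at $y_a^1$ of the Poincaré mapping along $s$, denoted $\phi_{a,b,s,y_a^1}$, associates to each $y_a$ near $y_a^1$ the value $y(y_a,b)$ at $b$ of the solution $y(y_a,x)$ continued along $s$. The curve $\gamma$: for $y_a$ near $y_a^0$ the local branch near $b$ of the solution $y(y_a,x)$, continued along $s$ to a neighborhood of $b$, has exactly one singularity $x_0(y_a)$ near $b$, which is a holomorphic function of $y_a$ with $x_0(y_a^0)=b$. The germ $\gamma\subset\mathbb C$ of a real curve at $y_a^0$ is formed by exactly those $y_a$ near $y_a^0$ for which $x_0(y_a)$ belongs to $s$. *)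

theory Defs
  imports "HOL-Complex_Analysis.Complex_Analysis" "HOL-Computational_Algebra.Polynomial"
begin

text \<open>
  Analytic continuation along the part of a path \<open>s\<close> with parameters in \<open>T\<close> (used for the
  intervals \<open>{0..1}\<close> and \<open>{0..<1}\<close>): for each parameter \<open>t\<close> a function element \<open>F t\<close>, of which only
  the germ at \<open>s t\<close> matters, such that neighbouring function elements agree.
\<close>

definition analytic_continuation ::
    "(real \<Rightarrow> complex) \<Rightarrow> real set \<Rightarrow> (real \<Rightarrow> complex \<Rightarrow> complex) \<Rightarrow> bool" where
  "analytic_continuation s T F \<longleftrightarrow>
     (\<forall>t\<in>T. F t analytic_on {s t}) \<and>
     (\<forall>t\<in>T. \<forall>\<^sub>F t' in at t within T. \<forall>\<^sub>F x in nhds (s t'). F t' x = F t x)"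

text \<open>
  The solution of \<open>y' = p y\<^sup>2 + q y\<^sup>3\<close> with value \<open>ya\<close> at the initial point of \<open>s\<close>, continued
  analytically along \<open>s\<close>.
\<close>

definition solution_along ::
    "complex poly \<Rightarrow> complex poly \<Rightarrow> (real \<Rightarrow> complex) \<Rightarrow> real set \<Rightarrow> complex \<Rightarrow>
     (real \<Rightarrow> complex \<Rightarrow> complex) \<Rightarrow> bool" where
  "solution_along p q s T ya F \<longleftrightarrow>
     analytic_continuation s T F \<and>
     F 0 (pathstart s) = ya \<and>
     (\<forall>\<^sub>F x in nhds (pathstart s).
        (F 0 has_field_derivative (poly p x * F 0 x ^ 2 + poly q x * F 0 x ^ 3)) (at x))"

text \<open>
  The value of the Poincare mapping is well defined, since the germ of the solution at
  \<open>pathstart s\<close> and its continuation along \<open>s\<close> are unique.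
\<close>

definition poincare_defined ::
    "complex poly \<Rightarrow> complex poly \<Rightarrow> (real \<Rightarrow> complex) \<Rightarrow> complex \<Rightarrow> bool" where
  "poincare_defined p q s ya \<longleftrightarrow> (\<exists>F. solution_along p q s {0..1} ya F)"

definition poincare_map ::
    "complex poly \<Rightarrow> complex poly \<Rightarrow> (real \<Rightarrow> complex) \<Rightarrow> complex \<Rightarrow> complex" where
  "poincare_map p q s ya =
     (THE v. \<exists>F. solution_along p q s {0..1} ya F \<and> v = F 1 (pathfinish s))"

text \<open>
  The solution can be continued along \<open>s\<close> to all points except the endpoint, and it cannot be
  extended holomorphically to the endpoint.
\<close>

definition singular_at_end ::
    "complex poly \<Rightarrow> complex poly \<Rightarrow> (real \<Rightarrow> complex) \<Rightarrow> complex \<Rightarrow> bool" where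
  "singular_at_end p q s ya \<longleftrightarrow>
     (\<exists>F. solution_along p q s {0..<1} ya F) \<and> \<not> (\<exists>F. solution_along p q s {0..1} ya F)"

text \<open>
  The singularities in \<open>D\<close> of the local branch of the solution which is obtained by first continuing
  along \<open>s\<close> up to the point \<open>s \<tau>\<close> in \<open>D\<close> and then along arbitrary paths inside \<open>D\<close>.
\<close>

definition local_singularities ::
    "complex poly \<Rightarrow> complex poly \<Rightarrow> (real \<Rightarrow> complex) \<Rightarrow> real \<Rightarrow> complex set \<Rightarrow> complex \<Rightarrow> complex set"
  where
  "local_singularities p q s \<tau> D ya =
     {pathfinish g | g. path g \<and> path_image g \<subseteq> D \<and> pathstart g = s \<tau> \<and>
        singular_at_end p q (subpath 0 \<tau> s +++ g) ya}"

text \<open>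
  \<open>x0\<close> describes, for initial values in the disc of radius \<open>\<epsilon>\<close> about \<open>ya0\<close>, the only singularity
  near the endpoint \<open>b\<close> of \<open>s\<close> of the local branch of the solution. These conditions determine the
  germ of \<open>x0\<close> at \<open>ya0\<close>.
\<close>

definition moving_singularity ::
    "complex poly \<Rightarrow> complex poly \<Rightarrow> (real \<Rightarrow> complex) \<Rightarrow> complex \<Rightarrow> real \<Rightarrow> (complex \<Rightarrow> complex) \<Rightarrow> bool"
  where
  "moving_singularity p q s ya0 \<epsilon> x0 \<longleftrightarrow>
     x0 holomorphic_on ball ya0 \<epsilon> \<and> x0 ya0 = pathfinish s \<and>
     (\<exists>\<rho>>0. \<exists>\<tau>\<in>{0..<1}. s ` {\<tau>..1} \<subseteq> ball (pathfinish s) \<rho> \<and>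
        (\<forall>ya\<in>ball ya0 \<epsilon>. local_singularities p q s \<tau> (ball (pathfinish s) \<rho>) ya = {x0 ya}))"

text \<open>A representative, in the disc of radius \<open>\<epsilon>\<close> about \<open>ya0\<close>, of the germ \<open>\<gamma>\<close>.\<close>

definition singular_curve ::
    "(real \<Rightarrow> complex) \<Rightarrow> complex \<Rightarrow> real \<Rightarrow> (complex \<Rightarrow> complex) \<Rightarrow> complex set" where
  "singular_curve s ya0 \<epsilon> x0 = {ya \<in> ball ya0 \<epsilon>. x0 ya \<in> path_image s}"

text \<open>\<open>H\<close> continues the germ of \<open>f\<close> at the initial point of \<open>g\<close> along the path \<open>g\<close> in \<open>U\<close>.\<close>

definition germ_continuation ::
    "complex set \<Rightarrow> (complex \<Rightarrow> complex) \<Rightarrow> (real \<Rightarrow> complex) \<Rightarrow> (real \<Rightarrow> complex \<Rightarrow> complex) \<Rightarrow> bool"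
  where
  "germ_continuation U f g H \<longleftrightarrow>
     path g \<and> path_image g \<subseteq> U \<and> analytic_continuation g {0..1} H \<and>
     (\<forall>\<^sub>F w in nhds (pathstart g). H 0 w = f w)"

text \<open>
  The values at \<open>z\<close> of the multivalued function on \<open>U\<close> obtained by continuing the germ of \<open>f\<close> at
  \<open>z1\<close> along all paths in \<open>U\<close>.
\<close>

definition continuation_values ::
    "complex set \<Rightarrow> (complex \<Rightarrow> complex) \<Rightarrow> complex \<Rightarrow> complex \<Rightarrow> complex set" where
  "continuation_values U f z1 z =
     {H 1 z | g H. germ_continuation U f g H \<and> pathstart g = z1 \<and> pathfinish g = z}"

end

theory Submission
  imports Defs
begin

text \<open>
  For \<open>w = 1 / y\<close> the equation becomes \<open>w w' = - p w - q\<close>. As \<open>q b \<noteq> 0\<close>, the substitution \<open>x = c + z\<^sup>2\<close>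
  turns it into a fixed point problem with a solution \<open>w = z v(z, c)\<close>, \<open>v \<noteq> 0\<close>, holomorphic in \<open>z\<close> and in the
  position \<open>c\<close> of the singularity, and these functions exhaust the solutions with large values near \<open>b\<close>.
  By local existence the given solution is unbounded along \<open>s\<close>, hence it is of this form with \<open>c = b\<close>.
  Following the flow back along \<open>s\<close> gives an initial value \<open>Y c\<close> for each \<open>c\<close> near \<open>b\<close>; the map \<open>Y\<close> is
  holomorphic, and injective because the solution determines its singularity, so the inverse \<open>x0\<close> of \<open>Y\<close> is
  holomorphic with nonzero derivative. The value at \<open>b\<close> is \<open>1 / (z v(z, x0))\<close> with \<open>z\<^sup>2 = b - x0(ya)\<close>, and
  \<open>b - x0(ya)\<close> is \<open>ya - ya0\<close> times a nonvanishing square, which makes it a function of \<open>\<surd>(ya - ya0)\<close> with a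
  simple pole.
\<close>

subsection \<open>Holomorphic dependence on a parameter\<close>

text \<open>The obstacle is a branch point that moves with the initial value, so the usual
  dependence theorems stop short of \<open>b\<close>. In the coordinate \<open>z\<close>, a root of
  \<open>x - c\<close>, both the pole of \<open>y\<close> and its branching become explicit, and
  \<open>c\<close> is an ordinary parameter. Parametrizing by \<open>c\<close> instead of
  \<open>ya\<close> gives \<open>Y\<close> directly, and injectivity replaces the computation of a
  derivative. The fact that the local singularities are exactly \<open>{c}\<close> serves twice: it
  is the defining property of \<open>x0\<close> and the source of that injectivity. Square roots
  play two separate roles: in the \<open>x\<close>-plane around the singularity, where a root is
  followed along \<open>s\<close>, and in the \<open>ya\<close>-plane around \<open>ya0\<close>. Off
  the curve one only knows pointwise that the Poincare map takes the value \<open>N(r) / r\<close>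
  for one of the two roots \<open>r\<close> of \<open>ya - ya0\<close>, and the choice may jump
  across the curve. The germ is identified by continuity because the two candidates differ; this
  needs \<open>N(r) + N(-r) \<noteq> 0\<close> and is the reason for the last shrinking of the
  disc.\<close>

lemma holomorphic_on_integral_param:
  fixes f :: "complex \<Rightarrow> real \<Rightarrow> complex"
  assumes U: "open U" and cont: "continuous_on (U \<times> {0..1}) (\<lambda>(z, t). f z t)"
    and hol: "\<And>t. t \<in> {0..1} \<Longrightarrow> (\<lambda>z. f z t) holomorphic_on U"
  shows "(\<lambda>z. integral {0..1} (f z)) holomorphic_on U"
proof -
  \<comment> \<open>Exchanging the two integrals is what Morera's theorem needs: the integral over a
    triangle becomes an average over \<open>t\<close> of integrals that vanish by Cauchy's
    theorem.\<close>
  have *: "contour_integral (linepath a b) (\<lambda>z. integral {0..1} (f z))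
      = integral {0..1} (\<lambda>t. contour_integral (linepath a b) (\<lambda>z. f z t))"
    and int: "(\<lambda>t. contour_integral (linepath a b) (\<lambda>z. f z t)) integrable_on {0..1}"
    if seg: "closed_segment a b \<subseteq> U" for a b
  proof -
    have c: "continuous_on (cbox (0, 0) (1, 1)) (\<lambda>(x::real, t::real). f (linepath a b x) t * (b - a))"
      unfolding case_prod_beta
    proof (intro continuous_intros)
      have "continuous_on (cbox (0, 0) (1, 1)) (\<lambda>x::real \<times> real. (linepath a b (fst x), snd x))"
        by (auto intro!: continuous_intros simp: linepath_def)
      moreover have "(\<lambda>x::real \<times> real. (linepath a b (fst x), snd x)) ` cbox (0, 0) (1, 1) \<subseteq> U \<times> {0..1}"
      proof -
        have "linepath a b x \<in> U" if "0 \<le> x" "x \<le> 1" for x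
          using seg that linepath_in_path[of x a b] by auto
        then show ?thesis by (auto simp: cbox_Pair_eq)
      qed
      ultimately show "continuous_on (cbox (0, 0) (1, 1)) (\<lambda>x::real \<times> real. f (linepath a b (fst x)) (snd x))"
        using continuous_on_compose2[OF cont] by (fastforce simp: case_prod_beta)
    qed
    have "contour_integral (linepath a b) (\<lambda>z. integral {0..1} (f z))
        = integral (cbox 0 1) (\<lambda>x. integral (cbox 0 1) (\<lambda>t. f (linepath a b x) t * (b - a)))"
      by (simp add: contour_integral_integral)
    also have "\<dots> = integral (cbox 0 1) (\<lambda>t. integral (cbox 0 1) (\<lambda>x. f (linepath a b x) t * (b - a)))"
      by (rule integral_swap_continuous) (use c in simp)
    finally show "contour_integral (linepath a b) (\<lambda>z. integral {0..1} (f z))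
      = integral {0..1} (\<lambda>t. contour_integral (linepath a b) (\<lambda>z. f z t))"
      by (simp add: contour_integral_integral)
    have "continuous_on (cbox 0 1 \<times> cbox 0 1) (\<lambda>(t::real, x::real). f (linepath a b x) t * (b - a))"
      using continuous_on_swap_args c by (fastforce simp: cbox_Pair_eq)
    then have "continuous_on (cbox 0 1) (\<lambda>t::real. integral (cbox 0 (1::real)) (\<lambda>x. f (linepath a b x) t * (b - a)))"
      by (rule integral_continuous_on_param)
    then show "(\<lambda>t. contour_integral (linepath a b) (\<lambda>z. f z t)) integrable_on {0..1}"
      by (simp add: contour_integral_integral integrable_continuous_real)
  qed
  have "(\<lambda>z. integral {0..1} (f z)) analytic_on U"
  proof (rule Morera_triangle[OF _ U impI])
    show "continuous_on U (\<lambda>z. integral {0..1} (f z))"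
      using integral_continuous_on_param[of U 0 1 f] cont by simp
    fix a b c assume tri: "convex hull {a, b, c} \<subseteq> U"
    have seg: "closed_segment a b \<subseteq> U" "closed_segment b c \<subseteq> U" "closed_segment c a \<subseteq> U"
      using tri by (meson order_trans segments_subset_convex_hull)+
    have "contour_integral (linepath a b) (\<lambda>z. f z t) + contour_integral (linepath b c) (\<lambda>z. f z t) +
        contour_integral (linepath c a) (\<lambda>z. f z t) = 0" if "t \<in> {0..1}" for t
    proof -
      have "(\<lambda>z. f z t) holomorphic_on convex hull {a, b, c}"
        using hol[OF that] tri by (rule holomorphic_on_subset)
      then have "((\<lambda>z. f z t) has_contour_integral 0) (linepath a b +++ linepath b c +++ linepath c a)"
        by (rule Cauchy_theorem_triangle)
      then show ?thesis
        by (meson has_chain_integral_chain_integral3)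
    qed
    then have "integral {0..1} (\<lambda>t. contour_integral (linepath a b) (\<lambda>z. f z t)
       + contour_integral (linepath b c) (\<lambda>z. f z t) + contour_integral (linepath c a) (\<lambda>z. f z t)) = integral {0..1} (\<lambda>t::real. 0)"
      by (intro integral_cong) auto
    then show "contour_integral (linepath a b) (\<lambda>z. integral {0..1} (f z)) + contour_integral (linepath b c) (\<lambda>z. integral {0..1} (f z)) +
       contour_integral (linepath c a) (\<lambda>z. integral {0..1} (f z)) = 0"
      using *[OF seg(1)] *[OF seg(2)] *[OF seg(3)] int[OF seg(1)] int[OF seg(2)] int[OF seg(3)]
      by (simp add: integral_add integrable_add)
  qed
  then show ?thesis by (simp add: U analytic_on_open)
qed

section \<open>Contractions on spaces of functions of two complex variables\<close>

text \<open>Banach's iteration in the sup distance over \<open>S\<close>. The functions are total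
  and only their values on \<open>S\<close> count, so distances are expressed by arbitrary bounds
  \<open>d\<close>, and completeness by the closure of \<open>A\<close> under uniform limits on
  \<open>S\<close>. The iterates converge by the Weierstrass test for the telescoping series with
  majorant \<open>M / 2^n\<close>.\<close>

lemma contraction_fixpoint_on:
  fixes T :: "('a \<Rightarrow> complex) \<Rightarrow> 'a \<Rightarrow> complex"
  assumes u0: "u0 \<in> A" and T: "\<And>u. u \<in> A \<Longrightarrow> T u \<in> A"
    and contr: "\<And>u v d x. u \<in> A \<Longrightarrow> v \<in> A \<Longrightarrow> (\<And>x. x \<in> S \<Longrightarrow> dist (u x) (v x) \<le> d) \<Longrightarrow> x \<in> S \<Longrightarrow>
       dist (T u x) (T v x) \<le> d / 2"
    and bdd: "\<And>x. x \<in> S \<Longrightarrow> dist (u0 x) (T u0 x) \<le> M"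
    and lim: "\<And>f g. (\<And>n::nat. f n \<in> A) \<Longrightarrow> uniform_limit S f g sequentially \<Longrightarrow> g \<in> A"
  obtains u where "u \<in> A" "\<And>x. x \<in> S \<Longrightarrow> T u x = u x"
proof -
  define f where "f n = (T ^^ n) u0" for n
  have fA: "f n \<in> A" for n
    by (induction n) (auto simp: f_def u0 T)
  have step: "dist (f n x) (f (Suc n) x) \<le> M * (1/2)^n" if "x \<in> S" for n x
    using that
  proof (induction n arbitrary: x)
    case 0
    then show ?case using bdd by (simp add: f_def)
  next
    case (Suc n)
    have "dist (T (f n) x) (T (f (Suc n)) x) \<le> M * (1/2)^n / 2"
      by (rule contr) (use Suc fA in auto)
    then show ?case by (simp add: f_def)
  qed
  define g where "g x = f 0 x + (\<Sum>i. f (Suc i) x - f i x)" for x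
  have "uniform_limit S (\<lambda>n x. \<Sum>i<n. f (Suc i) x - f i x) (\<lambda>x. \<Sum>i. f (Suc i) x - f i x) sequentially"
  proof (rule Weierstrass_m_test)
    show "norm (f (Suc n) x - f n x) \<le> M * (1/2)^n" if "x \<in> S" for n x
      using step[OF that, of n] by (simp add: dist_norm norm_minus_commute)
    show "summable (\<lambda>n. M * (1/2::real)^n)"
      by (intro summable_mult summable_geometric) auto
  qed
  then have "uniform_limit S (\<lambda>n x. f 0 x + (\<Sum>i<n. f (Suc i) x - f i x)) g sequentially"
    unfolding g_def by (intro uniform_limit_intros)
  moreover have "f 0 x + (\<Sum>i<n. f (Suc i) x - f i x) = f n x" for n x
    by (subst sum_lessThan_telescope) simp
  ultimately have ul: "uniform_limit S f g sequentially" by simp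
  have gA: "g \<in> A" by (rule lim[OF fA ul])
  show ?thesis
  proof
    show "g \<in> A" by fact
    fix x assume x: "x \<in> S"
    have "dist (T g x) (g x) \<le> 0 + e" if "e > 0" for e
    proof -
      from ul have "\<forall>\<^sub>F n in sequentially. \<forall>x\<in>S. dist (f n x) (g x) < e/2"
        using that unfolding uniform_limit_iff by (meson half_gt_zero)
      then obtain N where N: "\<And>n x. n \<ge> N \<Longrightarrow> x \<in> S \<Longrightarrow> dist (f n x) (g x) < e/2"
        unfolding eventually_sequentially by blast
      have "dist (T g x) (T (f N) x) \<le> (e/2) / 2"
        by (rule contr[OF gA fA _ x]) (use N in \<open>force simp: dist_commute\<close>)
      moreover have "T (f N) x = f (Suc N) x" by (simp add: f_def)
      moreover have "dist (f (Suc N) x) (g x) < e/2" by (rule N) (use x in auto)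
      ultimately show ?thesis
        using dist_triangle[of "T g x" "g x" "f (Suc N) x"] that by simp
    qed
    then have "dist (T g x) (g x) \<le> 0" by (rule field_le_epsilon)
    then show "T g x = g x" by simp
  qed
qed

text \<open>
  Holomorphy in two variables, in a form that avoids the theory of several complex variables: it is
  visibly preserved by uniform limits, by composition and by integration over a parameter.
\<close>

definition plot_holomorphic :: "(complex \<times> complex) set \<Rightarrow> (complex \<times> complex \<Rightarrow> complex) \<Rightarrow> bool" where
  "plot_holomorphic S u \<longleftrightarrow> continuous_on S u \<and>
     (\<forall>U a b. open U \<longrightarrow> a holomorphic_on U \<longrightarrow> b holomorphic_on U \<longrightarrow> (\<forall>z\<in>U. (a z, b z) \<in> S) \<longrightarrow>
        (\<lambda>z. u (a z, b z)) holomorphic_on U)"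

lemma plot_holomorphicD:
  assumes "plot_holomorphic S u" "open U" "a holomorphic_on U" "b holomorphic_on U" "\<And>z. z \<in> U \<Longrightarrow> (a z, b z) \<in> S"
  shows "(\<lambda>z. u (a z, b z)) holomorphic_on U"
  using assms unfolding plot_holomorphic_def by blast

lemma plot_holomorphic_uniform_limit:
  assumes f: "\<And>n::nat. plot_holomorphic S (f n)" and ul: "uniform_limit S f g sequentially"
  shows "plot_holomorphic S g"
  unfolding plot_holomorphic_def
proof (intro conjI allI impI)
  show "continuous_on S g"
    by (rule uniform_limit_theorem[OF _ ul]) (use f in \<open>auto simp: plot_holomorphic_def\<close>)
  fix U a b assume U: "open U" "a holomorphic_on U" "b holomorphic_on U" "\<forall>z\<in>U. (a z, b z) \<in> S"
  show "(\<lambda>z. g (a z, b z)) holomorphic_on U"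
  proof (rule holomorphic_uniform_sequence[OF U(1)])
    show "(\<lambda>z. f n (a z, b z)) holomorphic_on U" for n
      by (rule plot_holomorphicD[OF f]) (use U in auto)
    fix x assume "x \<in> U"
    then obtain d where d: "d > 0" "cball x d \<subseteq> U" using U(1) open_contains_cball by blast
    have "uniform_limit U (\<lambda>n z. f n (a z, b z)) (\<lambda>z. g (a z, b z)) sequentially"
      using uniform_limit_compose'[OF ul, of "\<lambda>z. (a z, b z)" U] U(4) by auto
    then show "\<exists>d>0. cball x d \<subseteq> U \<and> uniform_limit (cball x d) (\<lambda>n z. f n (a z, b z)) (\<lambda>z. g (a z, b z)) sequentially"
      using d uniform_limit_on_subset by blast
  qed
qed

text \<open>The bound on the values has to survive uniform limits, hence closed balls. The iteration
  starts at the constant \<open>m\<close>, which \<open>T\<close> moves by at most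
  \<open>\<rho>\<close>.\<close>

lemma plot_holomorphic_fixpoint:
  fixes T :: "(complex \<times> complex \<Rightarrow> complex) \<Rightarrow> complex \<times> complex \<Rightarrow> complex"
  assumes rho: "\<rho> \<ge> 0"
    and T: "\<And>u. plot_holomorphic S u \<Longrightarrow> (\<And>x. x \<in> S \<Longrightarrow> u x \<in> cball m \<rho>) \<Longrightarrow> plot_holomorphic S (T u)"
    and Tm: "\<And>u x. plot_holomorphic S u \<Longrightarrow> (\<And>x. x \<in> S \<Longrightarrow> u x \<in> cball m \<rho>) \<Longrightarrow> x \<in> S \<Longrightarrow> T u x \<in> cball m \<rho>"
    and contr: "\<And>u v d x. plot_holomorphic S u \<Longrightarrow> (\<And>x. x \<in> S \<Longrightarrow> u x \<in> cball m \<rho>) \<Longrightarrow>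
       plot_holomorphic S v \<Longrightarrow> (\<And>x. x \<in> S \<Longrightarrow> v x \<in> cball m \<rho>) \<Longrightarrow>
       (\<And>x. x \<in> S \<Longrightarrow> dist (u x) (v x) \<le> d) \<Longrightarrow> x \<in> S \<Longrightarrow> dist (T u x) (T v x) \<le> d / 2"
  obtains u where "plot_holomorphic S u" "\<And>x. x \<in> S \<Longrightarrow> u x \<in> cball m \<rho>" "\<And>x. x \<in> S \<Longrightarrow> T u x = u x"
proof -
  define A where "A = {u. plot_holomorphic S u \<and> (\<forall>x\<in>S. u x \<in> cball m \<rho>)}"
  have m: "(\<lambda>_. m) \<in> A" using rho by (auto simp: A_def plot_holomorphic_def)
  obtain u where "u \<in> A" "\<And>x. x \<in> S \<Longrightarrow> T u x = u x"
  proof (rule contraction_fixpoint_on[where A = A and T = T and S = S and ?u0.0 = "\<lambda>_. m" and M = \<rho>])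
    show "T u \<in> A" if "u \<in> A" for u using that T Tm by (auto simp: A_def)
    show "dist (T u x) (T v x) \<le> d / 2" if "u \<in> A" "v \<in> A" "\<And>x. x \<in> S \<Longrightarrow> dist (u x) (v x) \<le> d" "x \<in> S" for u v d x
      by (rule contr) (use that in \<open>auto simp: A_def\<close>)
    show "dist m (T (\<lambda>_. m) x) \<le> \<rho>" if "x \<in> S" for x
      using T[of "\<lambda>_. m"] Tm[of "\<lambda>_. m" x] m that by (auto simp: A_def)
    show "g \<in> A" if f: "\<And>n::nat. f n \<in> A" and ul: "uniform_limit S f g sequentially" for f g
    proof -
      have "g x \<in> cball m \<rho>" if "x \<in> S" for x
        by (rule closed_sequentially[OF closed_cball _ tendsto_uniform_limitI[OF ul that]])
           (use f that in \<open>auto simp: A_def\<close>)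
      then show ?thesis
        using plot_holomorphic_uniform_limit[OF _ ul] f by (auto simp: A_def)
    qed
  qed (use m in auto)
  then show ?thesis using that by (auto simp: A_def)
qed

lemma plot_holomorphic_integral:
  fixes k :: "real \<Rightarrow> complex \<times> complex \<Rightarrow> complex"
  assumes cont: "continuous_on (S \<times> {0..1}) (\<lambda>(s, t). k t s)"
    and hol: "\<And>t. t \<in> {0..1} \<Longrightarrow> plot_holomorphic S (k t)"
  shows "plot_holomorphic S (\<lambda>s. integral {0..1} (\<lambda>t. k t s))"
  unfolding plot_holomorphic_def
proof (intro conjI allI impI)
  show "continuous_on S (\<lambda>s. integral {0..1} (\<lambda>t. k t s))"
    using integral_continuous_on_param[of S 0 1 "\<lambda>s t. k t s"] cont by simp
  fix U a b assume U: "open U" "a holomorphic_on U" "b holomorphic_on U" "\<forall>z\<in>U. (a z, b z) \<in> S"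
  show "(\<lambda>z. integral {0..1} (\<lambda>t. k t (a z, b z))) holomorphic_on U"
  proof (rule holomorphic_on_integral_param[OF U(1)])
    show "(\<lambda>z. k t (a z, b z)) holomorphic_on U" if "t \<in> {0..1}" for t
      by (rule plot_holomorphicD[OF hol[OF that]]) (use U in auto)
    have ab: "continuous_on U a" "continuous_on U b" using U holomorphic_on_imp_continuous_on by auto
    have "continuous_on (U \<times> {0..1}) (\<lambda>x::complex \<times> real. ((a (fst x), b (fst x)), snd x))"
      by (intro continuous_intros continuous_on_compose2[OF ab(1)] continuous_on_compose2[OF ab(2)]) auto
    then have "continuous_on (U \<times> {0..1}) (\<lambda>x. (\<lambda>(s, t). k t s) ((a (fst x), b (fst x)), snd x))"
      by (rule continuous_on_compose2[OF cont]) (use U in auto)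
    then show "continuous_on (U \<times> {0..1}) (\<lambda>(z, t). k t (a z, b z))"
      by (simp add: case_prod_beta)
  qed
qed

section \<open>Integrals along segments from the origin\<close>

lemma scale_in_ball: 
  fixes z :: complex
  assumes "z \<in> ball 0 r" "t \<in> {0..1}" shows "of_real t * z \<in> ball 0 r"
proof -
  have "\<bar>t\<bar> * norm z \<le> 1 * norm z" using assms by (intro mult_right_mono) auto
  then show ?thesis using assms by (simp add: norm_mult)
qed

text \<open>Integrals from 0 to \<open>z\<close> are written as \<open>z\<close> times an integral
  over \<open>t\<close> in \<open>{0..1}\<close> of the integrand at \<open>t z\<close>, so that the
  interval of integration is fixed and \<open>z\<close> is a parameter. This is the joint continuity
  which such integrands require.\<close>

lemma continuous_on_scaled:
  assumes u: "plot_holomorphic (ball 0 r \<times> C) u"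
  shows "continuous_on ((ball 0 r \<times> C) \<times> {0..1}) (\<lambda>x. u (of_real (snd x) * fst (fst x), snd (fst x)))"
proof -
  have "continuous_on (ball 0 r \<times> C) u" using u by (simp add: plot_holomorphic_def)
  then show ?thesis
  proof (rule continuous_on_compose2)
    show "continuous_on ((ball 0 r \<times> C) \<times> {0..1}) (\<lambda>x::(complex \<times> complex) \<times> real. (of_real (snd x) * fst (fst x), snd (fst x)))"
      by (intro continuous_intros)
    show "(\<lambda>x::(complex \<times> complex) \<times> real. (complex_of_real (snd x) * fst (fst x), snd (fst x))) ` ((ball 0 r \<times> C) \<times> {0..1})
      \<subseteq> ball 0 r \<times> C"
      using scale_in_ball by fastforce
  qed
qed

lemma holomorphic_scaled:
  assumes u: "plot_holomorphic (ball 0 r \<times> C) u" and t: "t \<in> {0..1}"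
    and U: "open U" "a holomorphic_on U" "b holomorphic_on U" "\<And>z. z \<in> U \<Longrightarrow> (a z, b z) \<in> ball 0 r \<times> C"
  shows "(\<lambda>z. u (of_real t * a z, b z)) holomorphic_on U"
  by (rule plot_holomorphicD[OF u]) (use U scale_in_ball[OF _ t] in \<open>auto intro!: holomorphic_intros\<close>)

text \<open>Scaling the segment shows that the expression is the integral of \<open>g\<close> from 0
  to \<open>z\<close>, that is, the primitive of \<open>g\<close> vanishing at 0.\<close>

lemma has_field_derivative_scaled_integral:
  assumes g: "g holomorphic_on ball 0 r" and z: "z \<in> ball 0 r"
  shows "((\<lambda>z. z * integral {0..1} (\<lambda>t. g (of_real t * z))) has_field_derivative g z) (at z)"
proof -
  obtain G where G: "\<And>x. x \<in> ball 0 r \<Longrightarrow> (G has_field_derivative g x) (at x within ball 0 r)"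
    using holomorphic_convex_primitive'[OF convex_ball open_ball g] by blast
  have eq: "z * integral {0..1} (\<lambda>t. g (of_real t * z)) = G z - G 0" if "z \<in> ball 0 r" for z
  proof -
    have "r > 0" using that by (metis ball_eq_empty empty_iff not_le)
    then have "closed_segment 0 z \<subseteq> ball 0 r" using that by (intro closed_segment_subset) auto
    then have "(g has_contour_integral (G z - G 0)) (linepath 0 z)"
      using contour_integral_primitive[OF G, of "linepath 0 z"] by simp
    then have "((\<lambda>x. g (linepath 0 z x) * (z - 0)) has_integral (G z - G 0)) {0..1}"
      by (simp add: has_contour_integral_linepath)
    from integral_unique[OF this] have "integral {0..1} (\<lambda>x. g (linepath 0 z x) * z) = G z - G 0"
      by simp
    moreover have "linepath 0 z x = of_real x * z" for x by (simp add: linepath_def scaleR_conv_of_real)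
    ultimately show ?thesis by (simp add: mult.commute)
  qed
  have "((\<lambda>z. G z - G 0) has_field_derivative g z) (at z)"
    using G[OF z] z by (auto intro!: derivative_eq_intros simp: at_within_open[OF _ open_ball])
  then show ?thesis
    by (rule has_field_derivative_transform_within_open[OF _ open_ball z]) (use eq in auto)
qed

subsection \<open>The local flow and the square root chart\<close>

text \<open>Picard iteration on pairs \<open>(x - x1, c)\<close>, where \<open>c\<close> is the
  value at \<open>x1\<close>, so that holomorphy in \<open>c\<close> is built into the function
  space. The radius \<open>r\<close> depends only on the bound \<open>K\<close>; this uniformity
  drives both the continuation up to an endpoint and the transport along a compact path.\<close>

lemma local_flow:
  fixes p q :: "complex poly" and K :: real
  obtains r where "r > 0"
    "\<And>x1 y1. norm x1 \<le> K \<Longrightarrow> norm y1 \<le> K \<Longrightarrow> \<exists>u :: complex \<Rightarrow> complex \<Rightarrow> complex.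
       (\<forall>c\<in>ball y1 r. u x1 c = c) \<and> (\<forall>x\<in>ball x1 r. u x holomorphic_on ball y1 r) \<and>
       (\<forall>x\<in>ball x1 r. \<forall>c\<in>ball y1 r.
          ((\<lambda>x. u x c) has_field_derivative poly p x * u x c ^ 2 + poly q x * u x c ^ 3) (at x))"
proof -
  \<comment> \<open>A bound for all arguments that occur: points stay within distance 1 of
    \<open>x1\<close>, values within distance 2 of \<open>y1\<close>. The absolute value makes
    \<open>Y\<close> positive for every \<open>K\<close>.\<close>
  define Y where "Y = \<bar>K\<bar> + 2"
  have Y: "Y > 0" by (simp add: Y_def)
  define f where "f x y = poly p x * y ^ 2 + poly q x * y ^ 3" for x y
  have "compact (poly p ` cball 0 Y)" "compact (poly q ` cball 0 Y)"
    by (intro compact_continuous_image continuous_intros compact_cball)+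
  then have "bounded (poly p ` cball 0 Y \<union> poly q ` cball 0 Y)"
    by (simp add: compact_imp_bounded)
  then obtain A where A: "A > 0" "\<And>x. norm x \<le> Y \<Longrightarrow> norm (poly p x) \<le> A" "\<And>x. norm x \<le> Y \<Longrightarrow> norm (poly q x) \<le> A"
    unfolding bounded_pos by (metis UnCI image_eqI mem_cball_0)
  define M where "M = A * Y\<^sup>2 + A * Y ^ 3"
  define L where "L = A * (2 * Y) + A * (3 * Y\<^sup>2)"
  have LM: "M > 0" "L > 0" using A(1) Y by (auto simp: M_def L_def intro!: add_pos_pos)
  have fM: "norm (f x y) \<le> M" if "norm x \<le> Y" "norm y \<le> Y" for x y
    unfolding f_def M_def
    by (intro norm_triangle_le add_mono) (auto simp: norm_mult norm_power intro!: mult_mono power_mono A that less_imp_le[OF A(1)])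
  have fL: "norm (f x y - f x y') \<le> L * norm (y - y')" if "norm x \<le> Y" "norm y \<le> Y" "norm y' \<le> Y" for x y y'
  proof -
    have eq: "f x y - f x y' = (poly p x * (y + y') + poly q x * (y * y + y * y' + y' * y')) * (y - y')"
      by (simp add: f_def power2_eq_square power3_eq_cube algebra_simps)
    have mm: "norm (a * b) \<le> Y * Y" if "norm a \<le> Y" "norm b \<le> Y" for a b :: complex
      using that Y by (auto simp: norm_mult intro!: mult_mono)
    have 1: "norm (y * y + y * y' + y' * y') \<le> 3 * Y\<^sup>2"
      using norm_triangle_ineq[of "y * y + y * y'" "y' * y'"] norm_triangle_ineq[of "y * y" "y * y'"]
        mm[of y y] mm[of y y'] mm[of y' y'] that by (simp add: power2_eq_square)
    have 2: "norm (y + y') \<le> 2 * Y"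
      using norm_triangle_ineq[of y y'] that by simp
    have "norm (poly p x * (y + y') + poly q x * (y * y + y * y' + y' * y')) \<le> L"
      unfolding L_def
      by (intro norm_triangle_le add_mono) (auto simp: norm_mult intro!: mult_mono 1 2 A that less_imp_le[OF A(1)])
    then show ?thesis unfolding eq by (simp add: norm_mult mult_right_mono)
  qed
  \<comment> \<open>The integral term is at most \<open>r M \<le> 1\<close> and the initial value
    moves by less than \<open>r \<le> 1\<close>, which together give the radius 2 of the function
    space; \<open>r L \<le> 1/2\<close> is the contraction factor.\<close>
  define r where "r = min 1 (min (1 / M) (1 / (2 * L)))"
  have r: "r > 0" "r \<le> 1" "r * M \<le> 1" "r * L \<le> 1/2"
  proof -
    have "r \<le> 1 / M" "r \<le> 1 / (2 * L)" by (auto simp: r_def)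
    then show "r * M \<le> 1" "r * L \<le> 1/2" using LM by (auto simp: field_simps)
  qed (use LM in \<open>auto simp: r_def\<close>)
  show ?thesis
  proof (rule that[of r])
    fix x1 y1 :: complex assume K: "norm x1 \<le> K" "norm y1 \<le> K"
    define S where "S = ball (0::complex) r \<times> ball y1 r"
    define k where "k u t s = f (x1 + of_real t * fst s) (u (of_real t * fst s, snd s))"
      for u :: "complex \<times> complex \<Rightarrow> complex" and t :: real and s :: "complex \<times> complex"
    define T where "T u s = snd s + fst s * integral {0..1} (\<lambda>t. k u t s)" for u s
    have xY: "norm (x1 + of_real t * fst s) \<le> Y" if "s \<in> S" "t \<in> {0..1}" for s t
    proof -
      have "of_real t * fst s \<in> ball 0 r" using that by (intro scale_in_ball) (auto simp: S_def)
      then show ?thesis using norm_triangle_ineq[of x1 "of_real t * fst s"] K r by (simp add: Y_def)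
    qed
    have sS: "(of_real t * fst s, snd s) \<in> S" if "s \<in> S" "t \<in> {0..1}" for s t
      using that scale_in_ball[of "fst s" r t] by (auto simp: S_def)
    have uY: "norm y \<le> Y" if "y \<in> cball y1 2" for y
      using that K norm_triangle_ineq[of y1 "y - y1"] by (simp add: Y_def dist_norm norm_minus_commute)
    have kcont: "continuous_on (S \<times> {0..1}) (\<lambda>(s, t). k u t s)" if "plot_holomorphic S u" for u
      using continuous_on_scaled[of r "ball y1 r" u] that
      unfolding k_def f_def case_prod_beta S_def by (auto intro!: continuous_intros)
    have kcont1: "continuous_on {0..1} (\<lambda>t. k u t s)" if "plot_holomorphic S u" "s \<in> S" for u s
    proof -
      have "continuous_on {0..1} (\<lambda>t. (\<lambda>(s, t). k u t s) (s, t))"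
        by (rule continuous_on_compose2[OF kcont[OF that(1)]]) (use that in \<open>auto intro!: continuous_intros\<close>)
      then show ?thesis by simp
    qed
    have khol: "plot_holomorphic S (k u t)" if "plot_holomorphic S u" "t \<in> {0..1}" for u t
      unfolding plot_holomorphic_def
    proof (intro conjI allI impI)
      have "continuous_on S (\<lambda>s. (\<lambda>(s, t). k u t s) (s, t))"
        by (rule continuous_on_compose2[OF kcont[OF that(1)]]) (use that in \<open>auto intro!: continuous_intros\<close>)
      then show "continuous_on S (k u t)" by simp
      fix U a b assume U: "open U" "a holomorphic_on U" "b holomorphic_on U" "\<forall>z\<in>U. (a z, b z) \<in> S"
      show "(\<lambda>z. k u t (a z, b z)) holomorphic_on U"
        using holomorphic_scaled[of r "ball y1 r" u t U a b] that U unfolding k_def f_def S_def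
        by (auto intro!: holomorphic_intros)
    qed
    have Ihol: "plot_holomorphic S (\<lambda>s. integral {0..1} (\<lambda>t. k u t s))" if "plot_holomorphic S u" for u
      using kcont khol that by (intro plot_holomorphic_integral) auto
    obtain u where u: "plot_holomorphic S u" "\<And>x. x \<in> S \<Longrightarrow> u x \<in> cball y1 2" "\<And>x. x \<in> S \<Longrightarrow> T u x = u x"
    proof (rule plot_holomorphic_fixpoint[of 2 S y1 T])
      fix u assume u: "plot_holomorphic S u" "\<And>x. x \<in> S \<Longrightarrow> u x \<in> cball y1 2"
      show "plot_holomorphic S (T u)"
        using Ihol[OF u(1)] unfolding T_def plot_holomorphic_def
        by (auto intro!: continuous_intros holomorphic_intros)
      fix s assume s: "s \<in> S"
      have "norm (k u t s) \<le> M" if "t \<in> {0..1}" for t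
        unfolding k_def using s that by (intro fM xY uY u(2) sS)
      then have "norm (integral {0..1} (\<lambda>t. k u t s)) \<le> M * (1 - 0)"
        using u s by (intro integral_bound kcont1) auto
      then have "norm (fst s * integral {0..1} (\<lambda>t. k u t s)) \<le> r * M"
        using s r by (auto simp: norm_mult S_def intro!: mult_mono)
      then have "norm (T u s - y1) \<le> norm (snd s - y1) + 1"
        using norm_triangle_ineq[of "snd s - y1" "fst s * integral {0..1} (\<lambda>t. k u t s)"] r
        by (simp add: T_def algebra_simps)
      moreover have "norm (snd s - y1) < r" using s by (auto simp: S_def dist_norm norm_minus_commute)
      ultimately show "T u s \<in> cball y1 2" using r by (simp add: dist_norm norm_minus_commute)
    next
      fix u v d s assume u: "plot_holomorphic S u" "\<And>x. x \<in> S \<Longrightarrow> u x \<in> cball y1 2"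
        and v: "plot_holomorphic S v" "\<And>x. x \<in> S \<Longrightarrow> v x \<in> cball y1 2"
        and d: "\<And>x. x \<in> S \<Longrightarrow> dist (u x) (v x) \<le> d" and s: "s \<in> S"
      have d0: "d \<ge> 0" using d[OF s] by (meson dist_commute order_trans zero_le_dist)
      have "norm (integral {0..1} (\<lambda>t. k u t s - k v t s)) \<le> (L * d) * (1 - 0)"
      proof (rule integral_bound)
        fix t :: real assume t: "t \<in> {0..1}"
        have "norm (k u t s - k v t s) \<le> L * norm (u (of_real t * fst s, snd s) - v (of_real t * fst s, snd s))"
          unfolding k_def using s t by (intro fL xY uY u(2) v(2) sS)
        also have "\<dots> \<le> L * d" using d[OF sS[OF s t]] LM by (simp add: dist_norm)
        finally show "norm (k u t s - k v t s) \<le> L * d" .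
      qed (use u v s in \<open>auto intro!: continuous_intros kcont1\<close>)
      moreover have "integral {0..1} (\<lambda>t. k u t s - k v t s) = integral {0..1} (\<lambda>t. k u t s) - integral {0..1} (\<lambda>t. k v t s)"
        using u v s by (intro integral_diff integrable_continuous_real kcont1)
      moreover have "T u s - T v s = fst s * (integral {0..1} (\<lambda>t. k u t s) - integral {0..1} (\<lambda>t. k v t s))"
        by (simp add: T_def algebra_simps)
      moreover have "norm (fst s) \<le> r" using s by (auto simp: S_def)
      ultimately have "norm (T u s - T v s) \<le> r * (L * d)"
        using r LM d0 by (simp add: norm_mult mult_mono)
      also have "\<dots> = (r * L) * d" by simp
      also have "\<dots> \<le> (1/2) * d" using r d0 by (intro mult_right_mono) auto
      finally show "dist (T u s) (T v s) \<le> d / 2" by (simp add: dist_norm)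
    qed auto
    show "\<exists>u :: complex \<Rightarrow> complex \<Rightarrow> complex.
       (\<forall>c\<in>ball y1 r. u x1 c = c) \<and> (\<forall>x\<in>ball x1 r. u x holomorphic_on ball y1 r) \<and>
       (\<forall>x\<in>ball x1 r. \<forall>c\<in>ball y1 r.
          ((\<lambda>x. u x c) has_field_derivative poly p x * u x c ^ 2 + poly q x * u x c ^ 3) (at x))"
    proof (intro exI[of _ "\<lambda>x c. u (x - x1, c)"] conjI ballI)
      fix c assume "c \<in> ball y1 r"
      then show "u (x1 - x1, c) = c" using u(3)[of "(0, c)"] r by (simp add: S_def T_def)
    next
      fix x assume "x \<in> ball x1 r"
      then show "(\<lambda>c. u (x - x1, c)) holomorphic_on ball y1 r"
        by (intro plot_holomorphicD[OF u(1)]) (auto simp: S_def dist_norm norm_minus_commute)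
    next
      fix x c assume x: "x \<in> ball x1 r" and c: "c \<in> ball y1 r"
      define g where "g z = f (x1 + z) (u (z, c))" for z
      have "(\<lambda>z. u (z, c)) holomorphic_on ball 0 r"
        by (rule plot_holomorphicD[OF u(1)]) (use c in \<open>auto simp: S_def\<close>)
      then have g: "g holomorphic_on ball 0 r"
        unfolding g_def f_def by (intro holomorphic_intros) auto
      have x0: "x - x1 \<in> ball 0 r" using x by (simp add: dist_norm norm_minus_commute)
      have "((\<lambda>z. c + z * integral {0..1} (\<lambda>t. g (of_real t * z))) has_field_derivative g (x - x1)) (at (x - x1))"
        using DERIV_add[OF DERIV_const[of c] has_field_derivative_scaled_integral[OF g x0]] by simp
      then have "((\<lambda>z. u (z, c)) has_field_derivative g (x - x1)) (at (x - x1))"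
      proof (rule has_field_derivative_transform_within_open[OF _ open_ball x0])
        fix z :: complex assume "z \<in> ball 0 r"
        then have "T u (z, c) = u (z, c)" using c by (intro u) (auto simp: S_def)
        then show "c + z * integral {0..1} (\<lambda>t. g (of_real t * z)) = u (z, c)"
          by (simp add: T_def k_def g_def)
      qed
      then have "((\<lambda>x. u (x - x1, c)) has_field_derivative g (x - x1) * 1) (at x)"
        by (intro DERIV_chain2[where g = "\<lambda>x. x - x1"]) (auto intro!: derivative_eq_intros)
      then show "((\<lambda>x. u (x - x1, c)) has_field_derivative
          poly p x * u (x - x1, c) ^ 2 + poly q x * u (x - x1, c) ^ 3) (at x)"
        by (simp add: g_def f_def)
    qed
  qed fact
qed

section \<open>Newton iteration and the square root chart\<close>

text \<open>The error after one Newton step for a root of \<open>E\<close> is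
  \<open>((u - v0)^2 + (E - v0^2)) / (2 u)\<close>. Its numerator is at most
  \<open>9/64 |v0|^2\<close>, while staying in the disc of radius \<open>|v0| / 8\<close> permits
  \<open>14/64 |v0|^2\<close>.\<close>

lemma newton_step_bound:
  fixes v0 u E :: complex
  assumes v0: "v0 \<noteq> 0" and u: "norm (u - v0) \<le> norm v0 / 8" and E: "norm (E - v0\<^sup>2) \<le> (norm v0)\<^sup>2 / 8"
  shows "norm ((u + E / u) / 2 - v0) \<le> norm v0 / 8"
proof -
  define n where "n = norm v0"
  have n: "n > 0" using v0 by (simp add: n_def)
  have nu: "norm u \<ge> 7/8 * n" using u norm_triangle_ineq2[of v0 u] by (simp add: n_def norm_minus_commute)
  then have u0: "u \<noteq> 0" using n by auto
  have eq: "(u + E / u) / 2 - v0 = ((u - v0)\<^sup>2 + (E - v0\<^sup>2)) / (2 * u)"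
    using u0 by (simp add: field_simps power2_eq_square)
  have "norm ((u - v0)\<^sup>2 + (E - v0\<^sup>2)) \<le> (n/8)\<^sup>2 + n\<^sup>2 / 8"
    by (intro norm_triangle_le add_mono) (use u E in \<open>auto simp: norm_power n_def intro!: power_mono[of _ "norm v0 / 8", simplified]\<close>)
  also have "\<dots> \<le> n / 8 * (2 * (7/8 * n))" by (simp add: power2_eq_square field_simps)
  also have "\<dots> \<le> n / 8 * norm (2 * u)" using nu n by (intro mult_left_mono) (auto simp: norm_mult)
  finally show ?thesis unfolding eq n_def[symmetric] using u0 by (simp add: norm_divide field_simps norm_mult)
qed

text \<open>The difference of the two steps is \<open>(u - v) (u v - E) + u (E - F)\<close> divided
  by \<open>2 u v\<close>. The first term is small because \<open>u v\<close> and \<open>E\<close>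
  are both near \<open>v0^2\<close>, the second by the bound on \<open>E - F\<close>. Relative to
  \<open>|u v|\<close> they contribute \<open>25/49 d\<close> and \<open>d / 14\<close>, together
  less than \<open>d\<close>, and the denominator supplies the factor 1/2.\<close>

lemma newton_step_contraction:
  fixes v0 u v E F :: complex
  assumes v0: "v0 \<noteq> 0" and u: "norm (u - v0) \<le> norm v0 / 8" and v: "norm (v - v0) \<le> norm v0 / 8"
    and E: "norm (E - v0\<^sup>2) \<le> (norm v0)\<^sup>2 / 8" and d: "norm (u - v) \<le> d" and EF: "norm (E - F) \<le> norm v0 * d / 16"
  shows "norm ((u + E / u) / 2 - (v + F / v) / 2) \<le> d / 2"
proof -
  define n where "n = norm v0"
  have n: "n > 0" using v0 by (simp add: n_def)
  have d0: "d \<ge> 0" using d norm_ge_zero order_trans by blast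
  have nu: "norm u \<ge> 7/8 * n" using u norm_triangle_ineq2[of v0 u] by (simp add: n_def norm_minus_commute)
  have nv: "norm v \<ge> 7/8 * n" using v norm_triangle_ineq2[of v0 v] by (simp add: n_def norm_minus_commute)
  have nv': "norm v \<le> 9/8 * n" using v norm_triangle_ineq2[of v v0] by (simp add: n_def)
  have u0: "u \<noteq> 0" "v \<noteq> 0" using nu nv n by auto
  have eq: "(u + E / u) / 2 - (v + F / v) / 2 = ((u - v) * (u * v - E) + u * (E - F)) / (2 * (u * v))"
    using u0 by (simp add: field_simps)
  have a: "norm ((u - v0) * v) \<le> (n/8) * (9/8 * n)" unfolding norm_mult
    by (intro mult_mono) (use u nv' n in \<open>auto simp: n_def\<close>)
  moreover have "norm (v0 * (v - v0)) \<le> n * (n / 8)" unfolding norm_mult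
    by (intro mult_mono) (use v n in \<open>auto simp: n_def\<close>)
  moreover have "norm (v0\<^sup>2 - E) \<le> n * n / 8" using E by (simp add: norm_minus_commute n_def power2_eq_square)
  moreover have eq2: "u * v - E = (u - v0) * v + v0 * (v - v0) + (v0\<^sup>2 - E)" by (simp add: algebra_simps power2_eq_square)
  ultimately have uvE: "norm (u * v - E) \<le> 25/64 * n * n"
    unfolding eq2 using norm_triangle_ineq[of "(u - v0) * v + v0 * (v - v0)" "v0\<^sup>2 - E"] norm_triangle_ineq[of "(u - v0) * v" "v0 * (v - v0)"]
    by (simp del: add_diff_eq)
  have nuv: "norm (u * v) \<ge> norm u * (7/8 * n)" unfolding norm_mult by (intro mult_left_mono nv) auto
  have nn: "n * n > 0" using n by simp
  have nuv2: "norm u * (7/8 * n) \<ge> 49/64 * (n * n)"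
    using mult_right_mono[OF nu, of "7/8 * n"] n by simp
  have nuv3: "norm (u * v) \<ge> 49/64 * (n * n)" using nuv2 nuv by (rule order_trans)
  have "norm ((u - v) * (u * v - E)) \<le> d * (25/64 * n * n)" unfolding norm_mult
    by (intro mult_mono d uvE d0) auto
  also have "\<dots> = d * (25/49 * (49/64 * (n * n)))" by simp
  also have "\<dots> \<le> d * (25/49 * norm (u * v))" using nuv3 d0 by (intro mult_left_mono) auto
  finally have 1: "norm ((u - v) * (u * v - E)) \<le> 25/49 * d * norm (u * v)" by simp
  have "norm (u * (E - F)) \<le> norm u * (n * d / 16)" unfolding norm_mult
    by (intro mult_left_mono) (use EF in \<open>auto simp: n_def\<close>)
  also have "\<dots> = d / 14 * (norm u * (7/8 * n))" by simp
  also have "\<dots> \<le> d / 14 * norm (u * v)" using nuv d0 by (intro mult_left_mono) auto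
  finally have 2: "norm (u * (E - F)) \<le> d / 14 * norm (u * v)" .
  have "25/49 * d * norm (u * v) + d / 14 * norm (u * v) \<le> d * norm (u * v)"
    using mult_nonneg_nonneg[OF d0 norm_ge_zero[of "u * v"]] by simp
  then have "norm ((u - v) * (u * v - E) + u * (E - F)) \<le> d * norm (u * v)"
    using norm_triangle_ineq[of "(u - v) * (u * v - E)" "u * (E - F)"] 1 2 by linarith
  then show ?thesis unfolding eq using u0 by (simp add: norm_divide field_simps norm_mult)
qed

text \<open>
  Near \<open>b\<close> the solution with singularity \<open>c\<close> is \<open>y = 1 / (z v(z, c))\<close> with \<open>x = c + z\<^sup>2\<close>; the derivative
  in \<open>v_ode\<close> is the equation \<open>w dw/dx = - p w - q\<close> for \<open>w = 1 / y = z v(z, c)\<close>.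
\<close>

locale square_root_chart =
  fixes p q :: "complex poly" and b :: complex and R m :: real and v :: "complex \<times> complex \<Rightarrow> complex"
  assumes R: "0 < R" "R \<le> 1" and m: "0 < m"
    and v: "plot_holomorphic (ball 0 R \<times> ball b R) v"
    and v_ge: "\<And>z c. z \<in> ball 0 R \<Longrightarrow> c \<in> ball b R \<Longrightarrow> m \<le> norm (v (z, c))"
    and v_ode: "\<And>z c. z \<in> ball 0 R \<Longrightarrow> c \<in> ball b R \<Longrightarrow> z \<noteq> 0 \<Longrightarrow>
       ((\<lambda>z. z * v (z, c)) has_field_derivative
         - 2 * z * (poly p (c + z\<^sup>2) * (z * v (z, c)) + poly q (c + z\<^sup>2)) / (z * v (z, c))) (at z)"

text \<open>In the coordinate \<open>z\<close> the equation reads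
  \<open>(w^2)' = - 4 z (p w + q)\<close>. Integrating from 0, where \<open>w\<close> vanishes,
  inserting \<open>w = z v\<close> and dividing by \<open>z^2\<close> gives
  \<open>v^2 = - 2 q(b) - 4 I\<close>, where \<open>I\<close> is the integral over \<open>t\<close>
  in \<open>{0..1}\<close> of \<open>t (p t z v + q - q(b))\<close>. The constant term is
  \<open>v0^2\<close>, and \<open>k\<close> is the integrand of \<open>I\<close>.\<close>

lemma square_root_chart_exists:
  fixes p q :: "complex poly" and b :: complex
  assumes qb: "poly q b \<noteq> 0"
  obtains R m v where "square_root_chart p q b R m v"
proof -
  define v0 where "v0 = csqrt (- 2 * poly q b)"
  have v0: "v0\<^sup>2 = - 2 * poly q b" "v0 \<noteq> 0" using qb by (auto simp: v0_def)
  define n where "n = norm v0"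
  have n: "n > 0" using v0 by (simp add: n_def)
  have "compact (poly p ` cball b 2)"
    by (intro compact_continuous_image continuous_intros compact_cball)
  then have "bounded (poly p ` cball b 2)" by (rule compact_imp_bounded)
  then obtain A where A: "A > 0" "\<And>x. x \<in> cball b 2 \<Longrightarrow> norm (poly p x) \<le> A"
    unfolding bounded_pos by (metis image_eqI)
  have "isCont (poly q) b" by simp
  then obtain e where e: "e > 0" "\<And>x. norm (x - b) < e \<Longrightarrow> norm (poly q x - poly q b) < n\<^sup>2 / 64"
    using n unfolding continuous_at_eps_delta dist_norm by (metis zero_less_divide_iff zero_less_numeral zero_less_power)
  \<comment> \<open>All points \<open>X t s\<close> lie within \<open>2 R\<close> of
    \<open>b\<close>, since \<open>R \<le> 1\<close> gives \<open>|z^2| \<le> R\<close>. Thus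
    \<open>e / 2\<close> keeps the variation of \<open>q\<close> below \<open>n^2 / 64\<close>, and
    \<open>n / (72 A)\<close> does the same for the term with \<open>p\<close>, as
    \<open>|v| \<le> 9/8 n\<close>. Together they give \<open>|E - v0^2| \<le> n^2 / 8\<close>, the
    hypothesis of the Newton step.\<close>
  define R where "R = min 1 (min (e / 2) (n / (72 * A)))"
  have R: "R > 0" "R \<le> 1" "2 * R \<le> e" "72 * (R * A) \<le> n"
  proof -
    have "R \<le> n / (72 * A)" by (simp add: R_def)
    then show "72 * (R * A) \<le> n" using A by (simp add: field_simps)
  qed (use e n A in \<open>auto simp: R_def\<close>)
  define S where "S = ball (0::complex) R \<times> ball b R"
  define X where "X t s = snd s + (of_real t * fst s)\<^sup>2" for t :: real and s :: "complex \<times> complex"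
  have Xb: "norm (X t s - b) < 2 * R" if "s \<in> S" "t \<in> {0..1}" for s t
  proof -
    have "of_real t * fst s \<in> ball 0 R" using that by (intro scale_in_ball) (auto simp: S_def)
    then have "norm ((of_real t * fst s)\<^sup>2) \<le> R * 1"
      unfolding power2_eq_square norm_mult[of "_ * _"] using R by (intro mult_mono) auto
    then have "norm ((of_real t * fst s)\<^sup>2) \<le> R" by simp
    moreover have "norm (snd s - b) < R" using that by (auto simp: S_def dist_norm norm_minus_commute)
    ultimately show ?thesis
      using norm_triangle_ineq[of "snd s - b" "(of_real t * fst s)\<^sup>2"] by (simp add: X_def algebra_simps)
  qed
  define k where "k u t s = of_real t * (poly p (X t s) * (of_real t * fst s * u (of_real t * fst s, snd s)) +
       (poly q (X t s) - poly q b))" for u :: "complex \<times> complex \<Rightarrow> complex" and t s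
  define E where "E u s = v0\<^sup>2 - 4 * integral {0..1} (\<lambda>t. k u t s)" for u s
  \<comment> \<open>The integrated equation for \<open>w\<^sup>2\<close> reads \<open>v\<^sup>2 = E v\<close>; \<open>T\<close> is its Newton step, which needs no branch of the root.\<close>
  define T where "T u s = (u s + E u s / u s) / 2" for u s
  have sS: "(of_real t * fst s, snd s) \<in> S" if "s \<in> S" "t \<in> {0..1}" for s t
    using that scale_in_ball[of "fst s" R t] by (auto simp: S_def)
  have kcont: "continuous_on (S \<times> {0..1}) (\<lambda>(s, t). k u t s)" if "plot_holomorphic S u" for u
    using continuous_on_scaled[of R "ball b R" u] that
    unfolding k_def X_def case_prod_beta S_def by (auto intro!: continuous_intros)
  have kcont1: "continuous_on {0..1} (\<lambda>t. k u t s)" if "plot_holomorphic S u" "s \<in> S" for u s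
  proof -
    have "continuous_on {0..1} (\<lambda>t. (\<lambda>(s, t). k u t s) (s, t))"
      by (rule continuous_on_compose2[OF kcont[OF that(1)]]) (use that in \<open>auto intro!: continuous_intros\<close>)
    then show ?thesis by simp
  qed
  have khol: "plot_holomorphic S (k u t)" if "plot_holomorphic S u" "t \<in> {0..1}" for u t
    unfolding plot_holomorphic_def
  proof (intro conjI allI impI)
    have "continuous_on S (\<lambda>s. (\<lambda>(s, t). k u t s) (s, t))"
      by (rule continuous_on_compose2[OF kcont[OF that(1)]]) (use that in \<open>auto intro!: continuous_intros\<close>)
    then show "continuous_on S (k u t)" by simp
    fix U a' b' assume U: "open U" "a' holomorphic_on U" "b' holomorphic_on U" "\<forall>z\<in>U. (a' z, b' z) \<in> S"
    show "(\<lambda>z. k u t (a' z, b' z)) holomorphic_on U"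
      using holomorphic_scaled[of R "ball b R" u t U a' b'] that U unfolding k_def X_def S_def
      by (auto intro!: holomorphic_intros)
  qed
  have Ehol: "plot_holomorphic S (E u)" if "plot_holomorphic S u" for u
  proof -
    have "plot_holomorphic S (\<lambda>s. integral {0..1} (\<lambda>t. k u t s))"
      using kcont khol that by (intro plot_holomorphic_integral) auto
    then show ?thesis
      unfolding E_def plot_holomorphic_def by (auto intro!: continuous_intros holomorphic_intros)
  qed
  have pX: "norm (poly p (X t s) * (of_real t * fst s)) \<le> n / 72" if "s \<in> S" "t \<in> {0..1}" for s t
  proof -
    have "of_real t * fst s \<in> ball 0 R" using that by (intro scale_in_ball) (auto simp: S_def)
    then have "norm (poly p (X t s) * (of_real t * fst s)) \<le> A * R"
      unfolding norm_mult[of "poly _ _"] using Xb[OF that] R A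
      by (intro mult_mono A) (auto simp: dist_norm norm_minus_commute)
    then show ?thesis using R by (simp add: mult.commute)
  qed
  have un: "norm y \<le> 9/8 * n" "norm y \<ge> 7/8 * n" "y \<noteq> 0" if "y \<in> cball v0 (n / 8)" for y
  proof -
    have *: "norm (y - v0) \<le> n / 8" using that by (simp add: dist_norm norm_minus_commute)
    show "norm y \<le> 9/8 * n" using * norm_triangle_ineq2[of y v0] by (simp add: n_def)
    show "norm y \<ge> 7/8 * n" using * norm_triangle_ineq2[of v0 y] by (simp add: n_def norm_minus_commute)
    then show "y \<noteq> 0" using n by auto
  qed
  have kbound: "norm (k u t s) \<le> n\<^sup>2 / 32" if "\<And>x. x \<in> S \<Longrightarrow> u x \<in> cball v0 (n / 8)" "s \<in> S" "t \<in> {0..1}" for u t s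
  proof -
    let ?a = "poly p (X t s) * (of_real t * fst s)" and ?u = "u (of_real t * fst s, snd s)"
    have "norm (?a * ?u) \<le> n / 72 * (9/8 * n)"
      unfolding norm_mult[of ?a] using pX[OF that(2,3)] un(1)[OF that(1)[OF sS[OF that(2,3)]]] n
      by (intro mult_mono) auto
    then have 1: "norm (?a * ?u) \<le> n\<^sup>2 / 64" by (simp add: power2_eq_square)
    have 2: "norm (poly q (X t s) - poly q b) < n\<^sup>2 / 64"
      using Xb[OF that(2,3)] R by (intro e) auto
    have "norm (?a * ?u + (poly q (X t s) - poly q b)) \<le> n\<^sup>2 / 32"
      using norm_triangle_ineq[of "?a * ?u" "poly q (X t s) - poly q b"] 1 2 by linarith
    then have "norm (complex_of_real t) * norm (?a * ?u + (poly q (X t s) - poly q b)) \<le> 1 * (n\<^sup>2 / 32)"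
      by (intro mult_mono) (use that in auto)
    then show ?thesis unfolding k_def norm_mult[of "of_real t"] by (simp add: mult.assoc)
  qed
  have Ebound: "norm (E u s - v0\<^sup>2) \<le> (norm v0)\<^sup>2 / 8"
    if "plot_holomorphic S u" "\<And>x. x \<in> S \<Longrightarrow> u x \<in> cball v0 (n / 8)" "s \<in> S" for u s
  proof -
    have "norm (integral {0..1} (\<lambda>t. k u t s)) \<le> n\<^sup>2 / 32 * (1 - 0)"
      using that by (intro integral_bound kcont1 kbound) auto
    then show ?thesis by (simp add: E_def n_def norm_mult)
  qed
  have Elip: "norm (E u s - E w s) \<le> norm v0 * d / 16"
    if u: "plot_holomorphic S u" and w: "plot_holomorphic S w" and d: "\<And>x. x \<in> S \<Longrightarrow> dist (u x) (w x) \<le> d"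
      and s: "s \<in> S" for u w d s
  proof -
    have d0: "d \<ge> 0" using d[OF s] by (meson dist_commute order_trans zero_le_dist)
    have "norm (integral {0..1} (\<lambda>t. k u t s - k w t s)) \<le> (n / 72 * d) * (1 - 0)"
    proof (rule integral_bound)
      fix t :: real assume t: "t \<in> {0..1}"
      let ?a = "poly p (X t s) * (of_real t * fst s)" and ?d = "u (of_real t * fst s, snd s) - w (of_real t * fst s, snd s)"
      have "norm (?a * ?d) \<le> n / 72 * d"
        unfolding norm_mult[of ?a] using pX[OF s t] d[OF sS[OF s t]] n by (intro mult_mono) (auto simp: dist_norm)
      then have "norm (complex_of_real t) * norm (?a * ?d) \<le> 1 * (n / 72 * d)"
        by (intro mult_mono) (use t in auto)
      moreover have "k u t s - k w t s = of_real t * (?a * ?d)" by (simp add: k_def algebra_simps)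
      ultimately show "norm (k u t s - k w t s) \<le> n / 72 * d" by (simp add: norm_mult)
    qed (use u w s in \<open>auto intro!: continuous_intros kcont1\<close>)
    moreover have "integral {0..1} (\<lambda>t. k u t s - k w t s) = integral {0..1} (\<lambda>t. k u t s) - integral {0..1} (\<lambda>t. k w t s)"
      using u w s by (intro integral_diff integrable_continuous_real kcont1)
    moreover have eq: "E u s - E w s = - 4 * (integral {0..1} (\<lambda>t. k u t s) - integral {0..1} (\<lambda>t. k w t s))"
      by (simp add: E_def)
    ultimately have "norm (E u s - E w s) \<le> 4 * (n / 72 * d)" unfolding eq norm_mult by (simp add: mult.commute)
    also have "\<dots> \<le> n * d / 16" using mult_nonneg_nonneg[OF less_imp_le[OF n] d0] by (simp add: mult.commute)
    finally show ?thesis by (simp add: n_def)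
  qed
  obtain v where v: "plot_holomorphic S v" "\<And>x. x \<in> S \<Longrightarrow> v x \<in> cball v0 (n / 8)" "\<And>x. x \<in> S \<Longrightarrow> T v x = v x"
  proof (rule plot_holomorphic_fixpoint[of "n / 8" S v0 T])
    fix u assume u: "plot_holomorphic S u" "\<And>x. x \<in> S \<Longrightarrow> u x \<in> cball v0 (n / 8)"
    show "plot_holomorphic S (T u)"
      using Ehol[OF u(1)] u(1) un(3)[OF u(2)] unfolding T_def plot_holomorphic_def
      by (auto intro!: continuous_intros holomorphic_intros)
    fix s assume s: "s \<in> S"
    show "T u s \<in> cball v0 (n / 8)"
      using newton_step_bound[OF v0(2) _ Ebound[OF u s]] u(2)[OF s]
      by (simp add: T_def dist_norm norm_minus_commute n_def)
  next
    fix u w d s assume u: "plot_holomorphic S u" "\<And>x. x \<in> S \<Longrightarrow> u x \<in> cball v0 (n / 8)"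
      and w: "plot_holomorphic S w" "\<And>x. x \<in> S \<Longrightarrow> w x \<in> cball v0 (n / 8)"
      and d: "\<And>x. x \<in> S \<Longrightarrow> dist (u x) (w x) \<le> d" and s: "s \<in> S"
    show "dist (T u s) (T w s) \<le> d / 2"
      unfolding dist_norm T_def using u(2)[OF s] w(2)[OF s] d[OF s]
      by (intro newton_step_contraction[OF v0(2) _ _ Ebound[OF u s] _ Elip[OF u(1) w(1) d s]])
        (auto simp: dist_norm norm_minus_commute n_def)
  qed (use n in auto)
  have vE: "(v s)\<^sup>2 = E v s" if "s \<in> S" for s
    using v(3)[OF that] un(3)[OF v(2)[OF that]] by (simp add: T_def field_simps power2_eq_square)
  show ?thesis
  proof (rule that[of R "7/8 * n" v], unfold_locales)
    show "plot_holomorphic (ball 0 R \<times> ball b R) v" using v(1) by (simp add: S_def)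
    show "7/8 * n \<le> norm (v (z, c))" if "z \<in> ball 0 R" "c \<in> ball b R" for z c
      using that by (intro un v) (auto simp: S_def)
    fix z c :: complex assume z: "z \<in> ball 0 R" and c: "c \<in> ball b R" and z0: "z \<noteq> 0"
    have vh: "(\<lambda>z. v (z, c)) holomorphic_on ball 0 R"
      by (rule plot_holomorphicD[OF v(1)]) (use c in \<open>auto simp: S_def\<close>)
    define g where "g z = z * (poly p (c + z\<^sup>2) * (z * v (z, c)) + (poly q (c + z\<^sup>2) - poly q b))" for z
    have g: "g holomorphic_on ball 0 R"
      unfolding g_def using vh by (intro holomorphic_intros) auto
    define w where "w z = z * v (z, c)" for z
    \<comment> \<open>An explicit integral formula is available for \<open>w^2\<close>, not for
      \<open>w\<close>. It is brought into the form of a primitive to be differentiated; dividing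
      \<open>(w^2)' = 2 w w'\<close> by \<open>2 w\<close>, nonzero for \<open>z \<noteq> 0\<close>,
      yields \<open>v_ode\<close>.\<close>
    have w2: "(w z)\<^sup>2 = z\<^sup>2 * v0\<^sup>2 - 4 * (z * integral {0..1} (\<lambda>t. g (of_real t * z)))" if "z \<in> ball 0 R" for z
    proof -
      have "(w z)\<^sup>2 = z\<^sup>2 * v0\<^sup>2 - 4 * (z * (z * integral {0..1} (\<lambda>t. k v t (z, c))))"
      proof -
        have "(z, c) \<in> S" using that c by (simp add: S_def)
        then have "(w z)\<^sup>2 = z\<^sup>2 * E v (z, c)" by (simp only: w_def power_mult_distrib vE)
        then show ?thesis by (simp add: E_def right_diff_distrib power2_eq_square)
      qed
      moreover have "z * integral {0..1} (\<lambda>t. k v t (z, c)) = integral {0..1} (\<lambda>t. g (of_real t * z))"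
        by (subst integral_mult_right[symmetric]) (simp add: k_def g_def X_def algebra_simps)
      ultimately show ?thesis by simp
    qed
    have "((\<lambda>z. z\<^sup>2 * v0\<^sup>2 - 4 * (z * integral {0..1} (\<lambda>t. g (of_real t * z)))) has_field_derivative
        2 * z * v0\<^sup>2 - 4 * g z) (at z)"
    proof (rule DERIV_diff)
      show "((\<lambda>z. z\<^sup>2 * v0\<^sup>2) has_field_derivative 2 * z * v0\<^sup>2) (at z)"
        by (auto intro!: derivative_eq_intros)
      show "((\<lambda>z. 4 * (z * integral {0..1} (\<lambda>t. g (of_real t * z)))) has_field_derivative 4 * g z) (at z)"
        by (rule DERIV_cmult[OF has_field_derivative_scaled_integral[OF g z]])
    qed
    then have d1: "((\<lambda>z. (w z)\<^sup>2) has_field_derivative 2 * z * v0\<^sup>2 - 4 * g z) (at z)"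
      by (rule has_field_derivative_transform_within_open[OF _ open_ball z]) (simp add: w2)
    have "w holomorphic_on ball 0 R" unfolding w_def using vh by (intro holomorphic_intros)
    then obtain D where D: "(w has_field_derivative D) (at z)"
      using z holomorphic_on_imp_differentiable_at field_differentiable_def open_ball by metis
    have "((\<lambda>z. (w z)\<^sup>2) has_field_derivative 2 * w z * D) (at z)"
      using D by (auto intro!: derivative_eq_intros)
    then have "2 * w z * D = 2 * z * v0\<^sup>2 - 4 * g z" using d1 DERIV_unique by blast
    define X where "X = - 2 * z * (poly p (c + z\<^sup>2) * w z + poly q (c + z\<^sup>2))"
    have "2 * z * v0\<^sup>2 - 4 * g z = 2 * X"
      by (simp add: X_def v0 g_def w_def algebra_simps)
    then have "w z * D = X" using \<open>2 * w z * D = _\<close> by simp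
    moreover have "w z \<noteq> 0" using un(3)[OF v(2), of "(z, c)"] z c z0 by (auto simp: w_def S_def)
    ultimately have "D = X / w z" by (simp add: nonzero_eq_divide_eq mult.commute)
    then show "((\<lambda>z. z * v (z, c)) has_field_derivative
         - 2 * z * (poly p (c + z\<^sup>2) * (z * v (z, c)) + poly q (c + z\<^sup>2)) / (z * v (z, c))) (at z)"
      using D unfolding w_def X_def by simp
  qed (use R n in auto)
qed

subsection \<open>Analytic continuation of solutions\<close>

definition germ_eq :: "(complex \<Rightarrow> complex) \<Rightarrow> (complex \<Rightarrow> complex) \<Rightarrow> complex \<Rightarrow> bool" where
  "germ_eq f g x \<longleftrightarrow> (\<forall>\<^sub>F z in nhds x. f z = g z)"

definition solves :: "complex poly \<Rightarrow> complex poly \<Rightarrow> (complex \<Rightarrow> complex) \<Rightarrow> complex \<Rightarrow> bool" where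
  "solves p q f x \<longleftrightarrow>
     (\<forall>\<^sub>F z in nhds x. (f has_field_derivative (poly p z * f z ^ 2 + poly q z * f z ^ 3)) (at z))"

text \<open>Unlike \<open>solution_along\<close>, this carries the equation at every parameter and
  fixes no initial value, so that it can be restricted, reparametrized and glued.
  \<open>solution_along_iff\<close> connects the two notions.\<close>

definition solution_continuation ::
    "complex poly \<Rightarrow> complex poly \<Rightarrow> (real \<Rightarrow> complex) \<Rightarrow> real set \<Rightarrow> (real \<Rightarrow> complex \<Rightarrow> complex) \<Rightarrow> bool" where
  "solution_continuation p q s T F \<longleftrightarrow> analytic_continuation s T F \<and> (\<forall>t\<in>T. solves p q (F t) (s t))"

lemma germ_eq_at: "germ_eq f g x \<Longrightarrow> f x = g x"
  unfolding germ_eq_def by (rule eventually_nhds_x_imp_x)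

lemma germ_eq_refl [simp]: "germ_eq f f x"
  by (simp add: germ_eq_def)

lemma germ_eq_sym: "germ_eq f g x \<Longrightarrow> germ_eq g f x"
  by (simp add: germ_eq_def eq_commute)

lemma germ_eq_trans: "germ_eq f g x \<Longrightarrow> germ_eq g h x \<Longrightarrow> germ_eq f h x"
  unfolding germ_eq_def by (erule (1) eventually_elim2) simp

lemma germ_eq_ball:
  assumes "f holomorphic_on ball c r" "g holomorphic_on ball c r" "x \<in> ball c r" "germ_eq f g x" "y \<in> ball c r"
  shows "f y = g y"
proof -
  have "\<forall>\<^sub>F z in nhds x. f z = g z \<and> z \<in> ball c r"
    using assms(3,4) unfolding germ_eq_def by (intro eventually_conj eventually_nhds_in_open) auto
  then obtain S where S: "open S" "x \<in> S" "\<forall>z\<in>S. f z = g z \<and> z \<in> ball c r"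
    unfolding eventually_nhds by blast
  show ?thesis
    by (rule analytic_continuation_open[of S "ball c r" f g]) (use S assms in auto)
qed

lemma germ_eqI: "open S \<Longrightarrow> x \<in> S \<Longrightarrow> (\<And>z. z \<in> S \<Longrightarrow> f z = g z) \<Longrightarrow> germ_eq f g x"
  unfolding germ_eq_def eventually_nhds by blast

lemma solves_cong: "germ_eq f g x \<Longrightarrow> solves p q f x \<Longrightarrow> solves p q g x"
proof -
  assume eq: "germ_eq f g x" and sol: "solves p q f x"
  have "\<forall>\<^sub>F z in nhds x. germ_eq f g z" using eq by (simp add: germ_eq_def eventually_eventually)
  with sol show ?thesis unfolding solves_def
  proof eventually_elim
    case (elim z)
    then show ?case
      using germ_eq_at[OF elim(2)] DERIV_cong_ev[OF refl elim(2)[unfolded germ_eq_def] refl] by simp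
  qed
qed

lemma solvesI:
  assumes "open S" "x \<in> S"
    "\<And>z. z \<in> S \<Longrightarrow> (f has_field_derivative (poly p z * f z ^ 2 + poly q z * f z ^ 3)) (at z)"
  shows "solves p q f x"
  unfolding solves_def eventually_nhds using assms by blast

text \<open>Both \<open>deriv f\<close> and the right-hand side are holomorphic on the ball and
  agree near \<open>x\<close>, so the identity theorem spreads the equation.\<close>

lemma solves_ball:
  assumes f: "f holomorphic_on ball c r" and x: "x \<in> ball c r" "solves p q f x" and y: "y \<in> ball c r"
  shows "solves p q f y"
proof -
  have f': "deriv f holomorphic_on ball c r" using f by (intro holomorphic_deriv) auto
  have "germ_eq (deriv f) (\<lambda>z. poly p z * f z ^ 2 + poly q z * f z ^ 3) x"
    using x(2) unfolding solves_def germ_eq_def by eventually_elim (rule DERIV_imp_deriv)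
  moreover have "(\<lambda>z. poly p z * f z ^ 2 + poly q z * f z ^ 3) holomorphic_on ball c r"
    using f by (intro holomorphic_intros)
  ultimately have eq: "deriv f z = poly p z * f z ^ 2 + poly q z * f z ^ 3" if "z \<in> ball c r" for z
    using germ_eq_ball[OF f' _ x(1) _ that, of "\<lambda>z. poly p z * f z ^ 2 + poly q z * f z ^ 3"] by simp
  show ?thesis
    by (rule solvesI[OF open_ball y]) (metis eq f holomorphic_derivI open_ball)
qed

text \<open>The difference \<open>f - g\<close> satisfies a linear homogeneous equation with a
  holomorphic coefficient. Multiplied by the integrating factor \<open>exp (- K)\<close> it is
  constant, and it vanishes at \<open>x\<close>.\<close>

lemma solves_unique:
  assumes f: "solves p q f x" and g: "solves p q g x" and eq: "f x = g x"
  shows "germ_eq f g x"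
proof -
  have "\<forall>\<^sub>F z in nhds x. (f has_field_derivative (poly p z * f z ^ 2 + poly q z * f z ^ 3)) (at z) \<and>
      (g has_field_derivative (poly p z * g z ^ 2 + poly q z * g z ^ 3)) (at z)"
    using f g unfolding solves_def by (rule eventually_conj)
  then obtain r where r: "r > 0" and fg: "\<And>z. z \<in> ball x r \<Longrightarrow> (f has_field_derivative (poly p z * f z ^ 2 + poly q z * f z ^ 3)) (at z)"
      "\<And>z. z \<in> ball x r \<Longrightarrow> (g has_field_derivative (poly p z * g z ^ 2 + poly q z * g z ^ 3)) (at z)"
    unfolding eventually_nhds_metric by (auto simp: dist_commute)
  \<comment> \<open>\<open>k\<close> is the divided difference of the right-hand side: \<open>f' - g' = k (f - g)\<close>.\<close>
  define k where "k z = poly p z * (f z + g z) + poly q z * (f z ^ 2 + f z * g z + g z ^ 2)" for z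
  have "f holomorphic_on ball x r" "g holomorphic_on ball x r"
    using fg unfolding holomorphic_on_open[OF open_ball] by blast+
  then have "k holomorphic_on ball x r" unfolding k_def by (intro holomorphic_intros)
  then obtain K where K: "\<And>z. z \<in> ball x r \<Longrightarrow> (K has_field_derivative k z) (at z within ball x r)"
    using holomorphic_convex_primitive'[OF convex_ball open_ball] by blast
  define D where "D z = (f z - g z) * exp (- K z)" for z
  have "(D has_field_derivative 0) (at z within ball x r)" if z: "z \<in> ball x r" for z
  proof -
    have "((\<lambda>z. (f z - g z) * exp (- K z)) has_field_derivative
       ((poly p z * f z ^ 2 + poly q z * f z ^ 3) - (poly p z * g z ^ 2 + poly q z * g z ^ 3)) * exp (- K z)
        + (f z - g z) * (exp (- K z) * (- k z))) (at z within ball x r)"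
      using DERIV_subset[OF fg(1)[OF z]] DERIV_subset[OF fg(2)[OF z]] K[OF z]
      by (auto intro!: derivative_eq_intros)
    moreover have "((poly p z * f z ^ 2 + poly q z * f z ^ 3) - (poly p z * g z ^ 2 + poly q z * g z ^ 3)) * exp (- K z)
        + (f z - g z) * (exp (- K z) * (- k z)) = 0"
      by (simp add: k_def algebra_simps power2_eq_square power3_eq_cube)
    ultimately show ?thesis unfolding D_def by simp
  qed
  then obtain c where c: "\<And>z. z \<in> ball x r \<Longrightarrow> D z = c"
    using has_field_derivative_zero_constant[OF convex_ball, of x r D] by blast
  have "D z = 0" if "z \<in> ball x r" for z
    using c[OF that] c[of x] r eq by (simp add: D_def)
  then show ?thesis
    by (intro germ_eqI[OF open_ball, of x x r]) (use r in \<open>auto simp: D_def\<close>)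
qed

text \<open>The punctured neighbourhoods in the definition can be replaced by full ones because
  \<open>germ_eq\<close> is reflexive.\<close>

lemma analytic_continuation_iff:
  "analytic_continuation s T F \<longleftrightarrow> (\<forall>t\<in>T. F t analytic_on {s t}) \<and>
     (\<forall>t\<in>T. \<exists>d>0. \<forall>t'\<in>T. dist t' t < d \<longrightarrow> germ_eq (F t') (F t) (s t'))"
proof -
  have "(\<forall>\<^sub>F t' in at t within T. germ_eq (F t') (F t) (s t')) \<longleftrightarrow>
     (\<exists>d>0. \<forall>t'\<in>T. dist t' t < d \<longrightarrow> germ_eq (F t') (F t) (s t'))" for t
    unfolding eventually_at by (rule ex_cong1, rule conj_cong[OF refl], rule ball_cong[OF refl]) auto
  then show ?thesis unfolding analytic_continuation_def germ_eq_def by simp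
qed

lemma analytic_continuation_nbhd:
  assumes F: "analytic_continuation s T F" and s: "continuous_on T s" and t: "t \<in> T" and e: "e > 0"
  obtains d where "d > 0" "\<And>t'. t' \<in> T \<Longrightarrow> dist t' t < d \<Longrightarrow> germ_eq (F t') (F t) (s t')"
    "\<And>t'. t' \<in> T \<Longrightarrow> dist t' t < d \<Longrightarrow> s t' \<in> ball (s t) e"
proof -
  obtain d1 where d1: "d1 > 0" "\<And>t'. t' \<in> T \<Longrightarrow> dist t' t < d1 \<Longrightarrow> germ_eq (F t') (F t) (s t')"
    using F t unfolding analytic_continuation_iff by blast
  obtain d2 where d2: "d2 > 0" "\<And>t'. t' \<in> T \<Longrightarrow> dist t' t < d2 \<Longrightarrow> dist (s t') (s t) < e"
    using s t e unfolding continuous_on_iff by blast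
  show ?thesis by (rule that[of "min d1 d2"]) (use d1 d2 in \<open>auto simp: dist_commute\<close>)
qed

text \<open>Near a parameter \<open>a\<close> both continuations are represented by the single
  elements \<open>F a\<close> and \<open>G a\<close> on a common disc, so agreement at one nearby
  parameter passes through this disc to all others by the identity theorem. Connectedness of
  \<open>T\<close> turns this local statement into a global one.\<close>

lemma analytic_continuation_unique:
  assumes T: "connected T" and s: "continuous_on T s" and F: "analytic_continuation s T F" and G: "analytic_continuation s T G"
    and t0: "t0 \<in> T" "germ_eq (F t0) (G t0) (s t0)" and t: "t \<in> T"
  shows "germ_eq (F t) (G t) (s t)"
proof (rule connected_induction_simple[OF T t0(1) t, where P = "\<lambda>t. germ_eq (F t) (G t) (s t)"])
  show "germ_eq (F t0) (G t0) (s t0)" by fact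
  fix a assume a: "a \<in> T"
  obtain e1 where e1: "e1 > 0" "F a holomorphic_on ball (s a) e1"
    using F a unfolding analytic_continuation_def analytic_at_ball by blast
  obtain e2 where e2: "e2 > 0" "G a holomorphic_on ball (s a) e2"
    using G a unfolding analytic_continuation_def analytic_at_ball by blast
  define e where "e = min e1 e2"
  have e: "e > 0" "F a holomorphic_on ball (s a) e" "G a holomorphic_on ball (s a) e"
    using e1 e2 by (auto simp: e_def intro: holomorphic_on_subset)
  obtain d1 where d1: "d1 > 0" "\<And>t'. t' \<in> T \<Longrightarrow> dist t' a < d1 \<Longrightarrow> germ_eq (F t') (F a) (s t')"
    "\<And>t'. t' \<in> T \<Longrightarrow> dist t' a < d1 \<Longrightarrow> s t' \<in> ball (s a) e"
    using analytic_continuation_nbhd[OF F s a e(1)] by blast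
  obtain d2 where d2: "d2 > 0" "\<And>t'. t' \<in> T \<Longrightarrow> dist t' a < d2 \<Longrightarrow> germ_eq (G t') (G a) (s t')"
    "\<And>t'. t' \<in> T \<Longrightarrow> dist t' a < d2 \<Longrightarrow> s t' \<in> ball (s a) e"
    using analytic_continuation_nbhd[OF G s a e(1)] by blast
  have "germ_eq (F y) (G y) (s y)"
    if x: "x \<in> T" "dist x a < min d1 d2" "germ_eq (F x) (G x) (s x)" and y: "y \<in> T" "dist y a < min d1 d2" for x y
  proof -
    have "germ_eq (F a) (F x) (s x)" "germ_eq (G x) (G a) (s x)"
      using d1(2)[of x] d2(2)[of x] x by (auto intro: germ_eq_sym)
    then have "germ_eq (F a) (G a) (s x)" using x(3) germ_eq_trans by blast
    then have "F a z = G a z" if "z \<in> ball (s a) e" for z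
      using germ_eq_ball[OF e(2,3) _ _ that] d1(3)[of x] x by auto
    then have "germ_eq (F a) (G a) (s y)"
      using d1(3)[of y] y by (intro germ_eqI[OF open_ball]) auto
    moreover have "germ_eq (F y) (F a) (s y)" "germ_eq (G a) (G y) (s y)"
      using d1(2)[of y] d2(2)[of y] y by (auto intro: germ_eq_sym)
    ultimately show ?thesis using germ_eq_trans by blast
  qed
  note step = this
  show "\<exists>U. openin (top_of_set T) U \<and> a \<in> U \<and> (\<forall>x\<in>U. \<forall>y\<in>U. germ_eq (F x) (G x) (s x) \<longrightarrow> germ_eq (F y) (G y) (s y))"
  proof (intro exI[of _ "T \<inter> ball a (min d1 d2)"] conjI ballI impI)
    show "openin (top_of_set T) (T \<inter> ball a (min d1 d2))" by (simp add: openin_open_Int)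
    show "a \<in> T \<inter> ball a (min d1 d2)" using a d1(1) d2(1) by simp
    fix x y assume "x \<in> T \<inter> ball a (min d1 d2)" "y \<in> T \<inter> ball a (min d1 d2)" "germ_eq (F x) (G x) (s x)"
    then show "germ_eq (F y) (G y) (s y)" using step[of x y] by (simp add: dist_commute)
  qed
qed

text \<open>Permanence of the equation: near \<open>a\<close> only the element \<open>F a\<close>
  matters, and \<open>solves_ball\<close> spreads the equation over its disc.\<close>

lemma solves_continuation:
  assumes T: "connected T" and s: "continuous_on T s" and F: "analytic_continuation s T F"
    and t0: "t0 \<in> T" "solves p q (F t0) (s t0)" and t: "t \<in> T"
  shows "solves p q (F t) (s t)"
proof (rule connected_induction_simple[OF T t0(1) t, where P = "\<lambda>t. solves p q (F t) (s t)"])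
  show "solves p q (F t0) (s t0)" by fact
  fix a assume a: "a \<in> T"
  obtain e where e: "e > 0" "F a holomorphic_on ball (s a) e"
    using F a unfolding analytic_continuation_def analytic_at_ball by blast
  obtain d where d: "d > 0" "\<And>t'. t' \<in> T \<Longrightarrow> dist t' a < d \<Longrightarrow> germ_eq (F t') (F a) (s t')"
    "\<And>t'. t' \<in> T \<Longrightarrow> dist t' a < d \<Longrightarrow> s t' \<in> ball (s a) e"
    using analytic_continuation_nbhd[OF F s a e(1)] by blast
  have "solves p q (F y) (s y)"
    if x: "x \<in> T" "dist x a < d" "solves p q (F x) (s x)" and y: "y \<in> T" "dist y a < d" for x y
  proof -
    have "solves p q (F a) (s x)" using solves_cong[OF d(2) x(3)] x by blast
    then have "solves p q (F a) (s y)" using solves_ball[OF e(2) d(3) _ d(3)] x y by blast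
    then show ?thesis using solves_cong[OF germ_eq_sym[OF d(2)]] y by blast
  qed
  note step = this
  show "\<exists>U. openin (top_of_set T) U \<and> a \<in> U \<and> (\<forall>x\<in>U. \<forall>y\<in>U. solves p q (F x) (s x) \<longrightarrow> solves p q (F y) (s y))"
  proof (intro exI[of _ "T \<inter> ball a (d)"] conjI ballI impI)
    show "openin (top_of_set T) (T \<inter> ball a (d))" by (simp add: openin_open_Int)
    show "a \<in> T \<inter> ball a (d)" using a d(1) by simp
    fix x y assume "x \<in> T \<inter> ball a (d)" "y \<in> T \<inter> ball a (d)" "solves p q (F x) (s x)"
    then show "solves p q (F y) (s y)" using step[of x y] by (simp add: dist_commute)
  qed
qed

lemma solution_along_iff:
  assumes "connected T" "0 \<in> T" "continuous_on T s"
  shows "solution_along p q s T ya F \<longleftrightarrow> solution_continuation p q s T F \<and> F 0 (s 0) = ya"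
  using solves_continuation[OF assms(1,3) _ assms(2), of F p q] assms(2)
  unfolding solution_along_def solution_continuation_def solves_def pathstart_def by blast

lemma solution_continuation_unique:
  assumes "connected T" "continuous_on T s" "solution_continuation p q s T F" "solution_continuation p q s T G"
    and "t0 \<in> T" "F t0 (s t0) = G t0 (s t0)" "t \<in> T"
  shows "germ_eq (F t) (G t) (s t)"
  using assms solves_unique[of p q "F t0" "s t0" "G t0"] analytic_continuation_unique[of T s F G t0 t]
  by (auto simp: solution_continuation_def)

lemma analytic_continuation_subset:
  "analytic_continuation s T F \<Longrightarrow> T' \<subseteq> T \<Longrightarrow> analytic_continuation s T' F"
  unfolding analytic_continuation_iff by (meson subsetD)

lemma solution_continuation_subset:
  "solution_continuation p q s T F \<Longrightarrow> T' \<subseteq> T \<Longrightarrow> solution_continuation p q s T' F"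
  unfolding solution_continuation_def using analytic_continuation_subset by blast

lemma analytic_continuation_reparam:
  assumes F: "analytic_continuation s T F" and h: "continuous_on T' h" "h ` T' \<subseteq> T"
    and s': "\<And>t. t \<in> T' \<Longrightarrow> s' t = s (h t)"
  shows "analytic_continuation s' T' (\<lambda>t. F (h t))"
  unfolding analytic_continuation_iff
proof (intro conjI ballI)
  fix t assume t: "t \<in> T'"
  then show "F (h t) analytic_on {s' t}" using F h s' by (auto simp: analytic_continuation_iff)
  obtain d where d: "d > 0" "\<And>t'. t' \<in> T \<Longrightarrow> dist t' (h t) < d \<Longrightarrow> germ_eq (F t') (F (h t)) (s t')"
    using F t h unfolding analytic_continuation_iff by blast
  obtain d' where d': "d' > 0" "\<And>t'. t' \<in> T' \<Longrightarrow> dist t' t < d' \<Longrightarrow> dist (h t') (h t) < d"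
    using h(1) t d(1) unfolding continuous_on_iff by blast
  show "\<exists>d>0. \<forall>t'\<in>T'. dist t' t < d \<longrightarrow> germ_eq (F (h t')) (F (h t)) (s' t')"
    using d d' h s' by (intro exI[of _ d']) (auto simp: image_subset_iff)
qed

lemma solution_continuation_reparam:
  assumes "solution_continuation p q s T F" "continuous_on T' h" "h ` T' \<subseteq> T"
    "\<And>t. t \<in> T' \<Longrightarrow> s' t = s (h t)"
  shows "solution_continuation p q s' T' (\<lambda>t. F (h t))"
  using assms analytic_continuation_reparam[of s T F T' h s'] unfolding solution_continuation_def by auto

text \<open>Only the junction \<open>v\<close> is delicate. There the two germs agree, hence so do
  the two elements on a disc about \<open>s v\<close>, which still contains \<open>s t'\<close> for
  parameters \<open>t'\<close> slightly beyond \<open>v\<close>.\<close>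

lemma analytic_continuation_join:
  assumes F: "analytic_continuation s T1 F" and G: "analytic_continuation s T2 G"
    and s: "continuous_on (T1 \<union> T2) s" and v: "v \<in> T1" "v \<in> T2" "T1 \<subseteq> {..v}" "T2 \<subseteq> {v..}"
    and eq: "germ_eq (F v) (G v) (s v)"
  shows "analytic_continuation s (T1 \<union> T2) (\<lambda>t. if t \<le> v then F t else G t)"
  unfolding analytic_continuation_iff
proof (intro conjI ballI)
  let ?H = "\<lambda>t. if t \<le> v then F t else G t"
  fix t assume t: "t \<in> T1 \<union> T2"
  have tF: "t \<in> T1" if "t \<le> v" using t v that by force
  have tG: "t \<in> T2" if "t > v" using t v that by force
  show "?H t analytic_on {s t}" using F G tF tG by (auto simp: analytic_continuation_iff)
  consider "t < v" | "t = v" | "t > v" by linarith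
  then show "\<exists>d>0. \<forall>t'\<in>T1 \<union> T2. dist t' t < d \<longrightarrow> germ_eq (?H t') (?H t) (s t')"
  proof cases
    case 1
    obtain d where d: "d > 0" "\<And>t'. t' \<in> T1 \<Longrightarrow> dist t' t < d \<Longrightarrow> germ_eq (F t') (F t) (s t')"
      using F tF 1 unfolding analytic_continuation_iff by (meson less_imp_le)
    have "germ_eq (?H t') (?H t) (s t')" if "t' \<in> T1 \<union> T2" "dist t' t < min d (v - t)" for t'
    proof -
      have "t' < v" using that by (auto simp: dist_real_def)
      then show ?thesis using that 1 d(2)[of t'] v by force
    qed
    then show ?thesis using 1 d(1) by (intro exI[of _ "min d (v - t)"]) auto
  next
    case 3
    obtain d where d: "d > 0" "\<And>t'. t' \<in> T2 \<Longrightarrow> dist t' t < d \<Longrightarrow> germ_eq (G t') (G t) (s t')"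
      using G tG 3 unfolding analytic_continuation_iff by (meson less_imp_le)
    have "germ_eq (?H t') (?H t) (s t')" if "t' \<in> T1 \<union> T2" "dist t' t < min d (t - v)" for t'
    proof -
      have "t' > v" using that by (auto simp: dist_real_def)
      then show ?thesis using that 3 d(2)[of t'] v by force
    qed
    then show ?thesis using 3 d(1) by (intro exI[of _ "min d (t - v)"]) auto
  next
    case 2
    obtain e where e: "e > 0" "\<And>z. z \<in> ball (s v) e \<Longrightarrow> F v z = G v z"
      using eq unfolding germ_eq_def eventually_nhds_metric by (auto simp: dist_commute)
    have sc: "continuous_on T1 s" "continuous_on T2 s" by (auto intro: continuous_on_subset[OF s])
    obtain d1 where d1: "d1 > 0" "\<And>t'. t' \<in> T1 \<Longrightarrow> dist t' v < d1 \<Longrightarrow> germ_eq (F t') (F v) (s t')"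
      "\<And>t'. t' \<in> T1 \<Longrightarrow> dist t' v < d1 \<Longrightarrow> s t' \<in> ball (s v) e"
      using analytic_continuation_nbhd[OF F sc(1) v(1) e(1)] by blast
    obtain d2 where d2: "d2 > 0" "\<And>t'. t' \<in> T2 \<Longrightarrow> dist t' v < d2 \<Longrightarrow> germ_eq (G t') (G v) (s t')"
      "\<And>t'. t' \<in> T2 \<Longrightarrow> dist t' v < d2 \<Longrightarrow> s t' \<in> ball (s v) e"
      using analytic_continuation_nbhd[OF G sc(2) v(2) e(1)] by blast
    have "germ_eq (?H t') (?H t) (s t')" if t': "t' \<in> T1 \<union> T2" "dist t' t < min d1 d2" for t'
    proof (cases "t' \<le> v")
      case True
      then have "t' \<in> T1" using t' v by force
      then show ?thesis using True d1(2)[of t'] t' 2 by auto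
    next
      case False
      then have T2: "t' \<in> T2" using t' v by force
      have "germ_eq (G v) (F v) (s t')"
        using d2(3)[OF T2] t' 2 e(2) by (intro germ_eqI[OF open_ball]) auto
      then have "germ_eq (G t') (F v) (s t')" using d2(2)[OF T2] t' 2 germ_eq_trans by auto
      then show ?thesis using False 2 by simp
    qed
    then show ?thesis using d1(1) d2(1) by (intro exI[of _ "min d1 d2"]) auto
  qed
qed

text \<open>For solutions equal values at the junction suffice, since \<open>solves_unique\<close>
  upgrades them to equal germs.\<close>

lemma solution_continuation_join:
  assumes F: "solution_continuation p q s T1 F" and G: "solution_continuation p q s T2 G"
    and s: "continuous_on (T1 \<union> T2) s" and v: "v \<in> T1" "v \<in> T2" "T1 \<subseteq> {..v}" "T2 \<subseteq> {v..}"
    and eq: "F v (s v) = G v (s v)"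
  shows "solution_continuation p q s (T1 \<union> T2) (\<lambda>t. if t \<le> v then F t else G t)"
proof -
  have "germ_eq (F v) (G v) (s v)"
    using solves_unique[of p q "F v" "s v" "G v"] F G v eq by (auto simp: solution_continuation_def)
  then have "analytic_continuation s (T1 \<union> T2) (\<lambda>t. if t \<le> v then F t else G t)"
    using F G s v by (intro analytic_continuation_join) (auto simp: solution_continuation_def)
  moreover have "solves p q (if t \<le> v then F t else G t) (s t)" if "t \<in> T1 \<union> T2" for t
  proof (cases "t \<le> v")
    case True
    then have "t \<in> T1" using that v by force
    then show ?thesis using True F by (simp add: solution_continuation_def)
  next
    case False
    then have "t \<in> T2" using that v by force
    then show ?thesis using False G by (simp add: solution_continuation_def)
  qed
  ultimately show ?thesis unfolding solution_continuation_def by blast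
qed

lemma solution_continuation_const:
  assumes "open D" "s ` T \<subseteq> D"
    "\<And>z. z \<in> D \<Longrightarrow> (f has_field_derivative (poly p z * f z ^ 2 + poly q z * f z ^ 3)) (at z)"
  shows "solution_continuation p q s T (\<lambda>_. f)"
proof -
  have "f holomorphic_on D" using assms by (auto simp: holomorphic_on_open)
  then show ?thesis
    using assms unfolding solution_continuation_def analytic_continuation_iff
    by (auto intro!: solvesI[OF assms(1)] exI[of _ 1] holomorphic_on_imp_analytic_at)
qed

lemma poincare_map_eq:
  assumes s: "path s" and F: "solution_continuation p q s {0..1} F" "F 0 (s 0) = ya"
  shows "poincare_map p q s ya = F 1 (s 1)"
proof -
  have sol: "solution_along p q s {0..1} ya G \<longleftrightarrow> solution_continuation p q s {0..1} G \<and> G 0 (s 0) = ya" for G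
    by (rule solution_along_iff) (use s in \<open>auto simp: path_def\<close>)
  have un: "G 1 (s 1) = F 1 (s 1)" if "solution_continuation p q s {0..1} G" "G 0 (s 0) = ya" for G
    using germ_eq_at[OF solution_continuation_unique[of "{0..1}" s p q G F 0 1]] that F s by (auto simp: path_def)
  show ?thesis
    unfolding poincare_map_def sol pathfinish_def
  proof (rule the_equality)
    show "\<exists>G. (solution_continuation p q s {0..1} G \<and> G 0 (s 0) = ya) \<and> F 1 (s 1) = G 1 (s 1)"
      using F by blast
    fix v assume "\<exists>G. (solution_continuation p q s {0..1} G \<and> G 0 (s 0) = ya) \<and> v = G 1 (s 1)"
    then show "v = F 1 (s 1)" using un by blast
  qed
qed

section \<open>Transport of solutions along a path\<close>

text \<open>Close to \<open>t\<close> the value is \<open>F t (s t')\<close>: the element is fixed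
  and only the point moves.\<close>

lemma continuous_on_continuation_values:
  assumes F: "analytic_continuation s T F" and s: "continuous_on T s"
  shows "continuous_on T (\<lambda>t. F t (s t))"
  unfolding continuous_on_def
proof
  fix t assume t: "t \<in> T"
  have "isCont (F t) (s t)" using F t
    by (meson analytic_continuation_def analytic_on_imp_differentiable_at field_differentiable_imp_continuous_at singletonI)
  moreover have "(s \<longlongrightarrow> s t) (at t within T)" using s t by (simp add: continuous_on_def)
  ultimately have "((\<lambda>t'. F t (s t')) \<longlongrightarrow> F t (s t)) (at t within T)"
    by (rule isCont_tendsto_compose)
  moreover have "\<forall>\<^sub>F t' in at t within T. germ_eq (F t') (F t) (s t')"
    using F t unfolding analytic_continuation_def germ_eq_def by blast
  then have "\<forall>\<^sub>F t' in at t within T. F t (s t') = F t' (s t')"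
    by (rule eventually_mono) (simp add: germ_eq_at)
  ultimately show "((\<lambda>t. F t (s t)) \<longlongrightarrow> F t (s t)) (at t within T)"
    by (rule Lim_transform_eventually)
qed

text \<open>Points and values of the given solution along the compact path are bounded, so a single
  radius of \<open>local_flow\<close> serves everywhere. The map \<open>\<Theta>\<close> is a finite
  composition of local flow maps, obtained by bisection of the parameter interval.\<close>

lemma solution_flow:
  assumes uv: "u \<le> v" and s: "continuous_on {u..v} s" and F: "solution_continuation p q s {u..v} F"
  obtains \<delta> \<Theta> where "\<delta> > 0" "\<Theta> holomorphic_on ball (F u (s u)) \<delta>" "\<Theta> (F u (s u)) = F v (s v)"
    "\<And>c. c \<in> ball (F u (s u)) \<delta> \<Longrightarrow> \<exists>G. solution_continuation p q s {u..v} G \<and> G u (s u) = c \<and> G v (s v) = \<Theta> c"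
proof -
  have Fa: "analytic_continuation s {u..v} F" using F by (simp add: solution_continuation_def)
  have "compact ((\<lambda>t. F t (s t)) ` {u..v})" "compact (s ` {u..v})"
    using continuous_on_continuation_values[OF Fa s] s by (auto intro: compact_continuous_image)
  then have "bounded ((\<lambda>t. F t (s t)) ` {u..v} \<union> s ` {u..v})" by (simp add: compact_imp_bounded)
  then obtain K where "\<forall>x\<in>(\<lambda>t. F t (s t)) ` {u..v} \<union> s ` {u..v}. norm x \<le> K"
    unfolding bounded_iff by blast
  then have K: "norm (s t) \<le> K" "norm (F t (s t)) \<le> K" if "t \<in> {u..v}" for t using that by auto
  obtain r where r: "r > 0" and flow: "\<And>x1 y1. norm x1 \<le> K \<Longrightarrow> norm y1 \<le> K \<Longrightarrow> \<exists>w :: complex \<Rightarrow> complex \<Rightarrow> complex.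
       (\<forall>c\<in>ball y1 r. w x1 c = c) \<and> (\<forall>x\<in>ball x1 r. w x holomorphic_on ball y1 r) \<and>
       (\<forall>x\<in>ball x1 r. \<forall>c\<in>ball y1 r.
          ((\<lambda>x. w x c) has_field_derivative poly p x * w x c ^ 2 + poly q x * w x c ^ 3) (at x))"
    using local_flow[of K p q] by blast
  have "uniformly_continuous_on {u..v} s" using s by (simp add: compact_uniformly_continuous)
  then obtain d where d: "d > 0" "\<And>t t'. t \<in> {u..v} \<Longrightarrow> t' \<in> {u..v} \<Longrightarrow> dist t' t < d \<Longrightarrow> dist (s t') (s t) < r"
    unfolding uniformly_continuous_on_def using r by metis
  define Q where "Q x y \<longleftrightarrow> (\<exists>\<delta> \<Theta>. \<delta> > 0 \<and> \<Theta> holomorphic_on ball (F x (s x)) \<delta> \<and> \<Theta> (F x (s x)) = F y (s y) \<and>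
    (\<forall>c \<in> ball (F x (s x)) \<delta>. \<exists>G. solution_continuation p q s {x..y} G \<and> G x (s x) = c \<and> G y (s y) = \<Theta> c))" for x y
  have "u \<le> u \<longrightarrow> u \<le> v \<longrightarrow> v \<le> v \<longrightarrow> Q u v"
    using uv
  proof (induction rule: Bolzano[where P = "\<lambda>x y. u \<le> x \<longrightarrow> x \<le> y \<longrightarrow> y \<le> v \<longrightarrow> Q x y"])
    case (trans x y z)
    show ?case
    proof (intro impI)
      assume *: "u \<le> x" "x \<le> z" "z \<le> v"
      obtain \<delta>1 \<Theta>1 where 1: "\<delta>1 > 0" "\<Theta>1 holomorphic_on ball (F x (s x)) \<delta>1" "\<Theta>1 (F x (s x)) = F y (s y)"
        "\<And>c. c \<in> ball (F x (s x)) \<delta>1 \<Longrightarrow> \<exists>G. solution_continuation p q s {x..y} G \<and> G x (s x) = c \<and> G y (s y) = \<Theta>1 c"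
        using trans * unfolding Q_def by fastforce
      obtain \<delta>2 \<Theta>2 where 2: "\<delta>2 > 0" "\<Theta>2 holomorphic_on ball (F y (s y)) \<delta>2" "\<Theta>2 (F y (s y)) = F z (s z)"
        "\<And>c. c \<in> ball (F y (s y)) \<delta>2 \<Longrightarrow> \<exists>G. solution_continuation p q s {y..z} G \<and> G y (s y) = c \<and> G z (s z) = \<Theta>2 c"
        using trans * unfolding Q_def by fastforce
      have "isCont \<Theta>1 (F x (s x))"
        using holomorphic_on_imp_continuous_on[OF 1(2)] 1(1) by (simp add: continuous_on_eq_continuous_at)
      then obtain e where e: "e > 0" "\<And>c. dist c (F x (s x)) < e \<Longrightarrow> dist (\<Theta>1 c) (F y (s y)) < \<delta>2"
        using 2(1) 1(3) unfolding continuous_at_eps_delta dist_norm by metis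
      define \<delta> where "\<delta> = min \<delta>1 e"
      have \<delta>: "\<delta> > 0" "\<And>c. c \<in> ball (F x (s x)) \<delta> \<Longrightarrow> c \<in> ball (F x (s x)) \<delta>1 \<and> \<Theta>1 c \<in> ball (F y (s y)) \<delta>2"
        using 1(1) e by (auto simp: \<delta>_def dist_commute)
      show "Q x z"
        unfolding Q_def
      proof (intro exI[of _ \<delta>] exI[of _ "\<lambda>c. \<Theta>2 (\<Theta>1 c)"] conjI ballI)
        have "\<Theta>1 holomorphic_on ball (F x (s x)) \<delta>" using 1(2) by (rule holomorphic_on_subset) (auto simp: \<delta>_def)
        then show "(\<lambda>c. \<Theta>2 (\<Theta>1 c)) holomorphic_on ball (F x (s x)) \<delta>"
          using holomorphic_on_compose_gen[OF _ 2(2), of \<Theta>1 "ball (F x (s x)) \<delta>"] \<delta>(2)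
          by (auto simp: o_def image_subset_iff)
        fix c assume c: "c \<in> ball (F x (s x)) \<delta>"
        obtain G1 where G1: "solution_continuation p q s {x..y} G1" "G1 x (s x) = c" "G1 y (s y) = \<Theta>1 c"
          using 1(4) \<delta>(2) c by blast
        obtain G2 where G2: "solution_continuation p q s {y..z} G2" "G2 y (s y) = \<Theta>1 c" "G2 z (s z) = \<Theta>2 (\<Theta>1 c)"
          using 2(4) \<delta>(2) c by blast
        have un: "{x..y} \<union> {y..z} = {x..z}" using trans by auto
        have "solution_continuation p q s ({x..y} \<union> {y..z}) (\<lambda>t. if t \<le> y then G1 t else G2 t)"
        proof (rule solution_continuation_join[OF G1(1) G2(1)])
          show "continuous_on ({x..y} \<union> {y..z}) s" unfolding un by (rule continuous_on_subset[OF s]) (use * in auto)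
        qed (use trans G1 G2 in auto)
        then show "\<exists>G. solution_continuation p q s {x..z} G \<and> G x (s x) = c \<and> G z (s z) = \<Theta>2 (\<Theta>1 c)"
          unfolding un using G1 G2 trans
          by (intro exI[of _ "\<lambda>t. if t \<le> y then G1 t else G2 t"]) (auto simp: not_le dest: order_antisym)
      qed (use \<delta> 1 2 in auto)
    qed
  next
    case (local x)
    have "Q x' y'" if xy: "u \<le> x'" "x' \<le> y'" "y' \<le> v" "y' - x' < d" for x' y'
    proof -
      have x'v: "x' \<in> {u..v}" using xy by auto
      obtain w where w: "\<And>c. c\<in>ball (F x' (s x')) r \<Longrightarrow> w (s x') c = c"
        "\<And>x. x\<in>ball (s x') r \<Longrightarrow> w x holomorphic_on ball (F x' (s x')) r"
        "\<And>x c. x\<in>ball (s x') r \<Longrightarrow> c\<in>ball (F x' (s x')) r \<Longrightarrow>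
          ((\<lambda>x. w x c) has_field_derivative poly p x * w x c ^ 2 + poly q x * w x c ^ 3) (at x)"
        using flow[OF K(1)[OF x'v] K(2)[OF x'v]] by blast
      have sb: "s t \<in> ball (s x') r" if "t \<in> {x'..y'}" for t
        using d(2)[of x' t] that xy by (auto simp: dist_real_def dist_commute)
      have sol: "solution_continuation p q s {x'..y'} (\<lambda>_ x. w x c)" if "c \<in> ball (F x' (s x')) r" for c
        by (rule solution_continuation_const[OF open_ball]) (use w(3) that sb in auto)
      have c0: "F x' (s x') \<in> ball (F x' (s x')) r" using r by simp
      have "germ_eq (F y') (\<lambda>x. w x (F x' (s x'))) (s y')"
        by (rule solution_continuation_unique[of "{x'..y'}" s p q _ "\<lambda>_ x. w x (F x' (s x'))" x'])
          (use xy s w(1)[OF c0] sol[OF c0] in \<open>auto intro: continuous_on_subset solution_continuation_subset[OF F]\<close>)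
      then have "w (s y') (F x' (s x')) = F y' (s y')" by (metis germ_eq_at)
      moreover have "\<exists>G. solution_continuation p q s {x'..y'} G \<and> G x' (s x') = c \<and> G y' (s y') = w (s y') c"
        if "c \<in> ball (F x' (s x')) r" for c
        using sol[OF that] w(1)[OF that] by (intro exI[of _ "\<lambda>_ x. w x c"]) simp
      ultimately show ?thesis
        unfolding Q_def using r w(2) sb[of y'] xy by (intro exI[of _ r] exI[of _ "w (s y')"]) auto
    qed
    then show ?case using d(1) by (intro exI[of _ d]) auto
  qed
  then have "Q u v" using uv by simp
  then show ?thesis unfolding Q_def using that by blast
qed

text \<open>The reversal \<open>t \<mapsto> - t\<close> reduces this to the forward case. Initial
  values for prescribed values at the end are thus obtained directly, without inverting a flow
  map.\<close>

lemma solution_flow_backward: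
  assumes uv: "u \<le> v" and s: "continuous_on {u..v} s" and F: "solution_continuation p q s {u..v} F"
  obtains \<delta> \<Theta> where "\<delta> > 0" "\<Theta> holomorphic_on ball (F v (s v)) \<delta>" "\<Theta> (F v (s v)) = F u (s u)"
    "\<And>c. c \<in> ball (F v (s v)) \<delta> \<Longrightarrow> \<exists>G. solution_continuation p q s {u..v} G \<and> G v (s v) = c \<and> G u (s u) = \<Theta> c"
proof -
  have im: "uminus ` {-v..-u} \<subseteq> {u..v}" "uminus ` {u..v} \<subseteq> {-v..-u}" by auto
  have c: "continuous_on {-v..-u} (\<lambda>t. s (- t))"
    by (rule continuous_on_compose2[OF s]) (auto intro!: continuous_intros)
  have F': "solution_continuation p q (\<lambda>t. s (- t)) {-v..-u} (\<lambda>t. F (- t))"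
    by (rule solution_continuation_reparam[OF F _ im(1)]) (auto intro!: continuous_intros)
  obtain \<delta> \<Theta> where "\<delta> > 0" "\<Theta> holomorphic_on ball (F v (s v)) \<delta>" "\<Theta> (F v (s v)) = F u (s u)"
    and G: "\<And>c. c \<in> ball (F v (s v)) \<delta> \<Longrightarrow>
       \<exists>G. solution_continuation p q (\<lambda>t. s (- t)) {-v..-u} G \<and> G (-v) (s v) = c \<and> G (-u) (s u) = \<Theta> c"
    using solution_flow[OF _ c F'] uv by auto
  moreover have "\<exists>G. solution_continuation p q s {u..v} G \<and> G v (s v) = c \<and> G u (s u) = \<Theta> c"
    if "c \<in> ball (F v (s v)) \<delta>" for c
  proof -
    obtain G where G: "solution_continuation p q (\<lambda>t. s (- t)) {-v..-u} G" "G (-v) (s v) = c" "G (-u) (s u) = \<Theta> c"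
      using G[OF \<open>c \<in> _\<close>] by blast
    have "solution_continuation p q s {u..v} (\<lambda>t. G (- t))"
      by (rule solution_continuation_reparam[OF G(1) _ im(2)]) (auto intro!: continuous_intros)
    then show ?thesis using G by (intro exI[of _ "\<lambda>t. G (- t)"]) auto
  qed
  ultimately show ?thesis using that by blast
qed

text \<open>If the values stayed bounded, the uniform radius of \<open>local_flow\<close> would
  provide, at a parameter \<open>t1\<close> close to 1, a local solution on a disc that contains the
  rest of the path; gluing it to \<open>F\<close> would give a continuation up to the endpoint. The
  conclusion is that large values occur arbitrarily close to 1, not that the values tend to
  infinity.\<close>

lemma solution_unbounded_at_end:
  assumes s: "continuous_on {0..1} s" and F: "solution_continuation p q s {0..<1} F"
    and no: "\<And>H. solution_continuation p q s {0..1} H \<Longrightarrow> H 0 (s 0) \<noteq> F 0 (s 0)"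
    and t0: "t0 < 1"
  obtains t where "t0 < t" "0 < t" "t < 1" "norm (F t (s t)) > M"
proof (rule ccontr)
  assume "\<not> thesis"
  then have bd: "norm (F t (s t)) \<le> M" if "t0 < t" "0 < t" "t < 1" for t
    using that \<open>\<And>t. t0 < t \<Longrightarrow> 0 < t \<Longrightarrow> t < 1 \<Longrightarrow> norm (F t (s t)) > M \<Longrightarrow> thesis\<close> not_le by blast
  have "bounded (s ` {0..1})" by (intro compact_imp_bounded compact_continuous_image s) auto
  then obtain K0 where "\<forall>x\<in>s ` {0..1}. norm x \<le> K0"
    unfolding bounded_iff by blast
  then have K0: "norm (s t) \<le> K0" if "t \<in> {0..1}" for t using that by auto
  obtain r where r: "r > 0" and flow: "\<And>x1 y1. norm x1 \<le> max K0 M \<Longrightarrow> norm y1 \<le> max K0 M \<Longrightarrow> \<exists>w :: complex \<Rightarrow> complex \<Rightarrow> complex.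
       (\<forall>c\<in>ball y1 r. w x1 c = c) \<and> (\<forall>x\<in>ball x1 r. w x holomorphic_on ball y1 r) \<and>
       (\<forall>x\<in>ball x1 r. \<forall>c\<in>ball y1 r.
          ((\<lambda>x. w x c) has_field_derivative poly p x * w x c ^ 2 + poly q x * w x c ^ 3) (at x))"
    using local_flow[of "max K0 M" p q] by blast
  \<comment> \<open>Half the radius, because \<open>s t\<close> and \<open>s t1\<close> are both
    compared with \<open>s 1\<close>.\<close>
  obtain d where d: "d > 0" "\<And>t. t \<in> {0..1} \<Longrightarrow> dist t 1 < d \<Longrightarrow> dist (s t) (s 1) < r / 2"
    using s r unfolding continuous_on_iff by (metis atLeastAtMost_iff half_gt_zero order_refl zero_le_one)
  obtain t1 where "max (max t0 0) (1 - d) < t1" "t1 < 1"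
    using dense[of "max (max t0 0) (1 - d)" 1] t0 d(1) by auto
  then have t1: "t0 < t1" "0 < t1" "t1 < 1" "1 - t1 < d" by auto
  have sb: "s t \<in> ball (s t1) r" if "t \<in> {t1..1}" for t
  proof -
    have "dist (s t) (s 1) < r / 2" "dist (s t1) (s 1) < r / 2"
      using that t1 by (auto intro!: d(2) simp: dist_real_def simp del: less_divide_eq_numeral1)
    then show ?thesis using dist_triangle_half_r by (metis dist_commute mem_ball)
  qed
  have n: "norm (s t1) \<le> max K0 M" "norm (F t1 (s t1)) \<le> max K0 M"
    using K0[of t1] bd[of t1] t1 by auto
  obtain w where w: "\<And>c. c\<in>ball (F t1 (s t1)) r \<Longrightarrow> w (s t1) c = c"
    "\<And>x c. x\<in>ball (s t1) r \<Longrightarrow> c\<in>ball (F t1 (s t1)) r \<Longrightarrow>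
      ((\<lambda>x. w x c) has_field_derivative poly p x * w x c ^ 2 + poly q x * w x c ^ 3) (at x)"
    using flow[OF n] by blast
  let ?c = "F t1 (s t1)"
  have sol: "solution_continuation p q s {t1..1} (\<lambda>_ x. w x ?c)"
    by (rule solution_continuation_const[OF open_ball[of "s t1" r]]) (use w(2) r sb in auto)
  have F': "solution_continuation p q s {0..t1} F" by (rule solution_continuation_subset[OF F]) (use t1 in auto)
  have un: "{0..t1} \<union> {t1..1} = {0..1}" using t1 by auto
  have "solution_continuation p q s ({0..t1} \<union> {t1..1}) (\<lambda>t. if t \<le> t1 then F t else (\<lambda>x. w x ?c))"
    by (rule solution_continuation_join[OF F' sol]) (use s t1 w(1) r un in auto)
  then show False using no t1 un by fastforce
qed

subsection \<open>Branches of the square root\<close>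

text \<open>The branch of the square root of \<open>x - c\<close> which has the value \<open>z0\<close> at \<open>x = c + z0\<^sup>2\<close>.\<close>

definition sqrt_branch :: "complex \<Rightarrow> complex \<Rightarrow> complex \<Rightarrow> complex" where
  "sqrt_branch c z0 x = z0 * csqrt ((x - c) / z0\<^sup>2)"

lemma sqrt_branch_power2: "z0 \<noteq> 0 \<Longrightarrow> (sqrt_branch c z0 x)\<^sup>2 = x - c"
  by (simp add: sqrt_branch_def power_mult_distrib)

lemma sqrt_branch_base: "z0 \<noteq> 0 \<Longrightarrow> z0\<^sup>2 = x - c \<Longrightarrow> sqrt_branch c z0 x = z0"
  unfolding sqrt_branch_def by (metis csqrt_1 divide_self_if mult.right_neutral power_not_zero)

lemma sqrt_branch_unique:
  assumes "z0 \<noteq> 0" "m\<^sup>2 = x - c" "Re (m / z0) > 0"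
  shows "sqrt_branch c z0 x = m"
proof -
  have "csqrt ((x - c) / z0\<^sup>2) = m / z0"
    by (rule csqrt_unique) (use assms in \<open>auto simp: power_divide\<close>)
  then show ?thesis using assms(1) by (simp add: sqrt_branch_def)
qed

text \<open>The quotient lies in the open unit disc about 1, away from the cut of
  \<open>csqrt\<close>.\<close>

lemma sqrt_branch_arg:
  fixes x c z0 :: complex
  assumes z0: "z0 \<noteq> 0" and x: "norm (x - c - z0\<^sup>2) < (norm z0)\<^sup>2"
  shows "(x - c) / z0\<^sup>2 \<notin> \<real>\<^sub>\<le>\<^sub>0"
proof -
  have "(x - c) / z0\<^sup>2 - 1 = (x - c - z0\<^sup>2) / z0\<^sup>2" using z0 by (subst diff_divide_distrib[of "x - c" "z0\<^sup>2"]) simp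
  then have "norm ((x - c) / z0\<^sup>2 - 1) < 1" using z0 x by (simp add: norm_divide norm_power)
  then have "Re (1 - (x - c) / z0\<^sup>2) < 1"
    by (metis complex_Re_le_cmod norm_minus_commute order_le_less_trans)
  then show ?thesis by (auto simp: complex_nonpos_Reals_iff)
qed

lemma holomorphic_on_sqrt_branch:
  assumes "z0 \<noteq> 0" "a holomorphic_on S" "b holomorphic_on S"
    "\<And>z. z \<in> S \<Longrightarrow> norm (b z - a z - z0\<^sup>2) < (norm z0)\<^sup>2"
  shows "(\<lambda>z. sqrt_branch (a z) z0 (b z)) holomorphic_on S"
  unfolding sqrt_branch_def using assms sqrt_branch_arg[OF assms(1)] by (intro holomorphic_intros) auto

lemma holomorphic_on_sqrt_branch_ball:
  assumes "z0 \<noteq> 0" "z0\<^sup>2 = x0 - c"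
  shows "sqrt_branch c z0 holomorphic_on ball x0 ((norm z0)\<^sup>2)"
  by (rule holomorphic_on_sqrt_branch) (use assms in \<open>auto intro!: holomorphic_intros simp: dist_norm norm_minus_commute\<close>)

lemma isCont_sqrt_branch:
  assumes "z0 \<noteq> 0" "z0\<^sup>2 = x0 - c"
  shows "isCont (sqrt_branch c z0) x0"
  using holomorphic_on_imp_continuous_on[OF holomorphic_on_sqrt_branch_ball[OF assms]] assms(1)
  by (simp add: continuous_on_eq_continuous_at)

text \<open>A continuous root \<open>l\<close> along the path selects at each parameter the branch
  with value \<open>l t\<close>. For \<open>t'\<close> near \<open>t\<close> the quotient
  \<open>l t' / l t\<close> is close to 1, and its positive real part forces the two branches to
  coincide near \<open>g t'\<close>.\<close>

lemma analytic_continuation_sqrt_branch: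
  assumes g: "continuous_on T g" and l: "continuous_on T l"
    and lg: "\<And>t. t \<in> T \<Longrightarrow> (l t)\<^sup>2 = g t - c" and l0: "\<And>t. t \<in> T \<Longrightarrow> l t \<noteq> 0"
    and B: "open D" "B holomorphic_on D" "l ` T \<subseteq> D"
  shows "analytic_continuation g T (\<lambda>t x. B (sqrt_branch c (l t) x))"
  unfolding analytic_continuation_iff
proof (intro conjI ballI)
  fix t assume t: "t \<in> T"
  have "sqrt_branch c (l t) analytic_on {g t}"
    using holomorphic_on_sqrt_branch_ball[OF l0[OF t] lg[OF t]] l0[OF t]
    by (intro holomorphic_on_imp_analytic_at[OF _ open_ball]) auto
  moreover have "B analytic_on D" using B by (simp add: analytic_on_open)
  ultimately have "(B \<circ> sqrt_branch c (l t)) analytic_on {g t}"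
    by (rule analytic_on_compose_gen) (use sqrt_branch_base[OF l0[OF t] lg[OF t]] B(3) t in auto)
  then show "(\<lambda>x. B (sqrt_branch c (l t) x)) analytic_on {g t}" by (simp add: o_def)
  obtain d where d: "d > 0" "\<And>t'. t' \<in> T \<Longrightarrow> dist t' t < d \<Longrightarrow> dist (l t') (l t) < norm (l t)"
    using l t l0[OF t] unfolding continuous_on_iff by (metis zero_less_norm_iff)
  show "\<exists>d>0. \<forall>t'\<in>T. dist t' t < d \<longrightarrow>
      germ_eq (\<lambda>x. B (sqrt_branch c (l t') x)) (\<lambda>x. B (sqrt_branch c (l t) x)) (g t')"
  proof (intro exI[of _ d] conjI ballI impI)
    fix t' assume t': "t' \<in> T" "dist t' t < d"
    have "l t' / l t - 1 = (l t' - l t) / l t" using l0[OF t] by (simp add: field_simps)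
    then have "norm (l t' / l t - 1) < 1"
      using d(2)[OF t'] l0[OF t] by (simp add: norm_divide dist_norm)
    then have "Re (1 - l t' / l t) < 1"
      by (metis complex_Re_le_cmod norm_minus_commute order_le_less_trans)
    then have Re0: "Re (l t' / l t) > 0" by simp
    have "(sqrt_branch c (l t') \<longlongrightarrow> sqrt_branch c (l t') (g t')) (nhds (g t'))"
      using isCont_sqrt_branch[OF l0[OF t'(1)] lg[OF t'(1)]] by (simp add: isCont_def tendsto_at_iff_tendsto_nhds)
    then have "((\<lambda>x. Re (sqrt_branch c (l t') x / l t)) \<longlongrightarrow> Re (sqrt_branch c (l t') (g t') / l t)) (nhds (g t'))"
      using l0[OF t] by (intro tendsto_intros)
    then have "\<forall>\<^sub>F x in nhds (g t'). Re (sqrt_branch c (l t') x / l t) > 0"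
      using Re0 sqrt_branch_base[OF l0[OF t'(1)] lg[OF t'(1)]] by (simp add: order_tendstoD(1))
    then show "germ_eq (\<lambda>x. B (sqrt_branch c (l t') x)) (\<lambda>x. B (sqrt_branch c (l t) x)) (g t')"
      unfolding germ_eq_def
    proof eventually_elim
      case (elim x)
      then show ?case
        using sqrt_branch_unique[OF l0[OF t] sqrt_branch_power2[OF l0[OF t'(1)]]] by simp
    qed
  qed fact
qed

text \<open>A continuous function without zeros on a contractible set has a continuous root, and the
  sign is adjusted to the prescribed value. Half-open intervals are included, for paths that run
  into \<open>c\<close> at their end.\<close>

lemma sqrt_lift:
  fixes g :: "real \<Rightarrow> complex"
  assumes g: "continuous_on T g" and T: "convex T" and u: "u \<in> T" and gc: "\<And>t. t \<in> T \<Longrightarrow> g t \<noteq> c"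
    and z0: "z0\<^sup>2 = g u - c"
  obtains l where "continuous_on T l" "l u = z0" "\<And>t. t \<in> T \<Longrightarrow> (l t)\<^sup>2 = g t - c"
proof -
  obtain l where l: "continuous_on T l" "\<And>t. t \<in> T \<Longrightarrow> g t - c = (l t)\<^sup>2"
  proof (rule continuous_sqrt_on_contractible[of T "\<lambda>t. g t - c"])
    show "continuous_on T (\<lambda>t. g t - c)" using g by (intro continuous_intros)
    show "contractible T" using T by (rule convex_imp_contractible)
  qed (use gc in auto)
  have "z0 = l u \<or> z0 = - l u" using l(2)[OF u] z0 by (simp add: power2_eq_iff)
  then show ?thesis
  proof
    assume "z0 = l u"
    then show ?thesis using that[of l] l by auto
  next
    assume "z0 = - l u"
    then show ?thesis using that[of "\<lambda>t. - l t"] l by (auto intro!: continuous_intros)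
  qed
qed

section \<open>Solutions near \<open>b\<close> in the square root chart\<close>

context square_root_chart
begin

text \<open>The solution with singularity \<open>c\<close>, as a function of the chart coordinate
  \<open>z\<close>. It becomes a function of \<open>x\<close> only after a branch of the root of
  \<open>x - c\<close> is chosen.\<close>

definition sol :: "complex \<Rightarrow> complex \<Rightarrow> complex" where
  "sol c z = 1 / (z * v (z, c))"

lemma v_nz: "z \<in> ball 0 R \<Longrightarrow> c \<in> ball b R \<Longrightarrow> v (z, c) \<noteq> 0"
  using v_ge m by (metis norm_zero not_le)

lemma v_holomorphic: "c \<in> ball b R \<Longrightarrow> (\<lambda>z. v (z, c)) holomorphic_on ball 0 R"
  by (rule plot_holomorphicD[OF v]) auto

lemma sol_holomorphic: "c \<in> ball b R \<Longrightarrow> sol c holomorphic_on ball 0 R - {0}"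
  unfolding sol_def[abs_def] using v_nz
  by (intro holomorphic_intros holomorphic_on_subset[OF v_holomorphic]) auto

text \<open>The derivative \<open>1 / (2 z)\<close> of the root cancels the factor
  \<open>2 z\<close> in \<open>v_ode\<close>, which leaves \<open>w w' = - p w - q\<close> in the
  variable \<open>x\<close>; passing to \<open>1 / w\<close> restores the Abel equation.\<close>

lemma solves_sol:
  assumes c: "c \<in> ball b R" and z0: "z0 \<in> ball 0 R" "z0 \<noteq> 0" and x0: "z0\<^sup>2 = x0 - c"
  shows "solves p q (\<lambda>x. sol c (sqrt_branch c z0 x)) x0"
proof (rule solvesI)
  let ?\<sigma> = "sqrt_branch c z0"
  \<comment> \<open>On the first set the branch of the root is holomorphic, on the second its values
    stay in the chart.\<close>
  let ?S = "ball x0 ((norm z0)\<^sup>2) \<inter> {x. norm (x - c) < R\<^sup>2}"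
  show "open ?S" by (intro open_Int open_ball open_Collect_less continuous_intros)
  have "norm (x0 - c) < R\<^sup>2"
    using z0 x0[symmetric] R by (simp add: norm_power power_strict_mono)
  then show "x0 \<in> ?S" using z0 by simp
  fix x assume x: "x \<in> ?S"
  have s2: "(?\<sigma> x)\<^sup>2 = x - c" by (rule sqrt_branch_power2[OF z0(2)])
  then have "(norm (?\<sigma> x))\<^sup>2 < R\<^sup>2" using x by (simp add: norm_power[symmetric])
  then have \<sigma>R: "?\<sigma> x \<in> ball 0 R" using R by (simp add: power2_less_imp_less)
  have "x \<noteq> c" using x x0 by (auto simp: dist_norm norm_power[symmetric])
  then have \<sigma>0: "?\<sigma> x \<noteq> 0" using s2 by auto
  obtain D where D: "(?\<sigma> has_field_derivative D) (at x)"
    using holomorphic_on_sqrt_branch_ball[OF z0(2) x0] x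
    by (meson IntD1 field_differentiable_def holomorphic_on_imp_differentiable_at open_ball)
  have "((\<lambda>x. (?\<sigma> x)\<^sup>2) has_field_derivative 2 * ?\<sigma> x * D) (at x)"
    using D by (auto intro!: derivative_eq_intros)
  moreover have "((\<lambda>x. (?\<sigma> x)\<^sup>2) has_field_derivative 1) (at x)"
    unfolding sqrt_branch_power2[OF z0(2)] by (auto intro!: derivative_eq_intros)
  ultimately have "2 * ?\<sigma> x * D = 1" by (rule DERIV_unique)
  then have Dval: "D = 1 / (2 * ?\<sigma> x)" using \<sigma>0 by (simp add: field_simps)
  define w where "w z = z * v (z, c)" for z
  have w0: "w (?\<sigma> x) \<noteq> 0" using \<sigma>0 v_nz[OF \<sigma>R c] by (simp add: w_def)
  have "(w has_field_derivative - 2 * ?\<sigma> x * (poly p x * w (?\<sigma> x) + poly q x) / w (?\<sigma> x)) (at (?\<sigma> x))"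
    using v_ode[OF \<sigma>R c \<sigma>0] s2 by (simp add: w_def[abs_def])
  from DERIV_chain2[OF this D]
  have "((\<lambda>x. w (?\<sigma> x)) has_field_derivative
      - 2 * ?\<sigma> x * (poly p x * w (?\<sigma> x) + poly q x) / w (?\<sigma> x) * D) (at x)" .
  moreover have "- 2 * ?\<sigma> x * (poly p x * w (?\<sigma> x) + poly q x) / w (?\<sigma> x) * D =
      - (poly p x * w (?\<sigma> x) + poly q x) / w (?\<sigma> x)"
    using \<sigma>0 w0 by (simp add: Dval field_simps)
  ultimately have wd: "((\<lambda>x. w (?\<sigma> x)) has_field_derivative
      - (poly p x * w (?\<sigma> x) + poly q x) / w (?\<sigma> x)) (at x)"
    by (simp only:)
  have "((\<lambda>x. 1 / w (?\<sigma> x)) has_field_derivative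
      - ((- (poly p x * w (?\<sigma> x) + poly q x) / w (?\<sigma> x)) / (w (?\<sigma> x))\<^sup>2)) (at x)"
    using wd w0 by (auto intro!: derivative_eq_intros simp: power2_eq_square)
  moreover have "- ((- (poly p x * w (?\<sigma> x) + poly q x) / w (?\<sigma> x)) / (w (?\<sigma> x))\<^sup>2) =
     poly p x * (1 / w (?\<sigma> x))\<^sup>2 + poly q x * (1 / w (?\<sigma> x)) ^ 3"
    using w0 by (simp add: divide_simps power2_eq_square power3_eq_cube)
  ultimately show "((\<lambda>x. sol c (?\<sigma> x)) has_field_derivative
      poly p x * (sol c (?\<sigma> x))\<^sup>2 + poly q x * sol c (?\<sigma> x) ^ 3) (at x)"
    by (simp add: sol_def w_def)
qed

lemma chart_continuation:
  assumes g: "continuous_on T g" and l: "continuous_on T l"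
    and lg: "\<And>t. t \<in> T \<Longrightarrow> (l t)\<^sup>2 = g t - c" and lR: "\<And>t. t \<in> T \<Longrightarrow> l t \<in> ball 0 R - {0}" and c: "c \<in> ball b R"
  shows "solution_continuation p q g T (\<lambda>t x. sol c (sqrt_branch c (l t) x))"
  unfolding solution_continuation_def
proof (intro conjI ballI)
  show "analytic_continuation g T (\<lambda>t x. sol c (sqrt_branch c (l t) x))"
    by (rule analytic_continuation_sqrt_branch[OF g l lg _ _ sol_holomorphic[OF c]]) (use lR in auto)
  show "solves p q (\<lambda>x. sol c (sqrt_branch c (l t) x)) (g t)" if "t \<in> T" for t
    using solves_sol[OF c _ _ lg] that lR by auto
qed

lemma lift_in_ball:
  assumes "(z::complex)\<^sup>2 = x - c" "norm (x - c) < R\<^sup>2" "x \<noteq> c"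
  shows "z \<in> ball 0 R - {0}"
proof -
  have "(norm z)\<^sup>2 < R\<^sup>2" using assms by (simp add: norm_power[symmetric])
  then have "norm z < R" using R by (simp add: power2_less_imp_less)
  then show ?thesis using assms by auto
qed

text \<open>Before the end the continuation must coincide with the chart solution, so its product
  with \<open>z v(z, c)\<close> is 1. At the end \<open>z\<close> tends to 0 while a continued
  solution would keep a finite limit, and the product would tend to 0.\<close>

lemma no_continuation_to_center:
  assumes uv: "u < w" and g: "continuous_on {u..w} g" and gc: "\<And>t. t \<in> {u..<w} \<Longrightarrow> g t \<noteq> c" "g w = c"
    and gR: "\<And>t. t \<in> {u..w} \<Longrightarrow> norm (g t - c) < R\<^sup>2" and c: "c \<in> ball b R"
    and G: "solution_continuation p q g {u..w} G" and z0: "z0\<^sup>2 = g u - c" "G u (g u) = sol c z0"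
  shows False
proof -
  let ?T = "{u..<w}"
  have g': "continuous_on ?T g" by (rule continuous_on_subset[OF g]) auto
  obtain l where l: "continuous_on ?T l" "l u = z0" "\<And>t. t \<in> ?T \<Longrightarrow> (l t)\<^sup>2 = g t - c"
    by (rule sqrt_lift[OF g' _ _ gc(1) z0(1)]) (use uv in auto)
  have lR: "l t \<in> ball 0 R - {0}" if "t \<in> ?T" for t
    using lift_in_ball[OF l(3)[OF that]] gR[of t] gc(1)[OF that] that by auto
  have S: "solution_continuation p q g ?T (\<lambda>t x. sol c (sqrt_branch c (l t) x))"
    using chart_continuation[OF g' l(1,3) lR c] .
  have base: "sqrt_branch c (l t) (g t) = l t" if "t \<in> ?T" for t
    using sqrt_branch_base l(3)[OF that] lR[OF that] by auto
  have eq: "G t (g t) = sol c (l t)" if "t \<in> ?T" for t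
  proof -
    have "germ_eq (G t) (\<lambda>x. sol c (sqrt_branch c (l t) x)) (g t)"
    proof (rule solution_continuation_unique[of ?T g p q G "\<lambda>t x. sol c (sqrt_branch c (l t) x)" u t])
      show "solution_continuation p q g ?T G" by (rule solution_continuation_subset[OF G]) auto
      show "G u (g u) = sol c (sqrt_branch c (l u) (g u))" using base[of u] uv l(2) z0 by simp
    qed (use g' S that uv in auto)
    then show ?thesis using germ_eq_at base[OF that] by metis
  qed
  let ?F = "at w within ?T"
  have nt: "?F \<noteq> bot" using uv by (simp add: at_within_eq_bot_iff closure_atLeastLessThan)
  have "((\<lambda>t. G t (g t)) \<longlongrightarrow> G w (g w)) (at w within {u..w})"
    using continuous_on_continuation_values[OF _ g, of G] G uv
    by (auto simp: continuous_on_def solution_continuation_def)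
  then have lim1: "((\<lambda>t. G t (g t)) \<longlongrightarrow> G w (g w)) ?F"
    by (rule tendsto_within_subset) auto
  have "(g \<longlongrightarrow> c) (at w within {u..w})" using g gc(2) uv by (auto simp: continuous_on_def)
  then have "(g \<longlongrightarrow> c) ?F" by (rule tendsto_within_subset) auto
  then have "((\<lambda>t. sqrt (norm (g t - c))) \<longlongrightarrow> sqrt (norm (c - c))) ?F" by (intro tendsto_intros)
  moreover have "\<forall>\<^sub>F t in ?F. sqrt (norm (g t - c)) = norm (l t)"
    unfolding eventually_at_filter
    by (rule always_eventually) (auto simp: l(3)[symmetric] norm_power)
  ultimately have "((\<lambda>t. norm (l t)) \<longlongrightarrow> 0) ?F"
    using Lim_transform_eventually by fastforce
  then have l0: "(l \<longlongrightarrow> 0) ?F" by (simp add: tendsto_norm_zero_iff)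
  have "isCont (\<lambda>z. z * v (z, c)) 0"
  proof -
    have "continuous_on (ball 0 R) (\<lambda>z. z * v (z, c))"
      using v_holomorphic[OF c] by (intro continuous_intros holomorphic_on_imp_continuous_on)
    then show ?thesis using R by (simp add: continuous_on_eq_continuous_at)
  qed
  then have lim2: "((\<lambda>t. l t * v (l t, c)) \<longlongrightarrow> 0 * v (0, c)) ?F"
    using isCont_tendsto_compose[OF _ l0] by blast
  have "((\<lambda>t. G t (g t) * (l t * v (l t, c))) \<longlongrightarrow> G w (g w) * (0 * v (0, c))) ?F"
    by (rule tendsto_mult[OF lim1 lim2])
  moreover have "\<forall>\<^sub>F t in ?F. G t (g t) * (l t * v (l t, c)) = 1"
    unfolding eventually_at_filter
    by (rule always_eventually) (use eq lR v_nz c in \<open>auto simp: sol_def\<close>)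
  ultimately have "((\<lambda>t. 1::complex) \<longlongrightarrow> 0) ?F"
    using Lim_transform_eventually by fastforce
  then show False using tendsto_unique[OF nt _ tendsto_const] by fastforce
qed

text \<open>A chart solution continues along every path on which the root of \<open>x - c\<close>
  can be followed inside the chart. If the path ended elsewhere but met \<open>c\<close>, the first
  such parameter would contradict \<open>no_continuation_to_center\<close>; if it avoided
  \<open>c\<close>, the root could be lifted to the end and the solution would continue.\<close>

lemma singular_end_at_center:
  assumes uv: "u < w" and g: "continuous_on {u..w} g"
    and gR: "\<And>t. t \<in> {u..w} \<Longrightarrow> norm (g t - c) < R\<^sup>2" and c: "c \<in> ball b R"
    and G: "solution_continuation p q g {u..<w} G" and z0: "z0\<^sup>2 = g u - c" "g u \<noteq> c" "G u (g u) = sol c z0"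
    and no: "\<And>H. solution_continuation p q g {u..w} H \<Longrightarrow> H u (g u) \<noteq> G u (g u)"
  shows "g w = c"
proof (rule ccontr)
  assume gw: "g w \<noteq> c"
  have ne: "g t \<noteq> c" if t: "t \<in> {u..w}" for t
  proof
    assume gt: "g t = c"
    let ?K = "{t \<in> {u..w}. g t = c}"
    have "closed ?K" using continuous_closed_preimage_constant[OF g] by simp
    moreover have "bounded ?K" by (rule bounded_subset[OF bounded_closed_interval]) auto
    ultimately have "compact ?K" by (simp add: compact_eq_bounded_closed)
    then obtain t1 where t1: "t1 \<in> ?K" "\<And>s. s \<in> ?K \<Longrightarrow> t1 \<le> s"
      using compact_attains_inf[of ?K] t gt by blast
    have "t1 \<noteq> u" "t1 \<noteq> w" using t1 z0(2) gw by auto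
    then have t1': "u < t1" "t1 < w" using t1 by auto
    show False
    proof (rule no_continuation_to_center[of u t1 g c G z0])
      show "continuous_on {u..t1} g" by (rule continuous_on_subset[OF g]) (use t1' in auto)
      show "solution_continuation p q g {u..t1} G" by (rule solution_continuation_subset[OF G]) (use t1' in auto)
      show "g t \<noteq> c" if "t \<in> {u..<t1}" for t using t1(2)[of t] that t1' by auto
    qed (use t1' t1 gR c z0 in auto)
  qed
  obtain l where l: "continuous_on {u..w} l" "l u = z0" "\<And>t. t \<in> {u..w} \<Longrightarrow> (l t)\<^sup>2 = g t - c"
    by (rule sqrt_lift[OF g _ _ ne z0(1)]) (use uv in auto)
  have lR: "l t \<in> ball 0 R - {0}" if "t \<in> {u..w}" for t
    using lift_in_ball[OF l(3)[OF that] gR[OF that] ne[OF that]] .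
  have "solution_continuation p q g {u..w} (\<lambda>t x. sol c (sqrt_branch c (l t) x))"
    using chart_continuation[OF g l(1,3) lR c] .
  moreover have "sqrt_branch c (l u) (g u) = l u"
    using sqrt_branch_base l(3)[of u] lR[of u] uv by auto
  ultimately show False using no z0 l(2) by metis
qed

end

subsection \<open>The moving singularity\<close>

lemma continuous_on_joined:
  assumes "path s" "\<tau> \<in> {0..1}" "path g" "pathstart g = s \<tau>"
  shows "continuous_on {0..1} (subpath 0 \<tau> s +++ g)"
proof -
  have "path (subpath 0 \<tau> s)" using assms by (intro path_subpath) auto
  then have "path (subpath 0 \<tau> s +++ g)"
    using assms by (intro path_join_imp) (auto simp: pathfinish_def subpath_def)
  then show ?thesis by (simp add: path_def)
qed

lemma joined_first_half: "t \<le> 1/2 \<Longrightarrow> (subpath 0 \<tau> s +++ g) t = s (\<tau> * (2 * t))"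
  by (simp add: joinpaths_def subpath_def)

lemma joined_second_half:
  assumes "pathstart g = s \<tau>" "t \<ge> 1/2"
  shows "(subpath 0 \<tau> s +++ g) t = g (2 * t - 1)"
proof (cases "t = 1/2")
  case True
  show ?thesis unfolding True using assms(1) by (simp add: joinpaths_def subpath_def pathstart_def)
qed (use assms in \<open>auto simp: joinpaths_def\<close>)

lemma solution_joined_first_half:
  assumes "\<tau> \<ge> 0" and "solution_continuation p q s {0..\<tau>} F"
  shows "solution_continuation p q (subpath 0 \<tau> s +++ g) {0..1/2} (\<lambda>t. F (\<tau> * (2 * t)))"
proof (rule solution_continuation_reparam[OF assms(2)])
  show "(\<lambda>t. \<tau> * (2 * t)) ` {0..1/2} \<subseteq> {0..\<tau>}"
  proof clarify
    fix t :: real assume "t \<in> {0..1/2}"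
    then have "0 \<le> \<tau> * (2 * t)" "\<tau> * (2 * t) \<le> \<tau> * 1"
      using assms(1) mult_left_mono[of "2 * t" 1 \<tau>] by auto
    then show "\<tau> * (2 * t) \<in> {0..\<tau>}" by simp
  qed
qed (auto intro!: continuous_intros simp: joined_first_half)

text \<open>On the initial part along \<open>s\<close> the solution is \<open>F\<close> by
  uniqueness, so continuing along the joined path amounts to continuing along \<open>g\<close> from
  the value \<open>F \<tau> (s \<tau>)\<close>. The closed and the half-open parameter interval are
  treated by one argument.\<close>

lemma singular_at_end_joined_iff:
  assumes s: "path s" and \<tau>: "\<tau> \<in> {0..1}" and g: "path g" "pathstart g = s \<tau>"
    and F: "solution_continuation p q s {0..\<tau>} F"
  shows "singular_at_end p q (subpath 0 \<tau> s +++ g) (F 0 (s 0)) \<longleftrightarrow>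
    (\<exists>G. solution_continuation p q g {0..<1} G \<and> G 0 (g 0) = F \<tau> (s \<tau>)) \<and>
    \<not> (\<exists>G. solution_continuation p q g {0..1} G \<and> G 0 (g 0) = F \<tau> (s \<tau>))"
proof -
  let ?S = "subpath 0 \<tau> s +++ g"
  have Sc: "continuous_on {0..1} ?S" by (rule continuous_on_joined[OF s \<tau> g])
  have F1: "solution_continuation p q ?S {0..1/2} (\<lambda>t. F (\<tau> * (2 * t)))"
    using \<tau> F by (intro solution_joined_first_half) auto
  have S0: "?S 0 = s 0" by (simp add: joined_first_half)
  have Sh: "?S (1/2) = s \<tau>" by (simp add: joined_first_half)
  have "(\<exists>H. solution_along p q ?S T (F 0 (s 0)) H) \<longleftrightarrow>
     (\<exists>G. solution_continuation p q g T G \<and> G 0 (g 0) = F \<tau> (s \<tau>))" if T: "T = {0..1} \<or> T = {0..<1}" for T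
  proof -
    have T': "connected T" "0 \<in> T" "continuous_on T ?S" "{0..1/2} \<subseteq> T"
      using T Sc continuous_on_subset[OF Sc, of "{0..<1}"] by (auto simp: atLeastLessThan_subseteq_atLeastAtMost_iff)
    note iff = solution_along_iff[OF T'(1-3)]
    show ?thesis
    proof safe
      fix H assume "solution_along p q ?S T (F 0 (s 0)) H"
      then have H: "solution_continuation p q ?S T H" "H 0 (s 0) = F 0 (s 0)" using iff S0 by auto
      have "germ_eq (H (1/2)) (F \<tau>) (s \<tau>)"
        using solution_continuation_unique[of "{0..1/2}" ?S p q H "\<lambda>t. F (\<tau> * (2 * t))" 0 "1/2"]
          solution_continuation_subset[OF H(1) T'(4)] continuous_on_subset[OF T'(3,4)] F1 H(2) S0 Sh by simp
      then have "H (1/2) (s \<tau>) = F \<tau> (s \<tau>)" by (rule germ_eq_at)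
      moreover have "solution_continuation p q g T (\<lambda>t. H ((t + 1) / 2))"
        by (rule solution_continuation_reparam[OF H(1)])
          (use T g(2) in \<open>auto intro!: continuous_intros simp: joined_second_half add_divide_distrib\<close>)
      ultimately show "\<exists>G. solution_continuation p q g T G \<and> G 0 (g 0) = F \<tau> (s \<tau>)"
        using g(2) by (intro exI[of _ "\<lambda>t. H ((t + 1) / 2)"]) (simp add: pathstart_def)
    next
      fix G assume G: "solution_continuation p q g T G" "G 0 (g 0) = F \<tau> (s \<tau>)"
      have F2: "solution_continuation p q ?S ({1/2..} \<inter> T) (\<lambda>t. G (2 * t - 1))"
        by (rule solution_continuation_reparam[OF G(1)])
          (use T g(2) in \<open>auto intro!: continuous_intros simp: joined_second_half\<close>)
      have un: "{0..1/2} \<union> ({1/2..} \<inter> T) = T" using T by auto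
      have "solution_continuation p q ?S ({0..1/2} \<union> ({1/2..} \<inter> T)) (\<lambda>t. if t \<le> 1/2 then F (\<tau> * (2 * t)) else G (2 * t - 1))"
        by (rule solution_continuation_join[OF F1 F2])
          (use T'(3,4) un Sh G(2) g(2) in \<open>simp_all add: pathstart_def subset_eq\<close>)
      then show "\<exists>H. solution_along p q ?S T (F 0 (s 0)) H"
        unfolding un iff using S0 by (intro exI[of _ "\<lambda>t. if t \<le> 1/2 then F (\<tau> * (2 * t)) else G (2 * t - 1)"]) simp
    qed
  qed
  then show ?thesis unfolding singular_at_end_def by simp
qed

section \<open>Local singularities and solutions with large values\<close>

context square_root_chart
begin

text \<open>No other point is singular by \<open>singular_end_at_center\<close>; the point
  \<open>c\<close> itself is reached by the straight segment from \<open>s \<tau>\<close>, along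
  which \<open>no_continuation_to_center\<close> excludes an extension. The condition
  \<open>2 * \<rho> \<le> R^2\<close> keeps the roots of \<open>x - c\<close> inside the chart for
  all \<open>x\<close> in the disc.\<close>

lemma local_singularities_eq:
  assumes s: "path s" and \<tau>: "\<tau> \<in> {0..<1}" and \<rho>: "2 * \<rho> \<le> R\<^sup>2" "\<rho> \<le> R"
    and c: "c \<in> ball b \<rho>" and s\<tau>: "s \<tau> \<in> ball b \<rho>" "s \<tau> \<noteq> c"
    and F: "solution_continuation p q s {0..\<tau>} F" and z0: "z0\<^sup>2 = s \<tau> - c" "F \<tau> (s \<tau>) = sol c z0"
  shows "local_singularities p q s \<tau> (ball b \<rho>) (F 0 (s 0)) = {c}"
proof -
  have cR: "c \<in> ball b R" using c \<rho> by auto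
  have near: "norm (x - c) < R\<^sup>2" if "x \<in> ball b \<rho>" for x
    using that c \<rho> dist_triangle2[of x c b] by (simp add: dist_norm norm_minus_commute)
  have \<tau>1: "\<tau> \<in> {0..1}" using \<tau> by simp
  show ?thesis
  proof (rule set_eqI, rule iffI)
    fix x assume "x \<in> local_singularities p q s \<tau> (ball b \<rho>) (F 0 (s 0))"
    then obtain g where g: "path g" "path_image g \<subseteq> ball b \<rho>" "pathstart g = s \<tau>" "x = pathfinish g"
      and sing: "singular_at_end p q (subpath 0 \<tau> s +++ g) (F 0 (s 0))"
      unfolding local_singularities_def by blast
    obtain G where G: "solution_continuation p q g {0..<1} G" "G 0 (g 0) = F \<tau> (s \<tau>)"
      and no: "\<not> (\<exists>G. solution_continuation p q g {0..1} G \<and> G 0 (g 0) = F \<tau> (s \<tau>))"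
      using sing unfolding singular_at_end_joined_iff[OF s \<tau>1 g(1,3) F] by blast
    have g0: "g 0 = s \<tau>" using g(3) by (simp add: pathstart_def)
    have "g 1 = c"
    proof (rule singular_end_at_center[of 0 1 g c G z0])
      show "continuous_on {0..1} g" using g(1) by (simp add: path_def)
      show "norm (g t - c) < R\<^sup>2" if "t \<in> {0..1}" for t
        by (rule near) (use g(2) that in \<open>auto simp: path_image_def image_subset_iff\<close>)
    qed (use cR G no g0 z0 s\<tau> in auto)
    then show "x \<in> {c}" using g(4) by (simp add: pathfinish_def)
  next
    fix x assume "x \<in> {c}"
    then have x: "x = c" by simp
    define g where "g = linepath (s \<tau>) c"
    have g: "path g" "pathstart g = s \<tau>" "pathfinish g = c" "g 0 = s \<tau>" "g 1 = c"
      unfolding g_def by (simp_all add: linepath_0' linepath_1')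
    have "convex (ball b \<rho>)" by simp
    then have gi: "path_image g \<subseteq> ball b \<rho>"
      using c s\<tau>(1) by (simp add: g_def closed_segment_subset)
    have gt: "g t \<noteq> c" if "t \<in> {0..<1}" for t
    proof -
      have "g t - c = (1 - t) *\<^sub>R (s \<tau> - c)" by (simp add: g_def linepath_def algebra_simps)
      moreover have "(1 - t) *\<^sub>R (s \<tau> - c) \<noteq> 0" using that s\<tau>(2) by simp
      ultimately show ?thesis by auto
    qed
    have gR: "norm (g t - c) < R\<^sup>2" if "t \<in> {0..1}" for t
      by (rule near) (use gi that in \<open>auto simp: path_image_def image_subset_iff\<close>)
    have gc: "continuous_on {0..1} g" using g(1) by (simp add: path_def)
    have gc': "continuous_on {0..<1} g" by (rule continuous_on_subset[OF gc]) auto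
    obtain l where l: "continuous_on {0..<1} l" "l 0 = z0" "\<And>t. t \<in> {0..<1} \<Longrightarrow> (l t)\<^sup>2 = g t - c"
      by (rule sqrt_lift[OF gc' _ _ gt, of 0 z0]) (use z0 g in auto)
    have lR: "l t \<in> ball 0 R - {0}" if "t \<in> {0..<1}" for t
      using lift_in_ball[OF l(3)[OF that]] gR[of t] gt[OF that] that by auto
    have sol: "solution_continuation p q g {0..<1} (\<lambda>t x. sol c (sqrt_branch c (l t) x))"
      using chart_continuation[OF gc' l(1,3) lR cR] .
    have val: "sol c (sqrt_branch c (l 0) (g 0)) = F \<tau> (s \<tau>)"
    proof -
      have "z0 \<noteq> 0" using z0(1) s\<tau>(2) by auto
      then show ?thesis using sqrt_branch_base[OF _ z0(1)] z0(2) l(2) g(4) by simp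
    qed
    have "\<not> (\<exists>G. solution_continuation p q g {0..1} G \<and> G 0 (g 0) = F \<tau> (s \<tau>))"
      using no_continuation_to_center[OF _ gc gt g(5) gR cR] z0 g(4) by auto
    then have "singular_at_end p q (subpath 0 \<tau> s +++ g) (F 0 (s 0))"
      unfolding singular_at_end_joined_iff[OF s \<tau>1 g(1,2) F] using sol val
      by (intro conjI exI[of _ "\<lambda>t x. sol c (sqrt_branch c (l t) x)"]) auto
    then show "x \<in> local_singularities p q s \<tau> (ball b \<rho>) (F 0 (s 0))"
      unfolding local_singularities_def using x g gi by blast
  qed
qed

text \<open>With \<open>x\<close> given the centre has to be \<open>x - z^2\<close>, which leaves
  one equation for \<open>z\<close>. The size of \<open>y\<close> and the lower bound
  \<open>m\<close> for \<open>v\<close> give \<open>|1 / (y v)| \<le> R / 2\<close>, so Brouwer's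
  theorem applies on the disc of that radius, using only the continuity of \<open>v\<close>.\<close>

lemma chart_surjective:
  assumes x: "norm (x - b) < R\<^sup>2 / 4" and y: "norm y \<ge> 2 / (R * m)"
  obtains z c where "z \<noteq> 0" "z\<^sup>2 = x - c" "c \<in> ball b (R\<^sup>2 / 2)" "y = sol c z"
proof -
  define e where "e = R / 2"
  have e: "e > 0" "e < R" using R by (auto simp: e_def)
  have "0 < 2 / (R * m)" using R m by simp
  then have y0: "y \<noteq> 0" using y by auto
  have cb: "x - z\<^sup>2 \<in> ball b (R\<^sup>2 / 2)" if "z \<in> cball 0 e" for z
  proof -
    have "norm (z\<^sup>2) \<le> e\<^sup>2" using that by (simp add: norm_power power_mono)
    then have "norm (z\<^sup>2) \<le> R\<^sup>2 / 4" by (simp add: e_def power_divide)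
    then show ?thesis using x norm_triangle_ineq4[of "x - b" "z\<^sup>2"]
      by (simp add: dist_norm norm_minus_commute algebra_simps)
  qed
  have sub: "ball b (R\<^sup>2 / 2) \<subseteq> ball b R"
  proof -
    have "R\<^sup>2 / 2 \<le> R" using R mult_left_le[of R R] unfolding power2_eq_square by linarith
    then show ?thesis by auto
  qed
  have zc: "z \<in> ball 0 R" "x - z\<^sup>2 \<in> ball b R" if "z \<in> cball 0 e" for z
    using that cb[OF that] sub e by (auto simp del: mem_ball)
  \<comment> \<open>A fixed point satisfies \<open>z v(z, x - z\<^sup>2) = 1 / y\<close>.\<close>
  obtain z where z: "z \<in> cball 0 e" "1 / y / v (z, x - z\<^sup>2) = z"
  proof (rule brouwer_ball[OF e(1), of 0 "\<lambda>z. 1 / y / v (z, x - z\<^sup>2)"])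
    have "continuous_on (ball 0 R \<times> ball b R) v" using v by (simp add: plot_holomorphic_def)
    then have "continuous_on (cball 0 e) (\<lambda>z. v (z, x - z\<^sup>2))"
      by (rule continuous_on_compose2) (use zc in \<open>auto intro!: continuous_intros\<close>)
    then show "continuous_on (cball 0 e) (\<lambda>z. 1 / y / v (z, x - z\<^sup>2))"
      using v_nz zc by (intro continuous_intros) auto
    show "(\<lambda>z. 1 / y / v (z, x - z\<^sup>2)) \<in> cball 0 e \<rightarrow> cball 0 e"
    proof
      fix z :: complex assume z: "z \<in> cball 0 e"
      have "norm (v (z, x - z\<^sup>2)) \<ge> m" using v_ge zc[OF z] by blast
      then have "2 / (R * m) * m \<le> norm y * norm (v (z, x - z\<^sup>2))"
        using y R m by (intro mult_mono) auto
      then have "1 / (norm y * norm (v (z, x - z\<^sup>2))) \<le> 1 / (2 / (R * m) * m)"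
        using R m by (intro frac_le) simp_all
      also have "\<dots> = e" using R m by (simp add: e_def)
      finally show "1 / y / v (z, x - z\<^sup>2) \<in> cball 0 e" by (simp add: norm_divide norm_mult)
    qed
  qed
  have "z \<noteq> 0" using z v_nz[OF zc[OF z(1)]] y0 by auto
  moreover have "y = sol (x - z\<^sup>2) z"
  proof -
    have "z * v (z, x - z\<^sup>2) = 1 / y"
      using z(2) v_nz[OF zc[OF z(1)]] by (metis nonzero_eq_divide_eq)
    then show ?thesis unfolding sol_def by simp
  qed
  ultimately show ?thesis using that[of z "x - z\<^sup>2"] cb[OF z(1)] by simp
qed

end

section \<open>Initial values as functions of the singularity, and the Poincare map off the
  curve\<close>

context square_root_chart
begin

lemma R_power2: "R\<^sup>2 / 2 < R" "0 < R\<^sup>2"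
proof -
  have "R * R \<le> R * 1" using R by (intro mult_left_mono) auto
  then show "R\<^sup>2 / 2 < R" using R unfolding power2_eq_square by linarith
qed (use R in simp)

text \<open>
  \<open>Y c\<close> is the initial value of the solution whose singularity near \<open>b\<close> is \<open>c\<close>: take its value at \<open>s \<tau>\<close>
  from the chart and follow the flow along \<open>s\<close> backward.
\<close>

lemma singular_family:
  assumes s: "path s" "s 1 = b" and sing: "singular_at_end p q s ya0"
  obtains \<tau> \<delta> Y where "\<tau> \<in> {0..<1}" "0 < \<delta>" "\<delta> \<le> R\<^sup>2 / 2" "s ` {\<tau>..1} \<subseteq> ball b (R\<^sup>2 / 2)"
    "Y holomorphic_on ball b \<delta>" "Y b = ya0"
    "\<And>c. c \<in> ball b \<delta> \<Longrightarrow> \<exists>F z0. solution_continuation p q s {0..\<tau>} F \<and> F 0 (s 0) = Y c \<and>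
        z0\<^sup>2 = s \<tau> - c \<and> s \<tau> \<noteq> c \<and> F \<tau> (s \<tau>) = sol c z0"
proof -
  have sc: "continuous_on {0..1} s" using s by (simp add: path_def)
  have sc': "continuous_on {0..<1} s" by (rule continuous_on_subset[OF sc]) auto
  obtain F where "solution_along p q s {0..<1} ya0 F" using sing unfolding singular_at_end_def by blast
  then have F: "solution_continuation p q s {0..<1} F" "F 0 (s 0) = ya0"
    using solution_along_iff[of "{0..<1}" s p q ya0 F] sc' by auto
  have no: "H 0 (s 0) \<noteq> F 0 (s 0)" if "solution_continuation p q s {0..1} H" for H
    using sing that F solution_along_iff[of "{0..1}" s p q ya0 H] sc unfolding singular_at_end_def by auto
  obtain d where d: "d > 0" "\<And>t. t \<in> {0..1} \<Longrightarrow> dist t 1 < d \<Longrightarrow> dist (s t) b < R\<^sup>2 / 4"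
  proof -
    have "0 < R\<^sup>2 / 4" using R_power2 by simp
    then show ?thesis
      using sc s(2) that unfolding continuous_on_iff by (metis atLeastAtMost_iff order_refl zero_le_one)
  qed
  \<comment> \<open>The parameter is taken so late that \<open>s \<tau>\<close> is near
    \<open>b\<close>, and such that the value there is large enough for
    \<open>chart_surjective\<close>.\<close>
  obtain \<tau> where \<tau>: "1 - d < \<tau>" "0 < \<tau>" "\<tau> < 1" "norm (F \<tau> (s \<tau>)) > 2 / (R * m)"
  proof (rule solution_unbounded_at_end[OF sc F(1)])
    show "H 0 (s 0) \<noteq> F 0 (s 0)" if "solution_continuation p q s {0..1} H" for H
      by (rule no[OF that])
    show "1 - d < 1" using d(1) by simp
  qed
  have near: "norm (s t - b) < R\<^sup>2 / 4" if "t \<in> {\<tau>..1}" for t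
    using d(2)[of t] that \<tau> by (auto simp: dist_norm)
  obtain z1 c1 where z1: "z1 \<noteq> 0" "z1\<^sup>2 = s \<tau> - c1" "c1 \<in> ball b (R\<^sup>2 / 2)" "F \<tau> (s \<tau>) = sol c1 z1"
    using chart_surjective[OF near[of \<tau>] less_imp_le[OF \<tau>(4)]] \<tau> by auto
  have c1R: "c1 \<in> ball b R" using z1(3) R_power2 by auto
  \<comment> \<open>The chart solution through this value is singular at some \<open>c1\<close>. As
    the given solution does not continue to the end of \<open>s\<close>, the endpoint must be that
    singularity.\<close>
  have "s 1 = c1"
  proof (rule singular_end_at_center[of \<tau> 1 s c1 F z1])
    show "continuous_on {\<tau>..1} s" by (rule continuous_on_subset[OF sc]) (use \<tau> in auto)
    show "norm (s t - c1) < R\<^sup>2" if "t \<in> {\<tau>..1}" for t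
    proof -
      have "norm (c1 - b) < R\<^sup>2 / 2" using z1(3) by (simp add: dist_norm norm_minus_commute)
      moreover have "norm (s t - c1) \<le> norm (s t - b) + norm (c1 - b)"
        using norm_triangle_ineq4[of "s t - b" "c1 - b"] by simp
      ultimately show ?thesis using near[OF that] R_power2(2) by linarith
    qed
    show "solution_continuation p q s {\<tau>..<1} F" by (rule solution_continuation_subset[OF F(1)]) (use \<tau> in auto)
    fix H assume H: "solution_continuation p q s {\<tau>..1} H"
    show "H \<tau> (s \<tau>) \<noteq> F \<tau> (s \<tau>)"
    proof
      assume eq: "H \<tau> (s \<tau>) = F \<tau> (s \<tau>)"
      have un: "{0..\<tau>} \<union> {\<tau>..1} = {0..1}" using \<tau> by auto
      have "solution_continuation p q s {0..\<tau>} F" by (rule solution_continuation_subset[OF F(1)]) (use \<tau> in auto)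
      then have "solution_continuation p q s ({0..\<tau>} \<union> {\<tau>..1}) (\<lambda>t. if t \<le> \<tau> then F t else H t)"
        by (rule solution_continuation_join[OF _ H]) (use sc un eq \<tau> in auto)
      then show False using no[of "\<lambda>t. if t \<le> \<tau> then F t else H t"] un \<tau> by simp
    qed
  qed (use \<tau> z1 c1R in auto)
  then have c1: "c1 = b" using s(2) by simp
  have F': "solution_continuation p q s {0..\<tau>} F" by (rule solution_continuation_subset[OF F(1)]) (use \<tau> in auto)
  have sc\<tau>: "continuous_on {0..\<tau>} s" by (rule continuous_on_subset[OF sc]) (use \<tau> in auto)
  obtain \<delta>1 \<Theta> where \<Theta>: "\<delta>1 > 0" "\<Theta> holomorphic_on ball (F \<tau> (s \<tau>)) \<delta>1" "\<Theta> (F \<tau> (s \<tau>)) = F 0 (s 0)"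
    "\<And>c. c \<in> ball (F \<tau> (s \<tau>)) \<delta>1 \<Longrightarrow> \<exists>G. solution_continuation p q s {0..\<tau>} G \<and> G \<tau> (s \<tau>) = c \<and> G 0 (s 0) = \<Theta> c"
    using solution_flow_backward[OF _ sc\<tau> F'] \<tau> by auto
  \<comment> \<open>The bound \<open>|z1|^2\<close> keeps \<open>s \<tau> - c\<close> so close to
    \<open>z1^2 = s \<tau> - b\<close> that one branch of the root serves for all these
    \<open>c\<close>, and it keeps \<open>c\<close> away from \<open>s \<tau>\<close>.\<close>
  define \<delta>0 where "\<delta>0 = min (R\<^sup>2 / 2) ((norm z1)\<^sup>2)"
  have \<delta>0: "\<delta>0 > 0" "\<delta>0 \<le> R\<^sup>2 / 2" "\<delta>0 \<le> (norm z1)\<^sup>2" using R_power2 z1(1) by (auto simp: \<delta>0_def)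
  \<comment> \<open>The chart coordinate of the fixed point \<open>s \<tau>\<close> relative to the
    moving centre \<open>c\<close>.\<close>
  define \<sigma> where "\<sigma> c = sqrt_branch c z1 (s \<tau>)" for c
  have \<sigma>2: "(\<sigma> c)\<^sup>2 = s \<tau> - c" for c unfolding \<sigma>_def by (rule sqrt_branch_power2[OF z1(1)])
  have \<sigma>b: "\<sigma> b = z1" unfolding \<sigma>_def by (rule sqrt_branch_base) (use z1 c1 in auto)
  have \<sigma>hol: "\<sigma> holomorphic_on ball b \<delta>0"
    unfolding \<sigma>_def
  proof (rule holomorphic_on_sqrt_branch[OF z1(1)])
    fix c assume "c \<in> ball b \<delta>0"
    then have "norm (b - c) < (norm z1)\<^sup>2" using \<delta>0 by (simp add: dist_norm)
    then show "norm (s \<tau> - c - z1\<^sup>2) < (norm z1)\<^sup>2" using z1(2) c1 by simp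
  qed (auto intro!: holomorphic_intros)
  have s\<tau>c: "s \<tau> \<noteq> c" if "c \<in> ball b \<delta>0" for c
  proof
    assume "s \<tau> = c"
    then have "norm (z1\<^sup>2) < (norm z1)\<^sup>2" using that \<delta>0 z1(2) c1 by (simp add: dist_norm norm_minus_commute)
    then show False by (simp add: norm_power)
  qed
  have cR: "c \<in> ball b R" if "c \<in> ball b \<delta>0" for c using that \<delta>0 R_power2 by auto
  have \<sigma>R: "\<sigma> c \<in> ball 0 R - {0}" if "c \<in> ball b \<delta>0" for c
  proof (rule lift_in_ball[OF \<sigma>2 _ s\<tau>c[OF that]])
    show "norm (s \<tau> - c) < R\<^sup>2"
    proof -
      have "norm (c - b) < R\<^sup>2 / 2" using that \<delta>0 by (simp add: dist_norm norm_minus_commute)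
      moreover have "norm (s \<tau> - c) \<le> norm (s \<tau> - b) + norm (c - b)"
        using norm_triangle_ineq4[of "s \<tau> - b" "c - b"] by simp
      moreover have "norm (s \<tau> - b) < R\<^sup>2 / 4" using near[of \<tau>] \<tau> by simp
      ultimately show ?thesis using R_power2(2) by linarith
    qed
  qed
  define y where "y c = sol c (\<sigma> c)" for c
  have "(\<lambda>c. v (\<sigma> c, c)) holomorphic_on ball b \<delta>0"
    by (rule plot_holomorphicD[OF v]) (use \<sigma>hol \<sigma>R cR in \<open>auto intro!: holomorphic_intros\<close>)
  moreover have "v (\<sigma> c, c) \<noteq> 0" if "c \<in> ball b \<delta>0" for c using v_nz \<sigma>R[OF that] cR[OF that] by auto
  ultimately have yhol: "y holomorphic_on ball b \<delta>0"
    unfolding y_def sol_def using \<sigma>R \<sigma>hol by (intro holomorphic_intros) auto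
  have yb: "y b = F \<tau> (s \<tau>)" using z1(4) c1 \<sigma>b by (simp add: y_def)
  have "isCont y b"
    using holomorphic_on_imp_continuous_on[OF yhol] \<delta>0(1) by (simp add: continuous_on_eq_continuous_at)
  then obtain e where e: "e > 0" "\<And>c. dist c b < e \<Longrightarrow> dist (y c) (y b) < \<delta>1"
    using \<Theta>(1) unfolding continuous_at_eps_delta dist_norm by metis
  define \<delta> where "\<delta> = min \<delta>0 e"
  have \<delta>: "\<delta> > 0" "\<delta> \<le> \<delta>0" "\<And>c. c \<in> ball b \<delta> \<Longrightarrow> y c \<in> ball (F \<tau> (s \<tau>)) \<delta>1"
    using e \<delta>0 yb by (auto simp: \<delta>_def dist_commute)
  show ?thesis
  proof (rule that[of \<tau> \<delta> "\<lambda>c. \<Theta> (y c)"])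
    show "s ` {\<tau>..1} \<subseteq> ball b (R\<^sup>2 / 2)"
    proof
      fix x assume "x \<in> s ` {\<tau>..1}"
      then obtain t where "t \<in> {\<tau>..1}" "x = s t" by auto
      moreover have "norm (s t - b) < R\<^sup>2 / 2" using near[OF \<open>t \<in> _\<close>] R_power2(2) by linarith
      ultimately show "x \<in> ball b (R\<^sup>2 / 2)" by (simp add: dist_norm norm_minus_commute)
    qed
    have "y holomorphic_on ball b \<delta>" using yhol by (rule holomorphic_on_subset) (use \<delta> in auto)
    then show "(\<lambda>c. \<Theta> (y c)) holomorphic_on ball b \<delta>"
      using holomorphic_on_compose_gen[OF _ \<Theta>(2), of y "ball b \<delta>"] \<delta>(3) by (auto simp: o_def image_subset_iff)
    fix c assume c: "c \<in> ball b \<delta>"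
    obtain G where "solution_continuation p q s {0..\<tau>} G" "G \<tau> (s \<tau>) = y c" "G 0 (s 0) = \<Theta> (y c)"
      using \<Theta>(4)[OF \<delta>(3)[OF c]] by blast
    moreover have "s \<tau> \<noteq> c" using s\<tau>c c \<delta>(2) by auto
    ultimately show "\<exists>F z0. solution_continuation p q s {0..\<tau>} F \<and> F 0 (s 0) = \<Theta> (y c) \<and>
        z0\<^sup>2 = s \<tau> - c \<and> s \<tau> \<noteq> c \<and> F \<tau> (s \<tau>) = sol c z0"
      using \<sigma>2[of c] unfolding y_def by blast
  qed (use \<tau> \<delta> \<delta>0 \<Theta>(3) yb F(2) in auto)
qed

text \<open>For a fixed disc and \<open>\<tau>\<close>, \<open>local_singularities\<close> depends
  on the initial value alone and equals \<open>{c}\<close> for \<open>Y c\<close>, hence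
  \<open>Y\<close> is injective. The injectivity of its inverse \<open>x0\<close> is recorded
  because it later shows that \<open>b - x0\<close> has a simple zero at \<open>ya0\<close>.\<close>

lemma singularity_parameter:
  assumes s: "path s" "s 1 = b" and sing: "singular_at_end p q s ya0"
  obtains \<epsilon> \<tau> x0 where "0 < \<epsilon>" "\<tau> \<in> {0..<1}" "s ` {\<tau>..1} \<subseteq> ball b (R\<^sup>2 / 2)"
    "x0 holomorphic_on ball ya0 \<epsilon>" "x0 ya0 = b" "inj_on x0 (ball ya0 \<epsilon>)"
    "\<forall>ya\<in>ball ya0 \<epsilon>. x0 ya \<in> ball b (R\<^sup>2 / 2)"
    "\<forall>ya\<in>ball ya0 \<epsilon>. \<exists>F z0. solution_continuation p q s {0..\<tau>} F \<and> F 0 (s 0) = ya \<and>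
        z0\<^sup>2 = s \<tau> - x0 ya \<and> s \<tau> \<noteq> x0 ya \<and> F \<tau> (s \<tau>) = sol (x0 ya) z0"
    "\<forall>ya\<in>ball ya0 \<epsilon>. local_singularities p q s \<tau> (ball b (R\<^sup>2 / 2)) ya = {x0 ya}"
proof -
  obtain \<tau> \<delta> Y where \<tau>: "\<tau> \<in> {0..<1}" and \<delta>: "0 < \<delta>" "\<delta> \<le> R\<^sup>2 / 2" and si: "s ` {\<tau>..1} \<subseteq> ball b (R\<^sup>2 / 2)"
    and Y: "Y holomorphic_on ball b \<delta>" "Y b = ya0"
    and fam: "\<And>c. c \<in> ball b \<delta> \<Longrightarrow> \<exists>F z0. solution_continuation p q s {0..\<tau>} F \<and> F 0 (s 0) = Y c \<and>
        z0\<^sup>2 = s \<tau> - c \<and> s \<tau> \<noteq> c \<and> F \<tau> (s \<tau>) = sol c z0"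
    using singular_family[OF s sing] by blast
  have loc: "local_singularities p q s \<tau> (ball b (R\<^sup>2 / 2)) (Y c) = {c}" if c: "c \<in> ball b \<delta>" for c
  proof -
    obtain F z0 where F: "solution_continuation p q s {0..\<tau>} F" "F 0 (s 0) = Y c"
        "z0\<^sup>2 = s \<tau> - c" "s \<tau> \<noteq> c" "F \<tau> (s \<tau>) = sol c z0"
      using fam[OF c] by blast
    have "s \<tau> \<in> ball b (R\<^sup>2 / 2)" using si \<tau> by (auto simp: image_subset_iff)
    then show ?thesis
      using local_singularities_eq[OF s(1) \<tau> _ _ _ _ F(4,1,3,5), of "R\<^sup>2 / 2"] c \<delta> R_power2 F(2) by auto
  qed
  have inj: "inj_on Y (ball b \<delta>)"
  proof (rule inj_onI)
    fix c c' assume c: "c \<in> ball b \<delta>" "c' \<in> ball b \<delta>" and eq: "Y c = Y c'"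
    have "{c} = local_singularities p q s \<tau> (ball b (R\<^sup>2 / 2)) (Y c)" by (rule loc[OF c(1), symmetric])
    also have "\<dots> = {c'}" unfolding eq by (rule loc[OF c(2)])
    finally show "c = c'" by (rule singleton_inject)
  qed
  obtain x0 where x0: "x0 holomorphic_on Y ` ball b \<delta>" "\<forall>c\<in>ball b \<delta>. x0 (Y c) = c"
    by (rule holomorphic_has_inverse[OF Y(1) open_ball inj]) blast
  have "open (Y ` ball b \<delta>)" by (rule open_mapping_thm3[OF Y(1) open_ball inj])
  moreover have "ya0 \<in> Y ` ball b \<delta>" using Y(2) \<delta>(1) by (metis centre_in_ball imageI)
  ultimately obtain \<epsilon> where \<epsilon>: "\<epsilon> > 0" "ball ya0 \<epsilon> \<subseteq> Y ` ball b \<delta>"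
    using open_contains_ball by blast
  have x0Y: "x0 ya \<in> ball b \<delta> \<and> Y (x0 ya) = ya" if "ya \<in> ball ya0 \<epsilon>" for ya
  proof -
    obtain c where "c \<in> ball b \<delta>" "ya = Y c" using \<epsilon>(2) \<open>ya \<in> _\<close> by blast
    then show ?thesis using x0(2) by simp
  qed
  show ?thesis
  proof (rule that[OF \<epsilon>(1) \<tau> si])
    show "x0 holomorphic_on ball ya0 \<epsilon>" using x0(1) \<epsilon>(2) by (rule holomorphic_on_subset)
    show "x0 ya0 = b" using bspec[OF x0(2), of b] Y(2) \<delta>(1) by simp
    show "inj_on x0 (ball ya0 \<epsilon>)" by (rule inj_on_inverseI[of _ Y]) (rule x0Y[THEN conjunct2])
    show "\<forall>ya\<in>ball ya0 \<epsilon>. x0 ya \<in> ball b (R\<^sup>2 / 2)"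
    proof
      fix ya assume "ya \<in> ball ya0 \<epsilon>"
      then show "x0 ya \<in> ball b (R\<^sup>2 / 2)" using x0Y[of ya] \<delta>(2) by auto
    qed
    show "\<forall>ya\<in>ball ya0 \<epsilon>. \<exists>F z0. solution_continuation p q s {0..\<tau>} F \<and> F 0 (s 0) = ya \<and>
        z0\<^sup>2 = s \<tau> - x0 ya \<and> s \<tau> \<noteq> x0 ya \<and> F \<tau> (s \<tau>) = sol (x0 ya) z0"
    proof
      fix ya assume "ya \<in> ball ya0 \<epsilon>"
      note ya = x0Y[OF this]
      show "\<exists>F z0. solution_continuation p q s {0..\<tau>} F \<and> F 0 (s 0) = ya \<and>
          z0\<^sup>2 = s \<tau> - x0 ya \<and> s \<tau> \<noteq> x0 ya \<and> F \<tau> (s \<tau>) = sol (x0 ya) z0"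
        using fam[of "x0 ya"] ya by simp
    qed
    show "\<forall>ya\<in>ball ya0 \<epsilon>. local_singularities p q s \<tau> (ball b (R\<^sup>2 / 2)) ya = {x0 ya}"
    proof
      fix ya assume "ya \<in> ball ya0 \<epsilon>"
      note ya = x0Y[OF this]
      show "local_singularities p q s \<tau> (ball b (R\<^sup>2 / 2)) ya = {x0 ya}"
        using loc[of "x0 ya"] ya by simp
    qed
  qed
qed

text \<open>As the path avoids \<open>c\<close>, the root of \<open>s t - c\<close> can be followed
  from \<open>\<tau>\<close> to the end, and the chart gives the value at \<open>b\<close>. Applying
  \<open>solution_flow\<close> to the continuation so obtained along all of \<open>s\<close> gives
  definedness and holomorphy for nearby initial values.\<close>

lemma poincare_map_off_curve:
  assumes s: "path s" "s 1 = b" and \<tau>: "\<tau> \<in> {0..<1}" and si: "s ` {\<tau>..1} \<subseteq> ball b (R\<^sup>2 / 2)"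
    and c: "c \<in> ball b (R\<^sup>2 / 2)" "c \<notin> path_image s"
    and F: "solution_continuation p q s {0..\<tau>} F" "z0\<^sup>2 = s \<tau> - c" "F \<tau> (s \<tau>) = sol c z0"
  shows "\<forall>\<^sub>F w in nhds (F 0 (s 0)). poincare_defined p q s w"
    and "poincare_map p q s analytic_on {F 0 (s 0)}"
    and "\<exists>z. z\<^sup>2 = b - c \<and> poincare_map p q s (F 0 (s 0)) = sol c z"
proof -
  have sc: "continuous_on {0..1} s" using s by (simp add: path_def)
  have sc': "continuous_on {\<tau>..1} s" by (rule continuous_on_subset[OF sc]) (use \<tau> in auto)
  have ne: "s t \<noteq> c" if "t \<in> {\<tau>..1}" for t
    using c(2) that \<tau> by (auto simp: path_image_def)
  have cR: "c \<in> ball b R" using c R_power2 by auto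
  obtain l where l: "continuous_on {\<tau>..1} l" "l \<tau> = z0" "\<And>t. t \<in> {\<tau>..1} \<Longrightarrow> (l t)\<^sup>2 = s t - c"
    by (rule sqrt_lift[OF sc' _ _ ne F(2)]) (use \<tau> in auto)
  have lR: "l t \<in> ball 0 R - {0}" if t: "t \<in> {\<tau>..1}" for t
  proof (rule lift_in_ball[OF l(3)[OF t] _ ne[OF t]])
    have "s t \<in> ball b (R\<^sup>2 / 2)" using si t by (auto simp: image_subset_iff)
    then show "norm (s t - c) < R\<^sup>2"
      using c(1) dist_triangle2[of "s t" c b] by (simp add: dist_norm norm_minus_commute)
  qed
  have base: "sqrt_branch c (l t) (s t) = l t" if "t \<in> {\<tau>..1}" for t
    using sqrt_branch_base[of "l t" "s t" c] l(3)[OF that] lR[OF that] by auto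
  have G: "solution_continuation p q s {\<tau>..1} (\<lambda>t x. sol c (sqrt_branch c (l t) x))"
    using chart_continuation[OF sc' l(1,3) lR cR] .
  have un: "{0..\<tau>} \<union> {\<tau>..1} = {0..1}" using \<tau> by auto
  define H where "H t = (if t \<le> \<tau> then F t else (\<lambda>x. sol c (sqrt_branch c (l t) x)))" for t
  have "solution_continuation p q s ({0..\<tau>} \<union> {\<tau>..1}) H"
    unfolding H_def
    by (rule solution_continuation_join[OF F(1) G]) (use sc un \<tau> F(3) base l(2) in auto)
  then have H: "solution_continuation p q s {0..1} H" "H 0 (s 0) = F 0 (s 0)" "H 1 (s 1) = sol c (l 1)"
    using un \<tau> base[of 1] by (auto simp: H_def)
  have "poincare_map p q s (F 0 (s 0)) = sol c (l 1)"
    using poincare_map_eq[OF s(1) H(1,2)] H(3) by simp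
  then show "\<exists>z. z\<^sup>2 = b - c \<and> poincare_map p q s (F 0 (s 0)) = sol c z"
    using l(3)[of 1] \<tau> s(2) by (intro exI[of _ "l 1"]) simp
  obtain \<delta> \<Theta> where \<Theta>: "\<delta> > 0" "\<Theta> holomorphic_on ball (F 0 (s 0)) \<delta>" "\<Theta> (F 0 (s 0)) = H 1 (s 1)"
    "\<And>w. w \<in> ball (F 0 (s 0)) \<delta> \<Longrightarrow> \<exists>G. solution_continuation p q s {0..1} G \<and> G 0 (s 0) = w \<and> G 1 (s 1) = \<Theta> w"
    using solution_flow[OF _ sc H(1)] unfolding H(2) by auto
  have def: "poincare_defined p q s w" "poincare_map p q s w = \<Theta> w" if w: "w \<in> ball (F 0 (s 0)) \<delta>" for w
  proof -
    obtain G where G: "solution_continuation p q s {0..1} G" "G 0 (s 0) = w" "G 1 (s 1) = \<Theta> w"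
      using \<Theta>(4)[OF w] by blast
    show "poincare_defined p q s w"
      unfolding poincare_defined_def using solution_along_iff[of "{0..1}" s p q w G] sc G by auto
    show "poincare_map p q s w = \<Theta> w" using poincare_map_eq[OF s(1) G(1,2)] G(3) by simp
  qed
  have in_ball: "F 0 (s 0) \<in> ball (F 0 (s 0)) \<delta>" using \<Theta>(1) by simp
  show "\<forall>\<^sub>F w in nhds (F 0 (s 0)). poincare_defined p q s w"
    unfolding eventually_nhds using def(1) in_ball by (intro exI[of _ "ball (F 0 (s 0)) \<delta>"]) auto
  have "poincare_map p q s holomorphic_on ball (F 0 (s 0)) \<delta>"
    using \<Theta>(2) by (rule holomorphic_transform) (use def(2) in auto)
  then show "poincare_map p q s analytic_on {F 0 (s 0)}"
    using in_ball by (intro holomorphic_on_imp_analytic_at[OF _ open_ball])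
qed

end

subsection \<open>The double-valued continuation\<close>

lemma germ_continuation_unique:
  assumes H0: "germ_continuation U f g H0" and H: "germ_continuation U f g H"
  shows "H 1 (pathfinish g) = H0 1 (pathfinish g)"
proof -
  have "germ_eq (H 0) (H0 0) (g 0)"
    using H0 H unfolding germ_continuation_def germ_eq_def pathstart_def
    by (auto elim: eventually_elim2)
  then have "germ_eq (H 1) (H0 1) (g 1)"
    by (intro analytic_continuation_unique[of "{0..1}" g H H0 0 1])
      (use H H0 in \<open>auto simp: germ_continuation_def path_def\<close>)
  then show ?thesis by (simp add: germ_eq_at pathfinish_def)
qed

lemma square_in_punctured_ball:
  fixes r z0 :: complex
  shows "r \<in> ball 0 (sqrt \<epsilon>) - {0} \<longleftrightarrow> z0 + r\<^sup>2 \<in> ball z0 \<epsilon> - {z0}"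
proof -
  have "norm r < sqrt \<epsilon> \<longleftrightarrow> (norm r)\<^sup>2 < \<epsilon>"
    using real_sqrt_less_iff[of "(norm r)\<^sup>2" \<epsilon>] by simp
  then show ?thesis by (auto simp: dist_norm norm_power)
qed

text \<open>The root \<open>r\<close> in \<open>PB\<close> may vary from point to point. Since
  \<open>P ya = B r1\<close> differs from \<open>B (- r1)\<close>, continuity excludes the opposite
  branch near \<open>ya\<close>, so \<open>P\<close> agrees there with \<open>B\<close> of a single
  holomorphic branch.\<close>

lemma square_root_germ:
  fixes B :: "complex \<Rightarrow> complex"
  assumes \<epsilon>: "D = ball 0 (sqrt \<epsilon>) - {0}"
    and B: "B holomorphic_on D" and ne: "\<And>r. r \<in> D \<Longrightarrow> B r \<noteq> B (- r)"
    and ya: "ya \<in> ball z0 \<epsilon> - {z0}" and P: "P analytic_on {ya}"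
    and PB: "\<forall>\<^sub>F w in nhds ya. \<exists>r. r\<^sup>2 = w - z0 \<and> P w = B r"
  obtains r1 where "r1 \<in> D" "r1\<^sup>2 = ya - z0" "germ_eq (\<lambda>w. B (sqrt_branch z0 r1 w)) P ya"
proof -
  obtain r1 where r1: "r1\<^sup>2 = ya - z0" "P ya = B r1"
    using eventually_nhds_x_imp_x[OF PB] by blast
  have r1D: "r1 \<in> D" using square_in_punctured_ball[of r1 \<epsilon> z0] r1(1) ya \<epsilon> by simp
  then have r10: "r1 \<noteq> 0" using \<epsilon> by auto
  have oD: "open D" unfolding \<epsilon> by (intro open_delete open_ball)
  have mD: "- r1 \<in> D" using r1D \<epsilon> by auto
  let ?s = "sqrt_branch z0 r1"
  have s0: "?s ya = r1" by (rule sqrt_branch_base[OF r10 r1(1)])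
  have "(?s \<longlongrightarrow> ?s ya) (nhds ya)"
    using isCont_sqrt_branch[OF r10 r1(1)] by (simp only: isCont_def tendsto_at_iff_tendsto_nhds)
  then have sc: "(?s \<longlongrightarrow> r1) (nhds ya)" unfolding s0 .
  have Bc: "isCont B (- r1)"
    using holomorphic_on_imp_continuous_on[OF B] mD oD by (simp add: continuous_on_eq_continuous_at)
  have Pc: "(P \<longlongrightarrow> P ya) (nhds ya)"
    using analytic_at_imp_isCont[OF P] by (simp add: isCont_def tendsto_at_iff_tendsto_nhds)
  have "((\<lambda>w. P w - B (- ?s w)) \<longlongrightarrow> P ya - B (- r1)) (nhds ya)"
    by (intro tendsto_diff Pc isCont_tendsto_compose[OF Bc] tendsto_minus sc)
  moreover have "P ya - B (- r1) \<noteq> 0" using ne[OF r1D] r1(2) by simp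
  ultimately have "\<forall>\<^sub>F w in nhds ya. P w - B (- ?s w) \<noteq> 0" by (rule tendsto_imp_eventually_ne)
  then have "germ_eq (\<lambda>w. B (?s w)) P ya"
    unfolding germ_eq_def using PB
  proof eventually_elim
    case (elim w)
    then obtain r where r: "r\<^sup>2 = w - z0" "P w = B r" by blast
    then have "r\<^sup>2 = (?s w)\<^sup>2" by (simp add: sqrt_branch_power2[OF r10])
    then have "r = ?s w \<or> r = - ?s w" by (simp add: power2_eq_iff)
    then show ?case using elim(1) r(2) by auto
  qed
  then show ?thesis using that r1(1) r1D by blast
qed

lemma square_root_continuation:
  fixes B :: "complex \<Rightarrow> complex"
  assumes D: "D = ball 0 (sqrt \<epsilon>) - {0}" and B: "B holomorphic_on D"
    and g: "path g" "path_image g \<subseteq> ball z0 \<epsilon> - {z0}"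
    and l: "continuous_on {0..1} l" "\<And>t. t \<in> {0..1} \<Longrightarrow> (l t)\<^sup>2 = g t - z0"
    and P: "germ_eq (\<lambda>w. B (sqrt_branch z0 (l 0) w)) P (g 0)"
  shows "germ_continuation (ball z0 \<epsilon> - {z0}) P g (\<lambda>t w. B (sqrt_branch z0 (l t) w))"
    and "B (sqrt_branch z0 (l 1) (pathfinish g)) = B (l 1)"
proof -
  have lD: "l t \<in> D" if "t \<in> {0..1}" for t
  proof -
    have "z0 + (l t)\<^sup>2 \<in> ball z0 \<epsilon> - {z0}" using l(2)[OF that] g(2) that by (auto simp: path_image_def image_subset_iff)
    then show ?thesis using square_in_punctured_ball D by blast
  qed
  then have l0: "l t \<noteq> 0" if "t \<in> {0..1}" for t using that D by auto
  have gc: "continuous_on {0..1} g" using g(1) by (simp add: path_def)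
  have "analytic_continuation g {0..1} (\<lambda>t w. B (sqrt_branch z0 (l t) w))"
  proof (rule analytic_continuation_sqrt_branch[where D = D and l = l])
    show "open D" unfolding D by (intro open_delete open_ball)
  qed (use gc l l0 B lD in auto)
  then show "germ_continuation (ball z0 \<epsilon> - {z0}) P g (\<lambda>t w. B (sqrt_branch z0 (l t) w))"
    using g P unfolding germ_continuation_def germ_eq_def pathstart_def by blast
  show "B (sqrt_branch z0 (l 1) (pathfinish g)) = B (l 1)"
    using sqrt_branch_base[OF l0 l(2), of 1] by (simp add: pathfinish_def)
qed

text \<open>The map \<open>r \<mapsto> z0 + r^2\<close> is a two-sheeted covering of the punctured
  disc by \<open>D\<close>, and \<open>P\<close> is locally \<open>B\<close> read on one sheet.
  Lifting a path gives its continuation, and both sheets are reached because \<open>D\<close> is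
  path-connected.\<close>

lemma double_valued_continuation:
  fixes B :: "complex \<Rightarrow> complex"
  assumes D: "D = ball 0 (sqrt \<epsilon>) - {0}"
    and B: "B holomorphic_on D" and ne: "\<And>r. r \<in> D \<Longrightarrow> B r \<noteq> B (- r)"
    and ya: "ya \<in> ball z0 \<epsilon> - {z0}" and P: "P analytic_on {ya}"
    and PB: "\<forall>\<^sub>F w in nhds ya. \<exists>r. r\<^sup>2 = w - z0 \<and> P w = B r"
  shows "path g \<Longrightarrow> path_image g \<subseteq> ball z0 \<epsilon> - {z0} \<Longrightarrow> pathstart g = ya \<Longrightarrow>
      \<exists>H. germ_continuation (ball z0 \<epsilon> - {z0}) P g H"
    and "z \<in> ball z0 \<epsilon> - {z0} \<Longrightarrow>
      continuation_values (ball z0 \<epsilon> - {z0}) P ya z = {B r | r. r\<^sup>2 = z - z0}"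
proof -
  let ?U = "ball z0 \<epsilon> - {z0}"
  obtain r1 where r1: "r1 \<in> D" "r1\<^sup>2 = ya - z0" "germ_eq (\<lambda>w. B (sqrt_branch z0 r1 w)) P ya"
    by (rule square_root_germ[OF D B ne ya P PB])
  have lift: "\<exists>H r. germ_continuation ?U P g H \<and> r\<^sup>2 = pathfinish g - z0 \<and> H 1 (pathfinish g) = B r"
    if g: "path g" "path_image g \<subseteq> ?U" "pathstart g = ya" for g
  proof -
    have gc: "continuous_on {0..1} g" using g(1) by (simp add: path_def)
    have gne: "g t \<noteq> z0" if "t \<in> {0..1}" for t using g(2) that by (auto simp: path_image_def image_subset_iff)
    have g0: "g 0 = ya" using g(3) by (simp add: pathstart_def)
    obtain l where l: "continuous_on {0..1} l" "l 0 = r1" "\<And>t. t \<in> {0..1} \<Longrightarrow> (l t)\<^sup>2 = g t - z0"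
      by (rule sqrt_lift[OF gc _ _ gne, of 0 r1]) (use r1 g0 in auto)
    have P0: "germ_eq (\<lambda>w. B (sqrt_branch z0 (l 0) w)) P (g 0)" using r1(3) g0 l(2) by simp
    show ?thesis
      using square_root_continuation[OF D B g(1,2) l(1,3) P0] l(3)[of 1]
      by (intro exI[of _ "\<lambda>t w. B (sqrt_branch z0 (l t) w)"] exI[of _ "l 1"]) (simp add: pathfinish_def)
  qed
  show "path g \<Longrightarrow> path_image g \<subseteq> ?U \<Longrightarrow> pathstart g = ya \<Longrightarrow> \<exists>H. germ_continuation ?U P g H"
    using lift by blast
  assume z: "z \<in> ?U"
  show "continuation_values ?U P ya z = {B r | r. r\<^sup>2 = z - z0}"
  proof (rule set_eqI, rule iffI)
    fix y assume "y \<in> continuation_values ?U P ya z"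
    then obtain g H where H: "germ_continuation ?U P g H" "pathstart g = ya" "pathfinish g = z" "y = H 1 z"
      unfolding continuation_values_def by blast
    then obtain H0 r where "germ_continuation ?U P g H0" "r\<^sup>2 = z - z0" "H0 1 z = B r"
      using lift[of g] unfolding germ_continuation_def by blast
    then show "y \<in> {B r | r. r\<^sup>2 = z - z0}" using germ_continuation_unique[of ?U P g H0 H] H by auto
  next
    fix y assume "y \<in> {B r | r. r\<^sup>2 = z - z0}"
    then obtain r where r: "r\<^sup>2 = z - z0" "y = B r" by blast
    have "r \<in> D" using square_in_punctured_ball[of r \<epsilon> z0] r(1) z D by simp
    moreover have "path_connected D" unfolding D by (intro path_connected_punctured_ball) simp
    ultimately obtain l where l: "path l" "path_image l \<subseteq> D" "pathstart l = r1" "pathfinish l = r"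
      using r1(1) unfolding path_connected_def by blast
    \<comment> \<open>The projection of a path in \<open>D\<close> from \<open>r1\<close> to the
      wanted root; its lift is known by construction.\<close>
    define g where "g t = z0 + (l t)\<^sup>2" for t
    have lc: "continuous_on {0..1} l" using l(1) by (simp add: path_def)
    have g: "path g" unfolding path_def g_def by (intro continuous_intros lc)
    have "g t \<in> ?U" if "t \<in> {0..1}" for t
      unfolding g_def using l(2) that square_in_punctured_ball[of "l t" \<epsilon> z0] D
      by (auto simp: path_image_def image_subset_iff)
    then have gU: "path_image g \<subseteq> ?U" unfolding path_image_def by blast
    have g0: "g 0 = ya" "pathstart g = ya" "pathfinish g = z"
      using l(3,4) r r1(2) by (auto simp: g_def pathstart_def pathfinish_def)
    have P0: "germ_eq (\<lambda>w. B (sqrt_branch z0 (l 0) w)) P (g 0)"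
      using r1(3) g0(1) l(3) by (simp add: pathstart_def)
    have lg: "(l t)\<^sup>2 = g t - z0" for t by (simp add: g_def)
    have l1: "l 1 = r" using l(4) by (simp add: pathfinish_def)
    show "y \<in> continuation_values ?U P ya z"
      unfolding continuation_values_def
      using square_root_continuation[OF D B g gU lc lg P0] g0 r(2) l1
      by (intro CollectI exI[of _ g] exI[of _ "\<lambda>t w. B (sqrt_branch z0 (l t) w)"] conjI) simp_all
  qed
qed

section \<open>The Puiseux parametrization\<close>

context square_root_chart
begin

text \<open>Injectivity of \<open>x0\<close> makes the zero of \<open>b - x0\<close> at
  \<open>ya0\<close> simple and unique, so \<open>b - x0(ya) = (ya - ya0) k(ya)\<close> without
  zeros of \<open>k\<close>. On a disc \<open>k\<close> has a holomorphic logarithm and hence a root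
  \<open>\<kappa>\<close>. The pole of \<open>sol\<close> then splits off as \<open>1 / r\<close>,
  and the remaining factor \<open>N = 1 / (\<kappa> v)\<close> is holomorphic without zeros.\<close>

lemma puiseux_parametrization:
  assumes \<epsilon>: "\<epsilon> > 0" and x0: "x0 holomorphic_on ball ya0 \<epsilon>" "x0 ya0 = b" "inj_on x0 (ball ya0 \<epsilon>)"
    and x0b: "\<forall>ya\<in>ball ya0 \<epsilon>. x0 ya \<in> ball b (R\<^sup>2 / 2)"
  obtains N where "N holomorphic_on ball 0 (sqrt \<epsilon>)" "\<forall>r\<in>ball 0 (sqrt \<epsilon>). N r \<noteq> 0"
    "\<forall>ya\<in>ball ya0 \<epsilon> - {ya0}. \<forall>z. z\<^sup>2 = b - x0 ya \<longrightarrow> (\<exists>r. r\<^sup>2 = ya - ya0 \<and> sol (x0 ya) z = N r / r)"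
proof -
  define f where "f z = b - x0 z" for z
  define k where "k z = (if z = ya0 then deriv f ya0 else (f z - f ya0) / (z - ya0))" for z
  have f: "f holomorphic_on ball ya0 \<epsilon>" unfolding f_def using x0(1) by (intro holomorphic_intros)
  have f0: "f ya0 = 0" using x0(2) by (simp add: f_def)
  have finj: "inj_on f (ball ya0 \<epsilon>)" using x0(3) by (auto simp: inj_on_def f_def)
  have k: "k holomorphic_on ball ya0 \<epsilon>" unfolding k_def by (rule pole_lemma_open[OF f open_ball])
  have k0: "k z \<noteq> 0" if z: "z \<in> ball ya0 \<epsilon>" for z
  proof (cases "z = ya0")
    case True
    then show ?thesis
      using holomorphic_injective_imp_regular[OF f open_ball finj, of ya0] \<epsilon> by (simp add: k_def)
  next
    case False
    then have "f z \<noteq> f ya0" using finj z \<epsilon> by (auto dest: inj_onD)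
    then show ?thesis using False by (simp add: k_def)
  qed
  obtain g where g: "g holomorphic_on ball ya0 \<epsilon>" "\<And>z. z \<in> ball ya0 \<epsilon> \<Longrightarrow> exp (g z) = k z"
    using holomorphic_logarithm_exists[OF convex_ball open_ball k k0, of ya0] \<epsilon> by auto
  define \<kappa> where "\<kappa> z = exp (g z / 2)" for z
  have \<kappa>2: "(\<kappa> z)\<^sup>2 = k z" if "z \<in> ball ya0 \<epsilon>" for z
    using g(2)[OF that] by (simp add: \<kappa>_def exp_double[symmetric])
  have yb: "ya0 + r\<^sup>2 \<in> ball ya0 \<epsilon>" if "r \<in> ball 0 (sqrt \<epsilon>)" for r
    using that square_in_punctured_ball[of r \<epsilon> ya0] \<epsilon> by (cases "r = 0") auto
  \<comment> \<open>With \<open>b - x0 z = (z - ya0) (\<kappa> z)\<^sup>2\<close>, the chart coordinate of \<open>b\<close> is \<open>Z r\<close> where \<open>r\<^sup>2 = z - ya0\<close>.\<close>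
  define Z where "Z r = r * \<kappa> (ya0 + r\<^sup>2)" for r
  have Z2: "(Z r)\<^sup>2 = b - x0 (ya0 + r\<^sup>2)" if "r \<in> ball 0 (sqrt \<epsilon>)" for r
    using \<kappa>2[OF yb[OF that]] f0 by (auto simp: Z_def power_mult_distrib k_def f_def)
  have ZR: "Z r \<in> ball 0 R" if "r \<in> ball 0 (sqrt \<epsilon>)" for r
  proof -
    have "norm (b - x0 (ya0 + r\<^sup>2)) < R\<^sup>2 / 2" using bspec[OF x0b yb[OF that]] by (simp add: dist_norm)
    then have "norm ((Z r)\<^sup>2) < R\<^sup>2" unfolding Z2[OF that] using R_power2(2) by linarith
    then show ?thesis using R by (simp add: norm_power power2_less_imp_less)
  qed
  have xR: "x0 (ya0 + r\<^sup>2) \<in> ball b R" if "r \<in> ball 0 (sqrt \<epsilon>)" for r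
    using bspec[OF x0b yb[OF that]] R_power2(1) by auto
  have sq: "(\<lambda>r. ya0 + r\<^sup>2) holomorphic_on ball 0 (sqrt \<epsilon>)" "(\<lambda>r. ya0 + r\<^sup>2) ` ball 0 (sqrt \<epsilon>) \<subseteq> ball ya0 \<epsilon>"
    using yb by (auto intro!: holomorphic_intros simp del: mem_ball)
  have \<kappa>h: "(\<lambda>r. \<kappa> (ya0 + r\<^sup>2)) holomorphic_on ball 0 (sqrt \<epsilon>)"
  proof -
    have "\<kappa> holomorphic_on ball ya0 \<epsilon>" unfolding \<kappa>_def using g(1) by (intro holomorphic_intros) auto
    from holomorphic_on_compose_gen[OF sq(1) this sq(2)] show ?thesis by (simp add: o_def)
  qed
  have xh: "(\<lambda>r. x0 (ya0 + r\<^sup>2)) holomorphic_on ball 0 (sqrt \<epsilon>)"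
    using holomorphic_on_compose_gen[OF sq(1) x0(1) sq(2)] by (simp add: o_def)
  have vh: "(\<lambda>r. v (Z r, x0 (ya0 + r\<^sup>2))) holomorphic_on ball 0 (sqrt \<epsilon>)"
  proof (rule plot_holomorphicD[OF v open_ball _ xh])
    show "Z holomorphic_on ball 0 (sqrt \<epsilon>)" unfolding Z_def using \<kappa>h by (intro holomorphic_intros)
  qed (use ZR xR in auto)
  define N where "N r = 1 / (\<kappa> (ya0 + r\<^sup>2) * v (Z r, x0 (ya0 + r\<^sup>2)))" for r
  have den: "\<kappa> (ya0 + r\<^sup>2) * v (Z r, x0 (ya0 + r\<^sup>2)) \<noteq> 0" if "r \<in> ball 0 (sqrt \<epsilon>)" for r
    using v_nz[OF ZR[OF that] xR[OF that]] by (simp add: \<kappa>_def)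
  have sN: "sol (x0 (ya0 + r\<^sup>2)) (Z r) = N r / r" for r
    by (simp add: sol_def N_def Z_def)
  show ?thesis
  proof (rule that[of N])
    show "N holomorphic_on ball 0 (sqrt \<epsilon>)"
      unfolding N_def using \<kappa>h vh den by (intro holomorphic_intros)
    show "\<forall>r\<in>ball 0 (sqrt \<epsilon>). N r \<noteq> 0" using den by (simp add: N_def)
    show "\<forall>ya\<in>ball ya0 \<epsilon> - {ya0}. \<forall>z. z\<^sup>2 = b - x0 ya \<longrightarrow> (\<exists>r. r\<^sup>2 = ya - ya0 \<and> sol (x0 ya) z = N r / r)"
    proof (intro ballI allI impI)
      fix ya z assume ya: "ya \<in> ball ya0 \<epsilon> - {ya0}" and z: "z\<^sup>2 = b - x0 ya"
      define r where "r = csqrt (ya - ya0)"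
      have r2: "r\<^sup>2 = ya - ya0" by (simp add: r_def)
      then have yar: "ya = ya0 + r\<^sup>2" by simp
      then have rb: "r \<in> ball 0 (sqrt \<epsilon>)" using square_in_punctured_ball[of r \<epsilon> ya0] ya by auto
      have "z\<^sup>2 = (Z r)\<^sup>2" using Z2[OF rb] z by (simp only: yar[symmetric])
      then have "z = Z r \<or> z = - Z r" by (simp only: power2_eq_iff)
      \<comment> \<open>Since \<open>\<kappa>\<close> is evaluated at a function of
        \<open>r^2\<close>, \<open>Z\<close> is odd: the other root of \<open>b - x0 ya\<close>
        belongs to the other root of \<open>ya - ya0\<close>.\<close>
      moreover have "- Z r = Z (- r)" by (simp add: Z_def)
      ultimately have "z = Z r \<or> z = Z (- r)" by metis
      then show "\<exists>r. r\<^sup>2 = ya - ya0 \<and> sol (x0 ya) z = N r / r"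
      proof
        assume "z = Z r"
        then show ?thesis using sN[of r] r2 unfolding yar[symmetric] by blast
      next
        assume "z = Z (- r)"
        then show ?thesis
          using sN[of "- r"] r2 unfolding power2_minus yar[symmetric] by (intro exI[of _ "- r"]) simp
      qed
    qed
  qed
qed

end

theorem theorem4p1:
  fixes p q :: "complex poly" and s :: "real \<Rightarrow> complex" and a b ya0 :: complex
  assumes "path s" and "pathstart s = a" and "pathfinish s = b"
    and "poly q b \<noteq> 0"
    and "singular_at_end p q s ya0"
  shows "\<exists>\<epsilon>>0. \<exists>(x0 :: complex \<Rightarrow> complex) (\<phi> :: complex \<Rightarrow> complex set) (\<nu> :: nat \<Rightarrow> complex).
    moving_singularity p q s ya0 \<epsilon> x0 \<and>
    (let U0 = ball ya0 \<epsilon> - {ya0}; \<gamma> = singular_curve s ya0 \<epsilon> x0; P = poincare_map p q s in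
      (\<forall>ya \<in> ball ya0 \<epsilon> - \<gamma>. (\<forall>\<^sub>F w in nhds ya. poincare_defined p q s w) \<and> P analytic_on {ya}) \<and>
      (\<forall>ya \<in> U0 - \<gamma>. \<forall>g. path g \<and> path_image g \<subseteq> U0 \<and> pathstart g = ya \<longrightarrow>
         (\<exists>H. germ_continuation U0 P g H)) \<and>
      (\<forall>ya \<in> U0 - \<gamma>. \<forall>z \<in> U0. continuation_values U0 P ya z = \<phi> z) \<and>
      (\<forall>z \<in> U0. card (\<phi> z) = 2) \<and>
      \<nu> 0 \<noteq> 0 \<and>
      (\<forall>z \<in> U0. (\<forall>r. r ^ 2 = z - ya0 \<longrightarrow> summable (\<lambda>k. \<nu> k * r ^ k)) \<and>
         \<phi> z = {1 / r * (\<Sum>k. \<nu> k * r ^ k) | r. r ^ 2 = z - ya0}))"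
proof -
  obtain R m v where "square_root_chart p q b R m v"
    by (rule square_root_chart_exists[OF assms(4)])
  then interpret square_root_chart p q b R m v .
  have s1: "s 1 = b" using assms(3) by (simp add: pathfinish_def)
  obtain \<epsilon>1 \<tau> x0 where \<epsilon>1: "0 < \<epsilon>1" and \<tau>: "\<tau> \<in> {0..<1}" and si: "s ` {\<tau>..1} \<subseteq> ball b (R\<^sup>2 / 2)"
    and x0: "x0 holomorphic_on ball ya0 \<epsilon>1" "x0 ya0 = b" "inj_on x0 (ball ya0 \<epsilon>1)"
    and x0b: "\<forall>ya\<in>ball ya0 \<epsilon>1. x0 ya \<in> ball b (R\<^sup>2 / 2)"
    and fam: "\<forall>ya\<in>ball ya0 \<epsilon>1. \<exists>F z0. solution_continuation p q s {0..\<tau>} F \<and> F 0 (s 0) = ya \<and>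
        z0\<^sup>2 = s \<tau> - x0 ya \<and> s \<tau> \<noteq> x0 ya \<and> F \<tau> (s \<tau>) = sol (x0 ya) z0"
    and loc: "\<forall>ya\<in>ball ya0 \<epsilon>1. local_singularities p q s \<tau> (ball b (R\<^sup>2 / 2)) ya = {x0 ya}"
    by (rule singularity_parameter[OF assms(1) s1 assms(5)])
  obtain N where N: "N holomorphic_on ball 0 (sqrt \<epsilon>1)" "\<forall>r\<in>ball 0 (sqrt \<epsilon>1). N r \<noteq> 0"
    and par: "\<forall>ya\<in>ball ya0 \<epsilon>1 - {ya0}. \<forall>z. z\<^sup>2 = b - x0 ya \<longrightarrow> (\<exists>r. r\<^sup>2 = ya - ya0 \<and> sol (x0 ya) z = N r / r)"
    by (rule puiseux_parametrization[OF \<epsilon>1 x0 x0b])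
  have N0: "N 0 \<noteq> 0" using N(2) \<epsilon>1 by simp
  have "isCont N 0"
    using holomorphic_on_imp_continuous_on[OF N(1)] \<epsilon>1 by (simp add: continuous_on_eq_continuous_at)
  then obtain d where d: "d > 0" "\<And>r. norm r < d \<Longrightarrow> norm (N r - N 0) < norm (N 0)"
    using N0 unfolding continuous_at_eps_delta dist_norm by (metis diff_zero zero_less_norm_iff)
  \<comment> \<open>The values \<open>N r / r\<close> and \<open>N (- r) / (- r)\<close> coincide
    exactly when this sum vanishes; near 0 it is close to \<open>2 * N 0\<close>.\<close>
  have Npm: "N r + N (- r) \<noteq> 0" if "norm r < d" for r
  proof
    assume "N r + N (- r) = 0"
    then have "(N r - N 0) + (N (- r) - N 0) = - (2 * N 0)" by (simp add: algebra_simps)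
    then have "2 * norm (N 0) \<le> norm (N r - N 0) + norm (N (- r) - N 0)"
      using norm_triangle_ineq[of "N r - N 0" "N (- r) - N 0"] by (simp add: norm_mult)
    then show False using d(2)[of r] d(2)[of "- r"] that by simp
  qed
  \<comment> \<open>The bound \<open>d^2\<close> in the \<open>ya\<close>-plane corresponds to
    \<open>|r| < d\<close>, where the two values are distinct.\<close>
  define \<epsilon> where "\<epsilon> = min \<epsilon>1 (d\<^sup>2)"
  have \<epsilon>: "\<epsilon> > 0" "\<epsilon> \<le> \<epsilon>1" "sqrt \<epsilon> \<le> d" "sqrt \<epsilon> \<le> sqrt \<epsilon>1"
    using \<epsilon>1 d(1) by (auto simp: \<epsilon>_def intro: real_le_lsqrt)
  have sub: "ball ya0 \<epsilon> \<subseteq> ball ya0 \<epsilon>1" "ball (0::complex) (sqrt \<epsilon>) \<subseteq> ball 0 (sqrt \<epsilon>1)"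
    using \<epsilon>(2,4) by (auto intro!: subset_ball simp del: real_sqrt_le_iff)
  define U0 where "U0 = ball ya0 \<epsilon> - {ya0}"
  define D where "D = ball (0::complex) (sqrt \<epsilon>) - {0}"
  define B where "B r = N r / r" for r
  define P where "P = poincare_map p q s"
  define \<phi> where "\<phi> z = {B r | r. r\<^sup>2 = z - ya0}" for z
  \<comment> \<open>Taylor coefficients of \<open>N\<close> at 0; the series in \<open>r\<close>
    converges on the whole disc of radius \<open>sqrt \<epsilon>\<close>, hence the Puiseux series
    on all of \<open>U0\<close>.\<close>
  define \<nu> where "\<nu> k = (deriv ^^ k) N 0 / fact k" for k
  have NB: "N holomorphic_on ball 0 (sqrt \<epsilon>)" using N(1) sub(2) by (rule holomorphic_on_subset)
  have Bh: "B holomorphic_on D"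
    unfolding B_def D_def by (intro holomorphic_intros holomorphic_on_subset[OF NB]) auto
  have Bne: "B r \<noteq> B (- r)" if "r \<in> D" for r
  proof
    assume "B r = B (- r)"
    then have "N r + N (- r) = 0" using that by (simp add: B_def D_def field_simps)
    then show False using Npm[of r] that \<epsilon>(3) by (auto simp: D_def)
  qed
  have rD: "r \<in> D" if "z \<in> U0" "r\<^sup>2 = z - ya0" for r z
    using square_in_punctured_ball[of r \<epsilon> ya0] that by (simp add: D_def U0_def)
  have moving: "moving_singularity p q s ya0 \<epsilon> x0"
    unfolding moving_singularity_def
  proof (intro conjI exI[of _ "R\<^sup>2 / 2"] bexI[of _ \<tau>] ballI)
    show "x0 holomorphic_on ball ya0 \<epsilon>" using x0(1) sub(1) by (rule holomorphic_on_subset)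
    show "local_singularities p q s \<tau> (ball (pathfinish s) (R\<^sup>2 / 2)) ya = {x0 ya}" if "ya \<in> ball ya0 \<epsilon>" for ya
      using loc that sub(1) assms(3) by blast
  qed (use x0(2) assms(3) R_power2 \<tau> si in auto)
  have off: "(\<forall>\<^sub>F w in nhds ya. poincare_defined p q s w) \<and> P analytic_on {ya} \<and> (\<exists>r. r\<^sup>2 = ya - ya0 \<and> P ya = B r)"
    if ya: "ya \<in> ball ya0 \<epsilon>" "x0 ya \<notin> path_image s" for ya
  proof -
    have ya1: "ya \<in> ball ya0 \<epsilon>1" using ya sub(1) by blast
    \<comment> \<open>The endpoint belongs to the path, so \<open>ya0\<close> lies on the curve and
      a point off the curve is in the punctured disc.\<close>
    have "b \<in> path_image s" using assms(3) by (metis pathfinish_in_path_image)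
    then have "ya \<noteq> ya0" using ya(2) x0(2) by auto
    obtain F z0 where F: "solution_continuation p q s {0..\<tau>} F" "F 0 (s 0) = ya" "z0\<^sup>2 = s \<tau> - x0 ya" "F \<tau> (s \<tau>) = sol (x0 ya) z0"
      using bspec[OF fam ya1] by blast
    note off = poincare_map_off_curve[OF assms(1) s1 \<tau> si bspec[OF x0b ya1] ya(2) F(1,3,4), unfolded F(2)]
    obtain z where "z\<^sup>2 = b - x0 ya" "P ya = sol (x0 ya) z" using off(3) unfolding P_def by blast
    then show ?thesis
      using off(1,2) par ya1 \<open>ya \<noteq> ya0\<close> unfolding P_def B_def by auto
  qed
  \<comment> \<open>Being off the curve is an open condition because the image of \<open>s\<close>
    is closed; so the pointwise description of \<open>P\<close> holds throughout a neighbourhood,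
    with no control yet over the choice of the root.\<close>
  have PB: "\<forall>\<^sub>F w in nhds ya. \<exists>r. r\<^sup>2 = w - ya0 \<and> P w = B r"
    if ya: "ya \<in> ball ya0 \<epsilon>" "x0 ya \<notin> path_image s" for ya
  proof -
    have "continuous_on (ball ya0 \<epsilon>) x0"
      using x0(1) sub(1) holomorphic_on_imp_continuous_on holomorphic_on_subset by blast
    then have "open (ball ya0 \<epsilon> \<inter> x0 -` (- path_image s))"
      by (rule continuous_open_preimage) (use closed_path_image[OF assms(1)] in auto)
    then show ?thesis
      unfolding eventually_nhds using ya off by (intro exI[of _ "ball ya0 \<epsilon> \<inter> x0 -` (- path_image s)"]) auto
  qed
  note dv = double_valued_continuation[OF D_def Bh Bne _ _ PB, folded U0_def]
  have \<gamma>: "ya \<in> ball ya0 \<epsilon> \<and> x0 ya \<notin> path_image s" if "ya \<in> ball ya0 \<epsilon> - singular_curve s ya0 \<epsilon> x0" for ya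
    using that by (auto simp: singular_curve_def)
  have U0: "ya \<in> ball ya0 \<epsilon> \<and> x0 ya \<notin> path_image s" if "ya \<in> U0 - singular_curve s ya0 \<epsilon> x0" for ya
    using that by (auto simp: singular_curve_def U0_def)
  have sums: "(\<lambda>k. \<nu> k * r ^ k) sums N r" if "r \<in> D" for r
    using holomorphic_power_series[OF NB, of r] that by (simp add: \<nu>_def D_def)
  have two: "card (\<phi> z) = 2" if z: "z \<in> U0" for z
  proof -
    define r where "r = csqrt (z - ya0)"
    have r: "r\<^sup>2 = z - ya0" by (simp add: r_def)
    have "\<phi> z = {B r, B (- r)}"
      unfolding \<phi>_def r[symmetric] by (auto simp: power2_eq_iff)
    then show ?thesis using Bne[OF rD[OF z r]] by simp
  qed
  have series: "\<phi> z = {1 / r * (\<Sum>k. \<nu> k * r ^ k) | r. r ^ 2 = z - ya0}" if z: "z \<in> U0" for z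
  proof -
    have "B r = 1 / r * (\<Sum>k. \<nu> k * r ^ k)" if "r\<^sup>2 = z - ya0" for r
      using sums_unique[OF sums[OF rD[OF z that]]] by (simp add: B_def)
    then show ?thesis unfolding \<phi>_def by (intro Collect_cong) metis
  qed
  show ?thesis
  proof (unfold Let_def, intro exI[of _ \<epsilon>] exI[of _ x0] exI[of _ \<phi>] exI[of _ \<nu>] conjI ballI allI impI,
      fold U0_def P_def)
    show "\<epsilon> > 0" by (rule \<epsilon>)
    show "moving_singularity p q s ya0 \<epsilon> x0" by (rule moving)
    fix ya assume "ya \<in> ball ya0 \<epsilon> - singular_curve s ya0 \<epsilon> x0"
    then show "\<forall>\<^sub>F w in nhds ya. poincare_defined p q s w" "P analytic_on {ya}" using off \<gamma> by blast+
  next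
    fix ya g assume ya: "ya \<in> U0 - singular_curve s ya0 \<epsilon> x0" and "path g \<and> path_image g \<subseteq> U0 \<and> pathstart g = ya"
    then show "\<exists>H. germ_continuation U0 P g H"
      using dv(1)[of ya g] off[of ya] U0[OF ya] by blast
  next
    fix ya z assume ya: "ya \<in> U0 - singular_curve s ya0 \<epsilon> x0" and "z \<in> U0"
    then show "continuation_values U0 P ya z = \<phi> z"
      using dv(2)[of ya z] off[of ya] U0[OF ya] unfolding \<phi>_def by blast
  next
    show "card (\<phi> z) = 2" if "z \<in> U0" for z by (rule two[OF that])
    show "\<nu> 0 \<noteq> 0" using N0 by (simp add: \<nu>_def)
    show "summable (\<lambda>k. \<nu> k * r ^ k)" if "z \<in> U0" "r\<^sup>2 = z - ya0" for z r
      using sums[OF rD[OF that]] by (rule sums_summable)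
    show "\<phi> z = {1 / r * (\<Sum>k. \<nu> k * r ^ k) | r. r ^ 2 = z - ya0}" if "z \<in> U0" for z
      by (rule series[OF that])
  qed
qed

end
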